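(* Suppose that $k$ is an algebraically closed field of characteristic $0$ and $n$ is a positive integer. Let $\mathcal{L}=\mathrm{LT}(\mathfrak{s},\boldsymbol{\sigma},\mathfrak{h})$ and $\mathcal{L}'=\mathrm{LT}(\mathfrak{s}',\boldsymbol{\sigma}',\mathfrak{h}')$ be multiloop Lie $\mathbb{Z}^n$-tori. Then $\mathcal{L}$ and $\mathcal{L}'$ are bi-isomorphic if and only if there exist a matrix $P=(p_{ij})\in\mathrm{GL}_n(\mathbb{Z})$ and an algebra isomorphism $\varphi:\mathfrak{s}\to\mathfrak{s}'$ such that $$\boldsymbol{\sigma}'=\varphi\,\boldsymbol{\sigma}^P\varphi^{-1}.$$ Moreover, in that case, $\varphi$ can be chosen with the additional property that $\varphi(\mathfrak{h})=\mathfrak{h}'$.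
   Context: Sequences of automorphisms. For a sequence $\boldsymbol{\sigma}=(\sigma_1,\dots,\sigma_n)$ of pairwise commuting finite order automorphisms of an algebra and $P=(p_{ij})\in\mathrm{Mat}_n(\mathbb{Z})$, $\boldsymbol{\sigma}^P=(\prod_i\sigma_i^{p_{i1}},\dots,\prod_i\sigma_i^{p_{in}})$, and $\varphi\boldsymbol{\sigma}\varphi^{-1}=(\varphi\sigma_1\varphi^{-1},\dots,\varphi\sigma_n\varphi^{-1})$. Root systems. A finite irreducible root system is a finite subset $\Delta$ of a finite dimensional $k$-vector space with $0\in\Delta$ such that $\Delta\setminus\{0\}$ is a (nonempty) irreducible, not necessarily reduced, root system in the usual sense. $\Delta_{\mathrm{sh}}$ is the set of nonzero roots of minimum length. $\Delta_{\mathrm{en}}=\Delta\cup 2\Delta_{\mathrm{sh}}$ if $\Delta$ has type B$_\ell$, $\ell\ge1$ (B$_1$ means A$_1$), and $\Delta_{\mathrm{en}}=\Delta$ otherwise. Multiloop Lie tori. Fix primitive $\ell$-th roots of unity $\zeta_\ell\in k^\times$ ($\ell\ge1$) with $\zeta_{m\ell}^m=\zeta_\ell$ for all $\ell,m\geq 1$. Let $\mathfrak{s}$ be a finite dimensional simple Lie algebra over $k$, $\boldsymbol{\sigma}=(\sigma_1,\dots,\sigma_n)$ a sequence of pairwise commuting finite order automorphisms of $\mathfrak{s}$, $m_i=|\sigma_i|$, $\bar\Lambda=\mathbb{Z}/(m_1)\oplus\dots\oplus\mathbb{Z}/(m_n)$, $\lambda\mapsto\bar\lambda$ the canonical map $\mathbb{Z}^n\to\bar\Lambda$,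 and for $\lambda=(\ell_1,\dots,\ell_n)$ let $\mathfrak{s}^{\bar\lambda}=\{x\in\mathfrak{s}:\sigma_jx=\zeta_{m_j}^{\ell_j}x,\ 1\le j\le n\}$. Let $\mathfrak{g}=\mathfrak{s}^{\boldsymbol{\sigma}}=\mathfrak{s}^{\bar0}$ be the fixed point subalgebra. Assume: (A1) $\mathfrak{g}$ is a simple Lie algebra. (A2) If $0\ne\bar\lambda\in\bar\Lambda$ and $\mathfrak{s}^{\bar\lambda}\ne0$, then $\mathfrak{s}^{\bar\lambda}\simeq U^{\bar\lambda}\oplus V^{\bar\lambda}$ as a $\mathfrak{g}$-module, where $\mathfrak{g}$ acts trivially on $U^{\bar\lambda}$ and either $V^{\bar\lambda}=0$ or $V^{\bar\lambda}$ satisfies condition (M). (A3) $|\langle\sigma_1,\dots,\sigma_n\rangle|=\prod_i|\sigma_i|$. Here a finite dimensional $\mathfrak{g}$-module $V$ satisfies (M) if $V$ is irreducible of dimension $>1$ and its weights relative to a Cartan subalgebra $\mathfrak{h}$ of $\mathfrak{g}$ lie in $\Delta(\mathfrak{g},\mathfrak{h})_{\mathrm{en}}$. For an ad-diagonalizable subalgebra $\mathfrak{h}$ of a Lie algebra $\mathfrak{a}$, $\mathfrak{a}_\alpha=\{x:[h,x]=\alpha(h)x\ \forall h\in\mathfrak{h}\}$ and $\Delta(\mathfrak{a},\mathfrak{h})=\{\alpha\in\mathfrak{h}^*:\mathfrak{a}_\alpha\ne0\}$. Let $\mathfrak{h}$ be a Cartan subalgebra of $\mathfrak{g}$, $\Delta=\Delta(\mathfrak{s},\mathfrak{h})$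 (which is then a finite irreducible root system in $\mathfrak{h}^*$), $Q=\mathrm{span}_{\mathbb{Z}}(\Delta)$. The multiloop Lie $\mathbb{Z}^n$-torus determined by $\mathfrak{s},\boldsymbol{\sigma},\mathfrak{h}$ is $\mathrm{LT}(\mathfrak{s},\boldsymbol{\sigma},\mathfrak{h})=\sum_{\lambda\in\mathbb{Z}^n}\mathfrak{s}^{\bar\lambda}\otimes z^\lambda\subseteq\mathfrak{s}\otimes k[z_1^{\pm1},\dots,z_n^{\pm1}]$ with the $Q\times\mathbb{Z}^n$-grading whose $(\alpha,\lambda)$-component is $(\mathfrak{s}_\alpha\cap\mathfrak{s}^{\bar\lambda})\otimes z^\lambda$. Saying that $\mathrm{LT}(\mathfrak{s},\boldsymbol{\sigma},\mathfrak{h})$ is a multiloop Lie $\mathbb{Z}^n$-torus means that the data satisfy all these assumptions. Bi-isomorphism. A $Q\times\Lambda$-graded algebra $\mathcal{L}$ and a $Q'\times\Lambda'$-graded algebra $\mathcal{L}'$ are bi-isomorphic if there are an algebra isomorphism $\psi:\mathcal{L}\to\mathcal{L}'$ and group isomorphisms $\psi_r:Q\to Q'$, $\psi_e:\Lambda\to\Lambda'$ with $\psi(\mathcal{L}_\alpha^\lambda)={\mathcal{L}'}_{\psi_r(\alpha)}^{\psi_e(\lambda)}$ for all $\alpha,\lambda$ (here $\Lambda=\Lambda'=\mathbb{Z}^n$ and $Q$, $Q'$ are the root lattices of $\Delta(\mathfrak{s},\mathfrak{h})$, $\Delta(\mathfrak{s}',\mathfrak{h}')$). *)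

theory Defs
  imports
    "HOL-Analysis.Analysis"
    "HOL-Algebra.Multiplicative_Group"
    "HOL-Algebra.Generated_Groups"
    "HOL-Algebra.FiniteProduct"
    "HOL-Computational_Algebra.Polynomial"
    "HOL-Computational_Algebra.Group_Closure"
    "HOL-Library.Function_Algebras"
    "HOL-Library.Poly_Mapping"
begin

section \<open>Homomorphisms on carriers\<close>

definition algebra_iso ::
  "('k \<Rightarrow> 'a::plus \<Rightarrow> 'a) \<Rightarrow> ('a \<Rightarrow> 'a \<Rightarrow> 'a) \<Rightarrow> 'a set \<Rightarrow>
   ('k \<Rightarrow> 'b::plus \<Rightarrow> 'b) \<Rightarrow> ('b \<Rightarrow> 'b \<Rightarrow> 'b) \<Rightarrow> 'b set \<Rightarrow> ('a \<Rightarrow> 'b) \<Rightarrow> bool" where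
  "algebra_iso sc mul A sc' mul' B f \<longleftrightarrow>
     bij_betw f A B \<and>
     (\<forall>x\<in>A. \<forall>y\<in>A. f (x + y) = f x + f y) \<and>
     (\<forall>c. \<forall>x\<in>A. f (sc c x) = sc' c (f x)) \<and>
     (\<forall>x\<in>A. \<forall>y\<in>A. f (mul x y) = mul' (f x) (f y))"

definition additive_iso :: "'a::plus set \<Rightarrow> 'b::plus set \<Rightarrow> ('a \<Rightarrow> 'b) \<Rightarrow> bool" where
  "additive_iso A B f \<longleftrightarrow> bij_betw f A B \<and> (\<forall>x\<in>A. \<forall>y\<in>A. f (x + y) = f x + f y)"

section \<open>Bi-graded algebras\<close>

text \<open>An algebra graded by \<open>Q \<times> \<Lambda>\<close>, where \<open>Q\<close> is the subgroup \<open>ga_lattice\<close> of an abelian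
  group type \<open>'q\<close> and \<open>\<Lambda>\<close> is the whole abelian group type \<open>'l\<close>.\<close>

record ('k, 'x, 'q, 'l) bigraded_algebra =
  ga_scale :: "'k \<Rightarrow> 'x \<Rightarrow> 'x"
  ga_mult :: "'x \<Rightarrow> 'x \<Rightarrow> 'x"
  ga_space :: "'x set"
  ga_lattice :: "'q set"
  ga_comp :: "'q \<Rightarrow> 'l \<Rightarrow> 'x set"

definition bi_isomorphic ::
  "('k, 'x::plus, 'q::plus, 'l::plus) bigraded_algebra \<Rightarrow>
   ('k, 'y::plus, 'r::plus, 'm::plus) bigraded_algebra \<Rightarrow> bool" where
  "bi_isomorphic L L' \<longleftrightarrow>
     (\<exists>\<psi> \<psi>r \<psi>e.
        algebra_iso (ga_scale L) (ga_mult L) (ga_space L) (ga_scale L') (ga_mult L') (ga_space L') \<psi> \<and>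
        additive_iso (ga_lattice L) (ga_lattice L') \<psi>r \<and>
        additive_iso UNIV UNIV \<psi>e \<and>
        (\<forall>\<alpha>\<in>ga_lattice L. \<forall>l. \<psi> ` ga_comp L \<alpha> l = ga_comp L' (\<psi>r \<alpha>) (\<psi>e l)))"

section \<open>Short roots and the enlarged root system\<close>

text \<open>A finite irreducible root system \<open>R\<close> (with \<open>0 \<in> R\<close>) carries a symmetric bilinear form, invariant
  under the Weyl group and with positive rational values \<open>B \<alpha> \<alpha>\<close> on the nonzero roots; it is unique
  up to a positive rational factor, and root lengths are measured by it. The last condition says that
  the \<open>B\<close>-orthogonal reflection in each nonzero root preserves \<open>R\<close>; as \<open>R\<close> is finite and spanning, this
  reflection is then the reflection of the root system.\<close>

definition root_length_form ::
  "('k::field_char_0 \<Rightarrow> 'v::ab_group_add \<Rightarrow> 'v) \<Rightarrow> 'v set \<Rightarrow> ('v \<Rightarrow> 'v \<Rightarrow> 'k) \<Rightarrow> bool" where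
  "root_length_form sc R B \<longleftrightarrow>
     (\<forall>x\<in>module.span sc R. \<forall>y\<in>module.span sc R. B x y = B y x) \<and>
     (\<forall>x\<in>module.span sc R. \<forall>y\<in>module.span sc R. \<forall>z\<in>module.span sc R. B (x + y) z = B x z + B y z) \<and>
     (\<forall>c. \<forall>x\<in>module.span sc R. \<forall>y\<in>module.span sc R. B (sc c x) y = c * B x y) \<and>
     (\<forall>\<alpha>\<in>R - {0}. \<exists>q::rat. q > 0 \<and> B \<alpha> \<alpha> = of_rat q) \<and>
     (\<forall>\<alpha>\<in>R - {0}. \<forall>\<beta>\<in>R. \<beta> - sc (2 * B \<beta> \<alpha> / B \<alpha> \<alpha>) \<alpha> \<in> R)"

definition short_roots :: "('k::field_char_0 \<Rightarrow> 'v::ab_group_add \<Rightarrow> 'v) \<Rightarrow> 'v set \<Rightarrow> 'v set" where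
  "short_roots sc R =
     {\<alpha> \<in> R - {0}. \<exists>B. root_length_form sc R B \<and>
        (\<forall>\<beta>\<in>R - {0}. \<exists>p q::rat. B \<alpha> \<alpha> = of_rat p \<and> B \<beta> \<beta> = of_rat q \<and> p \<le> q)}"

text \<open>Type \<open>B\<close> of rank \<open>card E\<close>, in the standard coordinates. For \<open>card E = 1\<close> this is type \<open>A\<^sub>1\<close>.\<close>

definition type_B :: "('k::field_char_0 \<Rightarrow> 'v::ab_group_add \<Rightarrow> 'v) \<Rightarrow> 'v set \<Rightarrow> bool" where
  "type_B sc R \<longleftrightarrow>
     (\<exists>E. finite E \<and> E \<noteq> {} \<and> \<not> module.dependent sc E \<and>
        R - {0} = E \<union> uminus ` E \<union>
          {a + b | a b. \<exists>e\<in>E. \<exists>f\<in>E. e \<noteq> f \<and> a \<in> {e, - e} \<and> b \<in> {f, - f}})"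

definition enlarged :: "('k::field_char_0 \<Rightarrow> 'v::ab_group_add \<Rightarrow> 'v) \<Rightarrow> 'v set \<Rightarrow> 'v set" where
  "enlarged sc R = (if type_B sc R then R \<union> sc 2 ` short_roots sc R else R)"

section \<open>Lie algebras\<close>

locale lie_algebra = vector_space scale
  for scale :: "'k::field_char_0 \<Rightarrow> 'a::ab_group_add \<Rightarrow> 'a" (infixr \<open>*s\<close> 75) +
  fixes bracket :: "'a \<Rightarrow> 'a \<Rightarrow> 'a"
  assumes bracket_add_left: "bracket (x + y) z = bracket x z + bracket y z"
    and bracket_add_right: "bracket x (y + z) = bracket x y + bracket x z"
    and bracket_scale_left: "bracket (c *s x) y = c *s bracket x y"
    and bracket_scale_right: "bracket x (c *s y) = c *s bracket x y"
    and bracket_self: "bracket x x = 0"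
    and jacobi: "bracket x (bracket y z) + bracket y (bracket z x) + bracket z (bracket x y) = 0"
begin

definition subalgebra :: "'a set \<Rightarrow> bool" where
  "subalgebra A \<longleftrightarrow> subspace A \<and> (\<forall>x\<in>A. \<forall>y\<in>A. bracket x y \<in> A)"

definition lie_ideal :: "'a set \<Rightarrow> 'a set \<Rightarrow> bool" where
  "lie_ideal A I \<longleftrightarrow> subspace I \<and> I \<subseteq> A \<and> (\<forall>x\<in>A. \<forall>y\<in>I. bracket x y \<in> I)"

definition simple_lie :: "'a set \<Rightarrow> bool" where
  "simple_lie A \<longleftrightarrow> subalgebra A \<and> (\<exists>x\<in>A. \<exists>y\<in>A. bracket x y \<noteq> 0) \<and>
     (\<forall>I. lie_ideal A I \<longrightarrow> I = {0} \<or> I = A)"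

primrec lower_central :: "'a set \<Rightarrow> nat \<Rightarrow> 'a set" where
  "lower_central A 0 = A"
| "lower_central A (Suc i) = span {bracket x y | x y. x \<in> A \<and> y \<in> lower_central A i}"

definition nilpotent_lie :: "'a set \<Rightarrow> bool" where
  "nilpotent_lie A \<longleftrightarrow> (\<exists>i. lower_central A i = {0})"

definition cartan_subalgebra :: "'a set \<Rightarrow> 'a set \<Rightarrow> bool" where
  "cartan_subalgebra A H \<longleftrightarrow> subalgebra H \<and> H \<subseteq> A \<and> nilpotent_lie H \<and>
     {x \<in> A. \<forall>y\<in>H. bracket x y \<in> H} = H"

subsection \<open>Modules and weights\<close>

text \<open>All modules that occur are subspaces of the ambient Lie algebra, stable under the bracket
  action of the subalgebra \<open>G\<close>.\<close>

definition submodule :: "'a set \<Rightarrow> 'a set \<Rightarrow> bool" where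
  "submodule G V \<longleftrightarrow> subspace V \<and> (\<forall>x\<in>G. \<forall>v\<in>V. bracket x v \<in> V)"

definition irreducible_module :: "'a set \<Rightarrow> 'a set \<Rightarrow> bool" where
  "irreducible_module G V \<longleftrightarrow> submodule G V \<and> V \<noteq> {0} \<and>
     (\<forall>W. submodule G W \<and> W \<subseteq> V \<longrightarrow> W = {0} \<or> W = V)"

text \<open>The dual space of a subspace \<open>H\<close>: a functional on \<open>H\<close> is represented by its extension by \<open>0\<close> to
  the whole type, so that equality and the pointwise operations are those of the function type.\<close>

definition dual_space :: "'a set \<Rightarrow> ('a \<Rightarrow> 'k) set" where
  "dual_space H = {\<alpha>. (\<forall>x\<in>H. \<forall>y\<in>H. \<alpha> (x + y) = \<alpha> x + \<alpha> y) \<and>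
     (\<forall>c. \<forall>x\<in>H. \<alpha> (c *s x) = c * \<alpha> x) \<and> (\<forall>x. x \<notin> H \<longrightarrow> \<alpha> x = 0)}"

definition scale_fun :: "'k \<Rightarrow> ('a \<Rightarrow> 'k) \<Rightarrow> 'a \<Rightarrow> 'k" where
  "scale_fun c \<alpha> = (\<lambda>x. c * \<alpha> x)"

definition weight_space :: "'a set \<Rightarrow> 'a set \<Rightarrow> ('a \<Rightarrow> 'k) \<Rightarrow> 'a set" where
  "weight_space H V \<alpha> = {v \<in> V. \<forall>h\<in>H. bracket h v = \<alpha> h *s v}"

text \<open>For \<open>V = A\<close> a subalgebra containing \<open>H\<close>, the set \<open>weights H A\<close> is the root system \<open>\<Delta>(A, H)\<close>; it
  contains \<open>0\<close> whenever the centralizer of \<open>H\<close> in \<open>A\<close> is nonzero.\<close>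

definition weights :: "'a set \<Rightarrow> 'a set \<Rightarrow> ('a \<Rightarrow> 'k) set" where
  "weights H V = {\<alpha> \<in> dual_space H. weight_space H V \<alpha> \<noteq> {0}}"

text \<open>Over an algebraically closed field Cartan subalgebras are conjugate, so the choice of \<open>H\<close> below is
  immaterial.\<close>

definition condition_M :: "'a set \<Rightarrow> 'a set \<Rightarrow> bool" where
  "condition_M G V \<longleftrightarrow> irreducible_module G V \<and> dim V > 1 \<and>
     (\<exists>H. cartan_subalgebra G H \<and> weights H V \<subseteq> enlarged scale_fun (weights H G))"

subsection \<open>Automorphisms\<close>

definition aut_group :: "('a \<Rightarrow> 'a) monoid" where
  "aut_group = \<lparr>carrier = {f. algebra_iso scale bracket UNIV scale bracket UNIV f},
     mult = (\<circ>), one = id\<rparr>"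

text \<open>\<open>group.ord\<close> is \<open>0\<close> for elements of infinite order.\<close>

definition aut_order :: "('a \<Rightarrow> 'a) \<Rightarrow> nat" where
  "aut_order f = group.ord aut_group f"

text \<open>\<open>aut_group\<close> is not commutative, but the product below does not depend on the order of the
  factors when the \<open>\<sigma> i\<close> commute pairwise; see \<open>finprod_aut_insert\<close>.\<close>

definition seq_power :: "('n::finite \<Rightarrow> 'a \<Rightarrow> 'a) \<Rightarrow> int^'n^'n \<Rightarrow> 'n \<Rightarrow> 'a \<Rightarrow> 'a" where
  "seq_power \<sigma> P = (\<lambda>j. \<Otimes>\<^bsub>aut_group\<^esub>i\<in>UNIV. \<sigma> i [^]\<^bsub>aut_group\<^esub> (P $ i $ j))"

lemma vector_space_scale_fun: "vector_space scale_fun"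
  by unfold_locales (auto simp: scale_fun_def fun_eq_iff algebra_simps)

lemma group_aut_group: "group aut_group"
proof (rule groupI)
  fix f assume f: "f \<in> carrier aut_group"
  then have b: "bij f" and a: "\<And>x y. f (x + y) = f x + f y" and s: "\<And>c x. f (c *s x) = c *s f x"
    and m: "\<And>x y. f (bracket x y) = bracket (f x) (f y)"
    by (auto simp: aut_group_def algebra_iso_def)
  have i: "inv_into UNIV f z = w \<longleftrightarrow> z = f w" for z w
    using b by (metis bij_inv_eq_iff)
  have r: "f (inv_into UNIV f z) = z" for z
    using i by metis
  have "inv_into UNIV f \<in> carrier aut_group"
    using bij_imp_bij_inv[OF b] by (auto simp: aut_group_def algebra_iso_def i a s m r)
  moreover have "inv_into UNIV f \<circ> f = id"
    using b by (simp add: bij_is_inj)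
  ultimately show "\<exists>g\<in>carrier aut_group. g \<otimes>\<^bsub>aut_group\<^esub> f = \<one>\<^bsub>aut_group\<^esub>"
    by (intro bexI[of _ "inv_into UNIV f"]) (simp_all add: aut_group_def)
qed (auto simp: aut_group_def algebra_iso_def comp_assoc intro: bij_comp)

lemma finprod_aut_insert:
  fixes \<tau> :: "'i \<Rightarrow> 'a \<Rightarrow> 'a"
  assumes "finite A" "i \<notin> A" and aut: "\<And>j. \<tau> j \<in> carrier aut_group"
    and comm: "\<And>j l. \<tau> j \<circ> \<tau> l = \<tau> l \<circ> \<tau> j"
  shows "finprod aut_group \<tau> (insert i A) = \<tau> i \<circ> finprod aut_group \<tau> A"
proof -
  interpret group aut_group by (rule group_aut_group)
  have mult: "f \<otimes>\<^bsub>aut_group\<^esub> g = f \<circ> g" for f g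
    by (simp add: aut_group_def)
  have "LCD UNIV (carrier aut_group) (mult aut_group \<circ> \<tau>)"
  proof
    fix j l g
    show "(mult aut_group \<circ> \<tau>) j ((mult aut_group \<circ> \<tau>) l g)
      = (mult aut_group \<circ> \<tau>) l ((mult aut_group \<circ> \<tau>) j g)"
      using comm[of j l] by (simp add: mult flip: comp_assoc)
  qed (use aut in simp)
  from LCD.foldD_insert[OF this assms(1,2)] show ?thesis
    using assms(1) by (simp add: finprod_def mult)
qed

subsection \<open>Loop algebras\<close>

text \<open>\<open>\<ss> \<otimes> k[z\<^sub>1\<^sup>\<plusminus>\<^sup>1, \<dots>, z\<^sub>n\<^sup>\<plusminus>\<^sup>1]\<close> is represented by the finitely supported functions from \<open>int^'n\<close> to the Lie
  algebra, with \<open>x \<otimes> z\<^sup>l\<close> as \<open>Poly_Mapping.single l x\<close>.\<close>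

definition loop_scale :: "'k \<Rightarrow> ((int^'n::finite) \<Rightarrow>\<^sub>0 'a) \<Rightarrow> (int^'n) \<Rightarrow>\<^sub>0 'a" where
  "loop_scale c f = Poly_Mapping.map (scale c) f"

definition loop_bracket ::
  "((int^'n::finite) \<Rightarrow>\<^sub>0 'a) \<Rightarrow> ((int^'n) \<Rightarrow>\<^sub>0 'a) \<Rightarrow> (int^'n) \<Rightarrow>\<^sub>0 'a" where
  "loop_bracket f g =
     (\<Sum>l\<in>Poly_Mapping.keys f. \<Sum>m\<in>Poly_Mapping.keys g.
        Poly_Mapping.single (l + m) (bracket (Poly_Mapping.lookup f l) (Poly_Mapping.lookup g m)))"

definition fixed_points :: "('n::finite \<Rightarrow> 'a \<Rightarrow> 'a) \<Rightarrow> 'a set" where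
  "fixed_points \<sigma> = {x. \<forall>j. \<sigma> j x = x}"

text \<open>The eigenspace depends on \<open>l\<close> only through the residues of \<open>l $ j\<close> modulo the order of \<open>\<sigma> j\<close>.\<close>

definition eigenspace :: "(nat \<Rightarrow> 'k) \<Rightarrow> ('n::finite \<Rightarrow> 'a \<Rightarrow> 'a) \<Rightarrow> int^'n \<Rightarrow> 'a set" where
  "eigenspace \<zeta> \<sigma> l = {x. \<forall>j. \<sigma> j x = (\<zeta> (aut_order (\<sigma> j)) powi (l $ j)) *s x}"

definition LT ::
  "(nat \<Rightarrow> 'k) \<Rightarrow> ('n::finite \<Rightarrow> 'a \<Rightarrow> 'a) \<Rightarrow> 'a set \<Rightarrow>
   ('k, (int^'n) \<Rightarrow>\<^sub>0 'a, 'a \<Rightarrow> 'k, int^'n) bigraded_algebra" where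
  "LT \<zeta> \<sigma> H =
     \<lparr>ga_scale = loop_scale,
      ga_mult = loop_bracket,
      ga_space = {f. \<forall>l. Poly_Mapping.lookup f l \<in> eigenspace \<zeta> \<sigma> l},
      ga_lattice = group_closure (weights H UNIV),
      ga_comp = (\<lambda>\<alpha> l. Poly_Mapping.single l ` (weight_space H UNIV \<alpha> \<inter> eigenspace \<zeta> \<sigma> l))\<rparr>"

end

section \<open>Multiloop Lie tori\<close>

definition compatible_primitive_roots :: "(nat \<Rightarrow> 'k::field) \<Rightarrow> bool" where
  "compatible_primitive_roots \<zeta> \<longleftrightarrow>
     (\<forall>l\<ge>1. \<zeta> l ^ l = 1 \<and> (\<forall>i. 0 < i \<and> i < l \<longrightarrow> \<zeta> l ^ i \<noteq> 1)) \<and>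
     (\<forall>l\<ge>1. \<forall>m\<ge>1. \<zeta> (m * l) ^ m = \<zeta> l)"

text \<open>In \<open>A2\<close> the isomorphism with a direct sum is expressed by an internal direct sum, and the nonzero
  elements of \<open>\<Oplus>\<^sub>j \<int>/(m\<^sub>j)\<close> by those \<open>l\<close> that have a component not divisible by \<open>m\<^sub>j\<close>.\<close>

locale multiloop_lie_torus = lie_algebra scale bracket
  for scale :: "'k::field_char_0 \<Rightarrow> 'a::ab_group_add \<Rightarrow> 'a" (infixr \<open>*s\<close> 75)
    and bracket :: "'a \<Rightarrow> 'a \<Rightarrow> 'a" +
  fixes \<zeta> :: "nat \<Rightarrow> 'k"
    and \<sigma> :: "'n::finite \<Rightarrow> 'a \<Rightarrow> 'a"
    and H :: "'a set"
  assumes finite_dim: "\<exists>B. finite_dimensional_vector_space scale B"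
    and simple: "simple_lie UNIV"
    and automorphism: "\<sigma> j \<in> carrier aut_group"
    and commute: "\<sigma> i \<circ> \<sigma> j = \<sigma> j \<circ> \<sigma> i"
    and finite_order: "aut_order (\<sigma> j) > 0"
    and A1: "simple_lie (fixed_points \<sigma>)"
    and A2: "\<lbrakk>\<exists>j. \<not> int (aut_order (\<sigma> j)) dvd l $ j; eigenspace \<zeta> \<sigma> l \<noteq> {0}\<rbrakk> \<Longrightarrow>
      \<exists>U V. submodule (fixed_points \<sigma>) U \<and> submodule (fixed_points \<sigma>) V \<and>
        U \<inter> V = {0} \<and> eigenspace \<zeta> \<sigma> l = {u + v | u v. u \<in> U \<and> v \<in> V} \<and>
        (\<forall>x\<in>fixed_points \<sigma>. \<forall>u\<in>U. bracket x u = 0) \<and>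
        (V = {0} \<or> condition_M (fixed_points \<sigma>) V)"
    and A3: "card (generate aut_group (range \<sigma>)) = (\<Prod>j\<in>UNIV. aut_order (\<sigma> j))"
    and cartan: "cartan_subalgebra (fixed_points \<sigma>) H"

end

theory Submission
  imports Defs
begin

text \<open>The trace form of \<open>\<ss>\<close> is nondegenerate on \<open>\<ss>\<close> and on \<open>G = \<ss>\<^sup>\<sigma>\<close>: by the traces of commutators on root strings,
  its vanishing would force all weights of a Cartan subalgebra \<open>H\<close> of \<open>G\<close> to vanish. Hence derivations of \<open>\<ss>\<close> are
  inner, elements of \<open>G\<close> have Jordan decompositions inside \<open>G\<close>, and \<open>H\<close> acts diagonalizably on \<open>\<ss>\<close>.

  Two Cartan subalgebras \<open>H\<^sub>1\<close>, \<open>H\<^sub>2\<close> of \<open>G\<close> are conjugate under automorphisms of \<open>\<ss>\<close> commuting with \<open>\<sigma>\<close>, by induction on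
  the codimension of \<open>T = H\<^sub>1 \<inter> H\<^sub>2\<close>. In the centralizer of \<open>T\<close> choose Borel subalgebras \<open>B\<^sub>i = H\<^sub>i + N\<^sub>i\<close>. As \<open>N\<^sub>i\<close> is
  the annihilator of \<open>B\<^sub>i\<close>, counting dimensions gives \<open>x \<in> B\<^sub>1 \<inter> B\<^sub>2\<close> outside \<open>T + (N\<^sub>1 \<inter> N\<^sub>2)\<close>; its semisimple part
  lies in \<open>B\<^sub>1 \<inter> B\<^sub>2\<close> but not in \<open>T\<close>, and exponentials of elements of \<open>N\<^sub>i\<close> move it into \<open>H\<^sub>i\<close> while fixing \<open>T\<close>.

  Given \<open>\<sigma>' = \<phi> \<sigma>\<^sup>P \<phi>\<^sup>-\<^sup>1\<close> with \<open>\<phi>(H) = H'\<close> and \<open>D = diag(m\<^sub>i)\<close>, condition \<open>A3\<close> makes \<open>X = (D\<^sup>-\<^sup>1 P D')\<^sup>T\<close> integral and invertible,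
  and \<open>x \<otimes> z\<^sup>l \<mapsto> \<phi>(x) \<otimes> z\<close> to the power \<open>X l\<close> is a bi-isomorphism. Conversely a bi-isomorphism transports the centroid, hence
  carries the lattice \<open>D \<int>\<^sup>n\<close> onto \<open>D' \<int>\<^sup>n\<close>, and after twisting by a character it descends to \<open>\<phi> : \<ss> \<rightarrow> \<ss>'\<close>.\<close>

section \<open>Generalized eigenspaces and traces\<close>

text \<open>An isomorphism \<open>\<phi>\<close> with the right effect on \<open>\<sigma>\<close>
  maps \<open>H\<close> only to some Cartan subalgebra of the fixed points of
  \<open>\<sigma>'\<close>, and it must be corrected without disturbing its relation to
  \<open>\<sigma>'\<close>. This is why conjugacy is proved with exponentials of elements of
  \<open>G\<close>, which commute with \<open>\<sigma>\<close>. The correction is also needed to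
  build a bi-isomorphism from \<open>P\<close>, because the root grading sees \<open>H\<close>.

  The field has no order, so definiteness has to come from the rationals: traces on weight strings
  show that all weights take rationally proportional values on brackets of opposite weight vectors,
  which turns \<open>kappa h h = 0\<close> into a vanishing sum of rational squares. Positive roots
  are replaced by a rational functional that is nonzero on all nonzero weights, scaled to integer
  levels; Borel subalgebras are the parts of nonnegative level.

  The form is always that of the whole algebra, restricted to \<open>G\<close>, to centralizers or
  to \<open>H\<close>. In the converse direction the root grading is what shows that degrees in
  \<open>\<int>^n\<close> are respected; the matrix of \<open>\<psi>e\<close> is \<open>X\<close>,
  and \<open>P\<close> is recovered as \<open>D X^T D'^-1\<close>.\<close>

locale lin_space = vector_space scale
  for scale :: "'a::field \<Rightarrow> 'b::ab_group_add \<Rightarrow> 'b" (infixr "\<cdot>" 75)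
begin

abbreviation lin :: "('b \<Rightarrow> 'b) \<Rightarrow> bool" where
  "lin T \<equiv> Vector_Spaces.linear scale scale T"

lemma linI: "(\<And>x y. T (x + y) = T x + T y) \<Longrightarrow> (\<And>c x. T (c \<cdot> x) = c \<cdot> T x) \<Longrightarrow> lin T"
  using vector_space_axioms by (simp add: Vector_Spaces.linear_iff)

lemma lin_add: "lin T \<Longrightarrow> T (x + y) = T x + T y"
  and lin_scale: "lin T \<Longrightarrow> T (c \<cdot> x) = c \<cdot> T x"
  by (simp_all add: Vector_Spaces.linear_iff)

lemma lin_0: "lin T \<Longrightarrow> T 0 = 0"
  using lin_scale[of T 0 0] by simp

lemma lin_neg: "lin T \<Longrightarrow> T (- x) = - T x"
  using lin_scale[of T "-1" x] by simp

lemma lin_diff: "lin T \<Longrightarrow> T (x - y) = T x - T y"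
  using lin_add[of T x "- y"] by (simp add: lin_neg)

lemma lin_sum: "lin T \<Longrightarrow> T (sum g A) = (\<Sum>a\<in>A. T (g a))"
  by (induction A rule: infinite_finite_induct) (simp_all add: lin_0 lin_add)

lemma lin_compose: "lin S \<Longrightarrow> lin T \<Longrightarrow> lin (\<lambda>x. S (T x))"
  by (rule linI) (simp_all add: lin_add lin_scale)

lemma lin_funpow: "lin T \<Longrightarrow> lin (T ^^ n)"
  by (induction n) (auto intro!: linI simp: lin_add lin_scale)

lemma subspace_lin_vimage: "lin T \<Longrightarrow> subspace W \<Longrightarrow> subspace {x. T x \<in> W}"
  by (auto simp: subspace_def lin_add lin_scale lin_0)

lemma subspace_lin_image: "lin T \<Longrightarrow> subspace W \<Longrightarrow> subspace (T ` W)"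
  by (rule module_hom.subspace_image[OF Vector_Spaces.linear.axioms(3)])

definition shift :: "('b \<Rightarrow> 'b) \<Rightarrow> 'a \<Rightarrow> 'b \<Rightarrow> 'b" where
  "shift T c v = T v - c \<cdot> v"

text \<open>The exponent is left unbounded, so that the notion makes sense without a dimension; a
  common exponent on a finite dimensional subspace comes from
  \<open>nilpotent_uniform\<close>.\<close>

definition gen_eigenspace :: "('b \<Rightarrow> 'b) \<Rightarrow> 'a \<Rightarrow> 'b set" where
  "gen_eigenspace T c = {v. \<exists>n. (shift T c ^^ n) v = 0}"

lemma lin_shift: "lin T \<Longrightarrow> lin (shift T c)"
  by (rule linI) (simp_all add: shift_def lin_add lin_scale algebra_simps)

lemma lin_shift_pow: "lin T \<Longrightarrow> lin (shift T c ^^ n)"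
  by (intro lin_funpow lin_shift)

lemma shift_pow_mono: "lin T \<Longrightarrow> (shift T c ^^ n) v = 0 \<Longrightarrow> n \<le> m \<Longrightarrow> (shift T c ^^ m) v = 0"
  using lin_0[OF lin_shift_pow, of T "m - n" c] funpow_add[of "m - n" n "shift T c"] by simp

lemma gen_eigenspaceI: "(shift T c ^^ n) v = 0 \<Longrightarrow> v \<in> gen_eigenspace T c"
  by (auto simp: gen_eigenspace_def)

lemma eigen_in_gen_eigenspace: "T v = c \<cdot> v \<Longrightarrow> v \<in> gen_eigenspace T c"
  by (rule gen_eigenspaceI[where n=1]) (simp add: shift_def)

lemma subspace_gen_eigenspace:
  assumes T: "lin T"
  shows "subspace (gen_eigenspace T c)"
proof (rule subspaceI)
  show "0 \<in> gen_eigenspace T c" by (rule gen_eigenspaceI[where n=0]) simp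
next
  fix x y assume "x \<in> gen_eigenspace T c" "y \<in> gen_eigenspace T c"
  then obtain m n where "(shift T c ^^ m) x = 0" "(shift T c ^^ n) y = 0" by (auto simp: gen_eigenspace_def)
  then have "(shift T c ^^ (m + n)) (x + y) = 0"
    using shift_pow_mono[OF T, of m c x "m+n"] shift_pow_mono[OF T, of n c y "m+n"]
    by (simp add: lin_add[OF lin_shift_pow[OF T]])
  then show "x + y \<in> gen_eigenspace T c" by (rule gen_eigenspaceI)
next
  fix a x assume "x \<in> gen_eigenspace T c"
  then show "a \<cdot> x \<in> gen_eigenspace T c"
    by (auto simp: gen_eigenspace_def lin_scale[OF lin_shift_pow[OF T]])
qed

lemma shift_pow_commute:
  assumes "lin R" "\<And>v. R (T v) = T (R v)"
  shows "(shift T c ^^ n) (R v) = R ((shift T c ^^ n) v)"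
  using assms by (induction n arbitrary: v) (simp_all add: shift_def lin_diff lin_scale)

lemma gen_eigenspace_commute:
  assumes "lin R" "\<And>v. R (T v) = T (R v)" "v \<in> gen_eigenspace T c"
  shows "R v \<in> gen_eigenspace T c"
proof -
  obtain n where "(shift T c ^^ n) v = 0" using assms(3) by (auto simp: gen_eigenspace_def)
  then have "(shift T c ^^ n) (R v) = 0"
    by (simp add: shift_pow_commute[of R T, OF assms(1,2)] lin_0[OF assms(1)])
  then show ?thesis by (rule gen_eigenspaceI)
qed

lemma shift_pow_comm_pow:
  assumes "lin T"
  shows "(shift T d ^^ n) (T v) = T ((shift T d ^^ n) v)"
  by (rule shift_pow_commute) (simp_all add: assms)

lemma gen_eigenspace_Int:
  assumes T: "lin T" and "v \<in> gen_eigenspace T c" "v \<in> gen_eigenspace T d" "c \<noteq> d"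
  shows "v = 0"
proof -
  obtain n where "(shift T c ^^ n) v = 0" using assms by (auto simp: gen_eigenspace_def)
  moreover have "v \<in> gen_eigenspace T d" by fact
  ultimately show ?thesis
  proof (induction n arbitrary: v)
    case (Suc n)
    have "(shift T c ^^ n) (shift T c v) = 0" using Suc.prems(1) by (simp add: funpow_swap1)
    moreover have "shift T c v \<in> gen_eigenspace T d"
      using Suc.prems(2) by (intro gen_eigenspace_commute[of "shift T c"]) (simp_all add: lin_shift T, simp add: shift_def T lin_diff lin_scale)
    ultimately have "shift T c v = 0" by (rule Suc.IH)
    \<comment> \<open>Lowering the exponent leaves a genuine eigenvector for \<open>c\<close>, on
      which \<open>shift T d\<close> acts as the nonzero scalar \<open>c - d\<close> and so cannot
      be nilpotent.\<close>
    then have Tv: "T v = c \<cdot> v" by (simp add: shift_def)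
    have pw: "(shift T d ^^ k) v = ((c - d) ^ k) \<cdot> v" for k
      by (induction k) (simp_all add: shift_def T lin_scale Tv algebra_simps)
    obtain k where "(shift T d ^^ k) v = 0" using Suc.prems(2) by (auto simp: gen_eigenspace_def)
    with pw[of k] show "v = 0" using \<open>c \<noteq> d\<close> by simp
  qed simp
qed

text \<open>A power of \<open>shift T d\<close> that kills \<open>v d\<close> maps the other
  generalized eigenspaces to themselves. By induction it kills the other summands too, and each of
  these then lies in two generalized eigenspaces.\<close>

lemma gen_eigenspace_independent:
  assumes T: "lin T" and "finite C" "\<And>c. c \<in> C \<Longrightarrow> v c \<in> gen_eigenspace T c" "(\<Sum>c\<in>C. v c) = 0" "c \<in> C"
  shows "v c = 0"
  using assms(2-)
proof (induction C arbitrary: v c rule: finite_induct)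
  case (insert d C)
  obtain n where n: "(shift T d ^^ n) (v d) = 0" using insert.prems(1)[of d] by (auto simp: gen_eigenspace_def)
  let ?R = "shift T d ^^ n"
  have R: "lin ?R" by (rule lin_shift_pow[OF T])
  have "?R (\<Sum>c\<in>insert d C. v c) = 0" using insert.prems(2) lin_0[OF R] by simp
  then have z: "(\<Sum>c\<in>C. ?R (v c)) = 0" using insert.hyps n by (simp add: lin_add[OF R] lin_sum[OF R])
  have "v c = 0" if "c \<in> C" for c
  proof (rule gen_eigenspace_Int[OF T])
    show "v c \<in> gen_eigenspace T c" using insert.prems(1) that by simp
    have "?R (v e) \<in> gen_eigenspace T e" if "e \<in> C" for e
      using insert.prems(1)[of e] that
      by (intro gen_eigenspace_commute[of ?R]) (simp_all add: R shift_pow_comm_pow[OF T])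
    then have "?R (v c) = 0" by (rule insert.IH[OF _ z that])
    then show "v c \<in> gen_eigenspace T d" by (rule gen_eigenspaceI)
    show "c \<noteq> d" using that insert.hyps by auto
  qed
  moreover from this have "v d = 0" using insert.prems(2) insert.hyps by simp
  ultimately show ?case using insert.prems(3) by auto
qed simp

text \<open>Some \<open>s\<close> separates \<open>a\<close> from another index. Grouping
  \<open>X\<close> by the eigenvalue of \<open>F s\<close> puts the group sums into different
  generalized eigenspaces, so each vanishes, and the group of \<open>a\<close> is smaller than
  \<open>X\<close>. Used for weights and for the simultaneous eigenspaces of
  \<open>\<sigma>\<close>.\<close>

lemma joint_gen_eigenspace_independent:
  assumes "finite X" and lin: "\<And>s. s \<in> S \<Longrightarrow> lin (F s)"
    and "\<And>a b. a \<in> X \<Longrightarrow> b \<in> X \<Longrightarrow> a \<noteq> b \<Longrightarrow> \<exists>s\<in>S. ev a s \<noteq> ev b s"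
    and "\<And>a s. a \<in> X \<Longrightarrow> s \<in> S \<Longrightarrow> c a \<in> gen_eigenspace (F s) (ev a s)" "(\<Sum>a\<in>X. c a) = 0" "a \<in> X"
  shows "c a = 0"
  using assms(1,3-)
proof (induction X arbitrary: a rule: finite_psubset_induct)
  case (psubset X)
  show ?case
  proof (cases "X = {a}")
    case True
    then show ?thesis using psubset.prems by simp
  next
    case False
    then obtain b where b: "b \<in> X" "b \<noteq> a" using psubset.prems(4) by auto
    then obtain s where s: "s \<in> S" "ev b s \<noteq> ev a s" using psubset.prems(1) psubset.prems(4) by metis
    let ?Y = "\<lambda>e. {a\<in>X. ev a s = e}"
    have "(\<Sum>e\<in>(\<lambda>a. ev a s) ` X. sum c (?Y e)) = 0"
      using psubset.prems(3) psubset.hyps by (subst sum.image_gen[symmetric]) auto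
    moreover have "sum c (?Y e) \<in> gen_eigenspace (F s) e" for e
      using psubset.prems(2)[OF _ s(1)] by (intro subspace_sum[OF subspace_gen_eigenspace[OF lin[OF s(1)]]]) auto
    ultimately have z: "sum c (?Y (ev a s)) = 0"
      using psubset.hyps psubset.prems(4)
      by (intro gen_eigenspace_independent[OF lin[OF s(1)], where v="\<lambda>e. sum c (?Y e)"]) auto
    have "?Y (ev a s) \<subset> X" using b s by auto
    then show ?thesis
      by (rule psubset.IH) (use psubset.prems z in auto)
  qed
qed

text \<open>On this space \<open>T - d\<close> is the nonzero scalar \<open>c - d\<close> plus the
  nilpotent \<open>T - c\<close>, hence invertible; the induction on the exponent sums the geometric
  series.\<close>

lemma shift_surj_on_gen_eigenspace:
  assumes T: "lin T" and V: "subspace V" "\<And>x. x \<in> V \<Longrightarrow> T x \<in> V"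
    and w: "w \<in> V" "w \<in> gen_eigenspace T c" and cd: "c \<noteq> d"
  shows "\<exists>u\<in>V \<inter> gen_eigenspace T c. shift T d u = w"
proof -
  obtain n where "(shift T c ^^ n) w = 0" using w by (auto simp: gen_eigenspace_def)
  then show ?thesis using w
  proof (induction n arbitrary: w)
    case 0
    then show ?case using subspace_0[OF V(1)] subspace_0[OF subspace_gen_eigenspace[OF T]]
      by (intro bexI[of _ 0]) (auto simp: shift_def lin_0[OF T])
  next
    case (Suc n)
    define u0 where "u0 = (1 / (c - d)) \<cdot> w"
    \<comment> \<open>The error of the first approximation: \<open>shift T d u0 = w - r\<close>, and
      \<open>r\<close> has a smaller exponent than \<open>w\<close>.\<close>
    define r where "r = - shift T c u0"
    have u0: "u0 \<in> V" "u0 \<in> gen_eigenspace T c"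
      unfolding u0_def using Suc.prems V subspace_scale subspace_gen_eigenspace[OF T] by blast+
    have "shift T c u0 \<in> V" using u0 V by (auto simp: shift_def intro: subspace_diff subspace_scale)
    moreover have "shift T c u0 \<in> gen_eigenspace T c" using u0
      by (intro gen_eigenspace_commute[of "shift T c"]) (simp_all add: lin_shift T, simp add: shift_def T lin_diff lin_scale)
    ultimately have r: "r \<in> V" "r \<in> gen_eigenspace T c"
      unfolding r_def using V subspace_gen_eigenspace[OF T] subspace_neg by blast+
    have "(shift T c ^^ n) r = - ((1 / (c - d)) \<cdot> (shift T c ^^ Suc n) w)"
      unfolding r_def u0_def
      by (simp add: lin_neg[OF lin_shift_pow[OF T]] funpow_swap1 lin_scale[OF lin_shift[OF T]] lin_scale[OF lin_shift_pow[OF T]])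
    then have "(shift T c ^^ n) r = 0" using Suc.prems(1) by simp
    from Suc.IH[OF this r] obtain u1 where u1: "u1 \<in> V \<inter> gen_eigenspace T c" "shift T d u1 = r" by blast
    have "shift T d u0 = shift T c u0 + (c - d) \<cdot> u0" by (simp add: shift_def algebra_simps)
    also have "(c - d) \<cdot> u0 = w" using cd by (simp add: u0_def)
    finally have "shift T d (u0 + u1) = w" using u1 by (simp add: lin_add[OF lin_shift[OF T]] r_def)
    moreover have "u0 + u1 \<in> V \<inter> gen_eigenspace T c"
      using u0 u1 V subspace_gen_eigenspace[OF T] by (auto intro: subspace_add)
    ultimately show ?case by blast
  qed
qed

section \<open>Polynomials in a linear map\<close>

definition peval :: "('b \<Rightarrow> 'b) \<Rightarrow> 'a poly \<Rightarrow> 'b \<Rightarrow> 'b" where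
  "peval T p v = (\<Sum>i\<le>Polynomial.degree p. Polynomial.coeff p i \<cdot> (T ^^ i) v)"

lemma peval_bound: "Polynomial.degree p \<le> n \<Longrightarrow> peval T p v = (\<Sum>i\<le>n. Polynomial.coeff p i \<cdot> (T ^^ i) v)"
  unfolding peval_def by (rule sum.mono_neutral_left) (auto simp: coeff_eq_0)

lemma peval_linear_factor:
  assumes T: "lin T"
  shows "peval T ([:- a, 1:] * q) v = peval T q (shift T a v)"
proof -
  let ?n = "Polynomial.degree q"
  have d: "Polynomial.degree ([:- a, 1:] * q) \<le> Suc ?n"
    by (rule order.trans[OF degree_mult_le]) simp
  have c: "Polynomial.coeff ([:- a, 1:] * q) i = (case i of 0 \<Rightarrow> 0 | Suc j \<Rightarrow> Polynomial.coeff q j) - a * Polynomial.coeff q i" for i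
    by (simp add: coeff_pCons split: nat.split)
  have "peval T ([:- a, 1:] * q) v = (\<Sum>i\<le>Suc ?n. (case i of 0 \<Rightarrow> 0 | Suc j \<Rightarrow> Polynomial.coeff q j) \<cdot> (T ^^ i) v)
      - (\<Sum>i\<le>Suc ?n. (a * Polynomial.coeff q i) \<cdot> (T ^^ i) v)"
    unfolding peval_bound[OF d] c by (simp only: scale_left_diff_distrib sum_subtractf)
  also have "(\<Sum>i\<le>Suc ?n. (case i of 0 \<Rightarrow> 0 | Suc j \<Rightarrow> Polynomial.coeff q j) \<cdot> (T ^^ i) v)
      = (\<Sum>i\<le>?n. Polynomial.coeff q i \<cdot> (T ^^ i) (T v))"
    by (subst sum.atMost_Suc_shift) (simp add: funpow_swap1)
  also have "(\<Sum>i\<le>Suc ?n. (a * Polynomial.coeff q i) \<cdot> (T ^^ i) v) = (\<Sum>i\<le>?n. (a * Polynomial.coeff q i) \<cdot> (T ^^ i) v)"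
    by (simp add: coeff_eq_0)
  finally show ?thesis
    by (simp add: peval_def shift_def lin_diff[OF lin_funpow[OF T]] lin_scale[OF lin_funpow[OF T]]
        algebra_simps sum_subtractf)
qed

section \<open>Finite direct sums of subspaces\<close>

definition direct :: "'i set \<Rightarrow> ('i \<Rightarrow> 'b set) \<Rightarrow> bool" where
  "direct I V \<longleftrightarrow> finite I \<and> (\<forall>i\<in>I. subspace (V i)) \<and>
     (\<forall>c. (\<forall>i\<in>I. c i \<in> V i) \<and> (\<Sum>i\<in>I. c i) = 0 \<longrightarrow> (\<forall>i\<in>I. c i = 0))"

text \<open>The chosen family must vanish outside \<open>I\<close>, so that the component at an
  index outside \<open>I\<close> is zero, as is wanted for weights that do not occur. For vectors
  outside the span the value is arbitrary.\<close>

definition component :: "'i set \<Rightarrow> ('i \<Rightarrow> 'b set) \<Rightarrow> 'i \<Rightarrow> 'b \<Rightarrow> 'b" where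
  "component I V i x = (SOME c. (\<forall>i\<in>I. c i \<in> V i) \<and> (\<forall>i. i \<notin> I \<longrightarrow> c i = 0) \<and> x = (\<Sum>i\<in>I. c i)) i"

lemma span_Union_subspaces:
  assumes "finite I" "\<And>i. i \<in> I \<Longrightarrow> subspace (V i)" "x \<in> span (\<Union>i\<in>I. V i)"
  shows "\<exists>c. (\<forall>i\<in>I. c i \<in> V i) \<and> (\<forall>i. i \<notin> I \<longrightarrow> c i = 0) \<and> x = (\<Sum>i\<in>I. c i)"
proof -
  let ?T = "{x. \<exists>c. (\<forall>i\<in>I. c i \<in> V i) \<and> (\<forall>i. i \<notin> I \<longrightarrow> c i = 0) \<and> x = (\<Sum>i\<in>I. c i)}"
  have "subspace ?T"
  proof (rule subspaceI)
    show "0 \<in> ?T" using assms(2) by (auto intro!: exI[of _ "\<lambda>_. 0"] subspace_0)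
  next
    fix x y assume "x \<in> ?T" "y \<in> ?T"
    then obtain c d where "\<forall>i\<in>I. c i \<in> V i" "\<forall>i. i \<notin> I \<longrightarrow> c i = 0" "x = (\<Sum>i\<in>I. c i)"
      "\<forall>i\<in>I. d i \<in> V i" "\<forall>i. i \<notin> I \<longrightarrow> d i = 0" "y = (\<Sum>i\<in>I. d i)" by auto
    then show "x + y \<in> ?T"
      using assms(2) by (auto intro!: exI[of _ "\<lambda>i. c i + d i"] subspace_add simp: sum.distrib)
  next
    fix a x assume "x \<in> ?T"
    then obtain c where "\<forall>i\<in>I. c i \<in> V i" "\<forall>i. i \<notin> I \<longrightarrow> c i = 0" "x = (\<Sum>i\<in>I. c i)" by auto
    then show "a \<cdot> x \<in> ?T"
      using assms(2) by (auto intro!: exI[of _ "\<lambda>i. a \<cdot> c i"] subspace_scale simp: scale_sum_right)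
  qed
  moreover have "(\<Union>i\<in>I. V i) \<subseteq> ?T"
  proof safe
    fix i x assume "i \<in> I" "x \<in> V i"
    then show "\<exists>c. (\<forall>i\<in>I. c i \<in> V i) \<and> (\<forall>i. i \<notin> I \<longrightarrow> c i = 0) \<and> x = (\<Sum>i\<in>I. c i)"
      using assms(1,2) by (intro exI[of _ "\<lambda>j. if j = i then x else 0"]) (auto intro: subspace_0)
  qed
  ultimately show ?thesis using span_minimal assms(3) by blast
qed

context
  fixes I :: "'i set" and V
  assumes dir: "direct I V"
begin

lemma direct_finite: "finite I" and direct_subspace: "i \<in> I \<Longrightarrow> subspace (V i)"
  and directD: "(\<And>i. i \<in> I \<Longrightarrow> c i \<in> V i) \<Longrightarrow> (\<Sum>i\<in>I. c i) = 0 \<Longrightarrow> i \<in> I \<Longrightarrow> c i = 0"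
  using dir by (auto simp: direct_def)

lemma
  assumes "x \<in> span (\<Union>i\<in>I. V i)"
  shows component_in: "i \<in> I \<Longrightarrow> component I V i x \<in> V i"
    and component_outside: "i \<notin> I \<Longrightarrow> component I V i x = 0"
    and sum_component: "(\<Sum>i\<in>I. component I V i x) = x"
  using someI_ex[OF span_Union_subspaces[OF direct_finite direct_subspace assms], simplified]
  unfolding component_def by auto

lemma direct_unique:
  assumes "\<And>i. i \<in> I \<Longrightarrow> c i \<in> V i" "\<And>i. i \<in> I \<Longrightarrow> d i \<in> V i" "(\<Sum>i\<in>I. c i) = (\<Sum>i\<in>I. d i)" "i \<in> I"
  shows "c i = d i"
  using directD[of "\<lambda>i. c i - d i" i] assms direct_subspace by (auto simp: sum_subtractf subspace_diff)

lemma component_eq: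
  assumes "x \<in> span (\<Union>i\<in>I. V i)" "\<And>i. i \<in> I \<Longrightarrow> c i \<in> V i" "x = (\<Sum>i\<in>I. c i)" "i \<in> I"
  shows "component I V i x = c i"
  by (rule direct_unique[OF component_in[OF assms(1)] assms(2)]) (use assms sum_component[OF assms(1)] in auto)

lemma component_of_mem:
  assumes "j \<in> I" "x \<in> V j"
  shows "component I V i x = (if i = j then x else 0)"
proof -
  have x: "x \<in> span (\<Union>i\<in>I. V i)" using assms by (auto intro: span_base)
  show ?thesis
  proof (cases "i \<in> I")
    case True
    then show ?thesis
      by (intro component_eq[OF x]) (use assms direct_finite in \<open>auto intro: subspace_0[OF direct_subspace]\<close>)
  qed (use assms component_outside[OF x] in auto)
qed

lemma component_add:
  assumes x: "x \<in> span (\<Union>i\<in>I. V i)" and y: "y \<in> span (\<Union>i\<in>I. V i)"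
  shows "component I V i (x + y) = component I V i x + component I V i y"
proof (cases "i \<in> I")
  case True
  show ?thesis
    by (rule component_eq[OF span_add[OF x y] _ _ True])
      (auto simp: sum.distrib sum_component[OF x] sum_component[OF y]
        intro: subspace_add[OF direct_subspace component_in[OF x] component_in[OF y]])
qed (use component_outside[OF x] component_outside[OF y] component_outside[OF span_add[OF x y]] in auto)

lemma component_scale:
  assumes x: "x \<in> span (\<Union>i\<in>I. V i)"
  shows "component I V i (a \<cdot> x) = a \<cdot> component I V i x"
proof (cases "i \<in> I")
  case True
  show ?thesis
    by (rule component_eq[OF span_scale[OF x] _ _ True])
      (auto simp: sum_component[OF x] simp flip: scale_sum_right
        intro: subspace_scale[OF direct_subspace component_in[OF x]])
qed (use component_outside[OF x] component_outside[OF span_scale[OF x]] in auto)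

lemma component_invariant:
  assumes "x \<in> span (\<Union>i\<in>I. W \<inter> V i)" "subspace W"
  shows "component I V i x \<in> W"
proof -
  have s: "x \<in> span (\<Union>i\<in>I. V i)" using assms(1) span_mono[of "\<Union>i\<in>I. W \<inter> V i" "\<Union>i\<in>I. V i"] by auto
  have "\<And>i. i \<in> I \<Longrightarrow> subspace (W \<inter> V i)"
    using assms(2) direct_subspace by (auto intro: subspace_inter)
  from span_Union_subspaces[OF direct_finite this assms(1)] obtain c where
    c: "\<forall>i\<in>I. c i \<in> W \<inter> V i" "x = sum c I" by blast
  show ?thesis
    using component_eq[OF s, of c i] c component_outside[OF s, of i] subspace_0[OF assms(2)] by (cases "i \<in> I") auto
qed

end

end

locale fin_vs = finite_dimensional_vector_space scale Basis + lin_space scale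
  for scale :: "'a::field \<Rightarrow> 'b::ab_group_add \<Rightarrow> 'b" (infixr "\<cdot>" 75) and Basis
begin

section \<open>Traces on invariant subspaces\<close>

lemma sum_rep:
  assumes "independent B" "x \<in> span B"
  shows "(\<Sum>b\<in>B. representation B x b \<cdot> b) = x"
  using sum_representation_eq[OF assms finiteI_independent[OF assms(1)]] by simp

lemma rep_lin_sum:
  assumes B: "independent B" and T: "lin T" and "finite C" "\<And>c. c \<in> C \<Longrightarrow> T c \<in> span B"
  shows "representation B (T (\<Sum>c\<in>C. r c \<cdot> c)) b = (\<Sum>c\<in>C. r c * representation B (T c) b)"
  by (simp add: lin_sum[OF T] lin_scale[OF T] representation_sum[OF B] representation_scale[OF B] assms span_scale)

lemma trace_swap_aux:
  assumes B: "independent B" "span B = V" and C: "independent C" "span C = V"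
    and S: "lin S" "\<And>v. v \<in> V \<Longrightarrow> S v \<in> V" and T: "lin T" "\<And>v. v \<in> V \<Longrightarrow> T v \<in> V"
  shows "(\<Sum>b\<in>B. representation B (S (T b)) b) = (\<Sum>b\<in>B. \<Sum>c\<in>C. representation C (T b) c * representation B (S c) b)"
proof (rule sum.cong[OF refl])
  fix b assume b: "b \<in> B"
  then have Tb: "T b \<in> span C" using T(2)[of b] B C span_base by auto
  have "representation B (S (T b)) b = representation B (S (\<Sum>c\<in>C. representation C (T b) c \<cdot> c)) b"
    by (simp add: sum_rep[OF C(1) Tb])
  also have "\<dots> = (\<Sum>c\<in>C. representation C (T b) c * representation B (S c) b)"
    by (rule rep_lin_sum[OF B(1) S(1)]) (use C B S(2) span_base finiteI_independent in auto)
  finally show "representation B (S (T b)) b = \<dots>" .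
qed

text \<open>Allowing two different bases gives both the symmetry of the trace and, with the identity
  as \<open>S\<close>, its independence of the basis.\<close>

lemma trace_swap:
  assumes B: "independent B" "span B = V" and C: "independent C" "span C = V"
    and S: "lin S" "\<And>v. v \<in> V \<Longrightarrow> S v \<in> V" and T: "lin T" "\<And>v. v \<in> V \<Longrightarrow> T v \<in> V"
  shows "(\<Sum>b\<in>B. representation B (S (T b)) b) = (\<Sum>c\<in>C. representation C (T (S c)) c)"
proof -
  have "(\<Sum>b\<in>B. representation B (S (T b)) b)
      = (\<Sum>c\<in>C. \<Sum>b\<in>B. representation C (T b) c * representation B (S c) b)"
    by (rule trans[OF trace_swap_aux[OF B C S T] sum.swap])
  also have "\<dots> = (\<Sum>c\<in>C. \<Sum>b\<in>B. representation B (S c) b * representation C (T b) c)"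
    by (intro sum.cong refl mult.commute)
  also have "\<dots> = (\<Sum>c\<in>C. representation C (T (S c)) c)"
    by (rule trace_swap_aux[OF C B T S, symmetric])
  finally show ?thesis .
qed

definition basis_of :: "'b set \<Rightarrow> 'b set" where
  "basis_of V = (SOME B. independent B \<and> span B = V)"

definition trace_on :: "'b set \<Rightarrow> ('b \<Rightarrow> 'b) \<Rightarrow> 'a" where
  "trace_on V T = (\<Sum>b\<in>basis_of V. representation (basis_of V) (T b) b)"

lemma basis_of:
  assumes "subspace V"
  shows "independent (basis_of V)" "span (basis_of V) = V" "finite (basis_of V)"
proof -
  have "\<exists>B. independent B \<and> span B = V" using basis_subspace_exists[OF assms] by metis
  from someI_ex[OF this] show *: "independent (basis_of V)" "span (basis_of V) = V"
    by (auto simp: basis_of_def)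
  then show "finite (basis_of V)" by (simp add: finiteI_independent)
qed

lemma trace_on_basis:
  assumes "independent B" "span B = V" "lin T" "\<And>v. v \<in> V \<Longrightarrow> T v \<in> V"
  shows "trace_on V T = (\<Sum>b\<in>B. representation B (T b) b)"
proof -
  have V: "subspace V" using assms(2) subspace_span by blast
  show ?thesis
    unfolding trace_on_def
    by (rule trace_swap[OF basis_of(1,2)[OF V] assms(1,2), where S="\<lambda>x. x" and T=T])
      (use assms in \<open>auto simp: linI\<close>)
qed

lemma trace_on_commute:
  assumes V: "subspace V" and S: "lin S" "\<And>v. v \<in> V \<Longrightarrow> S v \<in> V" and T: "lin T" "\<And>v. v \<in> V \<Longrightarrow> T v \<in> V"
  shows "trace_on V (\<lambda>v. S (T v)) = trace_on V (\<lambda>v. T (S v))"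
  unfolding trace_on_def by (rule trace_swap[OF basis_of(1,2)[OF V] basis_of(1,2)[OF V] S T])

lemma trace_on_add:
  assumes V: "subspace V" and "\<And>v. v \<in> V \<Longrightarrow> S v \<in> V" "\<And>v. v \<in> V \<Longrightarrow> T v \<in> V"
  shows "trace_on V (\<lambda>v. S v + T v) = trace_on V S + trace_on V T"
proof -
  have "b \<in> V" if "b \<in> basis_of V" for b using that basis_of(2)[OF V] span_base by auto
  then show ?thesis
    unfolding trace_on_def sum.distrib[symmetric]
    by (intro sum.cong refl) (simp add: representation_add basis_of[OF V] assms)
qed

lemma trace_on_scale:
  assumes V: "subspace V" and "\<And>v. v \<in> V \<Longrightarrow> T v \<in> V"
  shows "trace_on V (\<lambda>v. c \<cdot> T v) = c * trace_on V T"
proof -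
  have "b \<in> V" if "b \<in> basis_of V" for b using that basis_of(2)[OF V] span_base by auto
  then show ?thesis
    unfolding trace_on_def sum_distrib_left
    by (intro sum.cong refl) (simp add: representation_scale basis_of[OF V] assms)
qed

lemma trace_on_diff:
  assumes V: "subspace V" and "\<And>v. v \<in> V \<Longrightarrow> S v \<in> V" "\<And>v. v \<in> V \<Longrightarrow> T v \<in> V"
  shows "trace_on V (\<lambda>v. S v - T v) = trace_on V S - trace_on V T"
proof -
  have "trace_on V (\<lambda>v. S v + (-1) \<cdot> T v) = trace_on V S + (-1) * trace_on V T"
    using assms by (subst trace_on_add) (auto simp: trace_on_scale subspace_scale simp del: scale_minus_left)
  then show ?thesis by simp
qed

lemma trace_on_cong:
  assumes V: "subspace V" and "\<And>v. v \<in> V \<Longrightarrow> S v = T v"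
  shows "trace_on V S = trace_on V T"
proof -
  have "b \<in> V" if "b \<in> basis_of V" for b using that basis_of(2)[OF V] span_base by auto
  then show ?thesis unfolding trace_on_def by (intro sum.cong refl) (simp add: assms)
qed

lemma trace_on_id:
  assumes V: "subspace V"
  shows "trace_on V (\<lambda>v. v) = of_nat (dim V)"
proof -
  have "trace_on V (\<lambda>v. v) = (\<Sum>b\<in>basis_of V. 1)"
    unfolding trace_on_def by (intro sum.cong refl) (simp add: representation_basis basis_of[OF V])
  also have "\<dots> = of_nat (dim V)"
    using basis_of[OF V] by (metis dim_eq_card_independent dim_span sum_constant mult.right_neutral)
  finally show ?thesis .
qed

text \<open>In a basis of \<open>V\<close> that extends one of \<open>W\<close>, the added vectors
  have no diagonal entries, as their images lie in the span of the others.\<close>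

lemma trace_on_into_subspace:
  assumes W: "subspace W" and V: "subspace V" and "W \<subseteq> V" and T: "lin T" "\<And>v. v \<in> V \<Longrightarrow> T v \<in> W"
  shows "trace_on V T = trace_on W T"
proof -
  define C where "C = basis_of W"
  have C: "independent C" "span C = W" "finite C" using basis_of[OF W] by (auto simp: C_def)
  have "C \<subseteq> V" using C(2) span_base assms(3) by auto
  from maximal_independent_subset_extend[OF this C(1)] obtain B
    where B: "C \<subseteq> B" "B \<subseteq> V" "independent B" "V \<subseteq> span B" by blast
  have sB: "span B = V" using B V by (simp add: span_subspace)
  have fB: "finite B" by (simp add: B finiteI_independent)
  have r: "representation B (T b) = representation C (T b)" if "b \<in> B" for b
    by (rule representation_extend[OF B(3) _ B(1)]) (use that B C T in auto)
  have "trace_on V T = (\<Sum>b\<in>B. representation B (T b) b)"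
    by (rule trace_on_basis[OF B(3) sB T(1)]) (use T assms in auto)
  also have "\<dots> = (\<Sum>b\<in>B. representation C (T b) b)" using r by simp
  also have "\<dots> = (\<Sum>b\<in>C. representation C (T b) b)"
    by (rule sum.mono_neutral_right[OF fB B(1)]) (use representation_ne_zero in blast)
  also have "\<dots> = trace_on W T"
    by (rule trace_on_basis[symmetric, OF C(1,2) T(1)]) (use T assms in auto)
  finally show ?thesis .
qed

text \<open>Passing from \<open>V\<close> to its image under \<open>T\<close> leaves the trace
  unchanged and lowers the exponent.\<close>

lemma trace_on_nilpotent:
  assumes "subspace V" "lin T" "\<And>v. v \<in> V \<Longrightarrow> T v \<in> V" "\<And>v. v \<in> V \<Longrightarrow> (T ^^ n) v = 0"
  shows "trace_on V T = 0"
  using assms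
proof (induction n arbitrary: V)
  case 0
  then have "V = {0}" using subspace_0 by auto
  moreover have "b \<noteq> 0" if "b \<in> basis_of V" for b
    using basis_of[OF 0(1)] that dependent_zero by auto
  ultimately have "basis_of V = {}" using basis_of(2)[OF 0(1)] span_base by blast
  then show ?case by (simp add: trace_on_def)
next
  case (Suc n)
  have "trace_on V T = trace_on (T ` V) T"
    by (rule trace_on_into_subspace) (use Suc.prems in \<open>auto intro: subspace_lin_image\<close>)
  also have "\<dots> = 0"
  proof (rule Suc.IH[OF subspace_lin_image])
    fix v assume "v \<in> T ` V"
    then show "(T ^^ n) v = 0" using Suc.prems(4) by (auto simp: funpow_swap1)
  qed (use Suc.prems in auto)
  finally show ?case .
qed

lemma nilpotent_uniform:
  assumes V: "subspace V" and T: "lin T" and "\<And>v. v \<in> V \<Longrightarrow> v \<in> gen_eigenspace T c"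
  shows "\<exists>n. \<forall>v\<in>V. (shift T c ^^ n) v = 0"
proof -
  have "\<forall>b\<in>basis_of V. \<exists>n. (shift T c ^^ n) b = 0"
  proof
    fix b assume "b \<in> basis_of V"
    then have "b \<in> gen_eigenspace T c" using basis_of(2)[OF V] span_base[of b "basis_of V"] assms(3) by simp
    then show "\<exists>n. (shift T c ^^ n) b = 0" by (simp add: gen_eigenspace_def)
  qed
  then obtain k where k: "\<And>b. b \<in> basis_of V \<Longrightarrow> (shift T c ^^ k b) b = 0" by metis
  define n where "n = Max (insert 0 (k ` basis_of V))"
  have "(shift T c ^^ n) b = 0" if "b \<in> basis_of V" for b
    by (rule shift_pow_mono[OF T k[OF that]]) (use that basis_of(3)[OF V] in \<open>simp add: n_def\<close>)
  then have "basis_of V \<subseteq> {v. (shift T c ^^ n) v \<in> {0}}" by auto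
  then have "span (basis_of V) \<subseteq> {v. (shift T c ^^ n) v \<in> {0}}"
    by (rule span_minimal) (intro subspace_lin_vimage lin_shift_pow T, simp)
  then show ?thesis using basis_of(2)[OF V] by auto
qed

lemma trace_on_gen_eigenspace:
  assumes V: "subspace V" and T: "lin T" "\<And>v. v \<in> V \<Longrightarrow> T v \<in> V" and g: "\<And>v. v \<in> V \<Longrightarrow> v \<in> gen_eigenspace T c"
  shows "trace_on V T = c * of_nat (dim V)"
proof -
  obtain n where "\<forall>v\<in>V. (shift T c ^^ n) v = 0" using nilpotent_uniform[OF V T(1) g] by blast
  then have "trace_on V (shift T c) = 0"
    by (intro trace_on_nilpotent[OF V lin_shift[OF T(1)]])
      (use T V in \<open>auto simp: shift_def intro: subspace_diff subspace_scale\<close>)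
  moreover have "trace_on V (shift T c) = trace_on V T - c * of_nat (dim V)"
    unfolding shift_def using V T
    by (subst trace_on_diff) (auto simp: trace_on_scale trace_on_id intro: subspace_scale)
  ultimately show ?thesis by simp
qed

lemma direct_basis:
  assumes dir: "direct I V"
  shows "independent (\<Union>i\<in>I. basis_of (V i))" "disjoint_family_on (\<lambda>i. basis_of (V i)) I"
proof -
  note sub = direct_subspace[OF dir]
  have in_V: "b \<in> V i" if "b \<in> basis_of (V i)" "i \<in> I" for b i
    using that basis_of(2)[OF sub] span_base by auto
  have nz: "b \<noteq> 0" if "b \<in> basis_of (V i)" "i \<in> I" for b i
    using basis_of(1)[OF sub] that dependent_zero by auto
  show disj: "disjoint_family_on (\<lambda>i. basis_of (V i)) I"
  proof (clarsimp simp: disjoint_family_on_def)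
    fix i j assume ij: "i \<in> I" "j \<in> I" "i \<noteq> j"
    show "basis_of (V i) \<inter> basis_of (V j) = {}"
    proof (rule ccontr)
      assume "basis_of (V i) \<inter> basis_of (V j) \<noteq> {}"
      then obtain b where b: "b \<in> basis_of (V i)" "b \<in> basis_of (V j)" by auto
      then show False
        using component_of_mem[OF dir ij(1) in_V[OF b(1) ij(1)], of i]
          component_of_mem[OF dir ij(2) in_V[OF b(2) ij(2)], of i] ij nz[OF b(1) ij(1)] by simp
    qed
  qed
  have fin: "finite (\<Union>i\<in>I. basis_of (V i))" using direct_finite[OF dir] basis_of(3)[OF sub] by auto
  show "independent (\<Union>i\<in>I. basis_of (V i))"
    unfolding independent_explicit
  proof (intro conjI allI impI ballI fin)
    fix c b assume z: "(\<Sum>v\<in>(\<Union>i\<in>I. basis_of (V i)). c v \<cdot> v) = 0" and "b \<in> (\<Union>i\<in>I. basis_of (V i))"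
    then obtain i where i: "i \<in> I" "b \<in> basis_of (V i)" by auto
    have "(\<Sum>i\<in>I. \<Sum>v\<in>basis_of (V i). c v \<cdot> v) = 0"
      using z disj direct_finite[OF dir] basis_of(3)[OF sub]
      by (subst sum.UNION_disjoint[symmetric]) (auto simp: disjoint_family_on_def)
    then have "(\<Sum>v\<in>basis_of (V i). c v \<cdot> v) = 0"
      by (intro directD[OF dir, where c="\<lambda>i. \<Sum>v\<in>basis_of (V i). c v \<cdot> v"])
        (rule subspace_sum subspace_scale sub in_V i | assumption)+
    then show "c b = 0"
      using independent_explicit[of "basis_of (V i)"] basis_of(1)[OF sub[OF i(1)]] i(2) by blast
  qed
qed

text \<open>Blocks that \<open>T\<close> moves to other blocks contribute nothing to the diagonal.
  The predicate \<open>P\<close> marks the blocks that may be mapped to themselves: all of them in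
  \<open>trace_on_direct\<close>, none in \<open>trace_on_direct_0\<close>.\<close>

lemma trace_on_direct_shift:
  assumes dir: "direct I V" and T: "lin T"
    and j: "\<And>i v. i \<in> I \<Longrightarrow> v \<in> V i \<Longrightarrow> T v = 0 \<or> (\<exists>k\<in>I. T v \<in> V k \<and> (k = i \<longrightarrow> P i))"
  shows "trace_on (span (\<Union>i\<in>I. V i)) T = (\<Sum>i | i \<in> I \<and> P i. \<Sum>b\<in>basis_of (V i). representation (\<Union>i\<in>I. basis_of (V i)) (T b) b)"
proof -
  note sub = direct_subspace[OF dir]
  let ?B = "\<Union>i\<in>I. basis_of (V i)" and ?U = "span (\<Union>i\<in>I. V i)"
  note B = direct_basis[OF dir]
  have in_V: "b \<in> V i" if "b \<in> basis_of (V i)" "i \<in> I" for b i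
    using that basis_of(2)[OF sub] span_base by auto
  have sB: "span ?B = ?U"
  proof (rule span_unique)
    show "?B \<subseteq> ?U" using in_V span_base by blast
    fix T' assume "?B \<subseteq> T'" "subspace T'"
    then have "V i \<subseteq> T'" if "i \<in> I" for i
      using span_minimal[of "basis_of (V i)" T'] basis_of(2)[OF sub] that by blast
    then show "?U \<subseteq> T'" by (intro span_minimal UN_least \<open>subspace T'\<close>)
  qed simp
  have "T v \<in> ?U" if "v \<in> V i" "i \<in> I" for v i
    using j[OF that(2,1)] by (auto intro!: span_zero intro: span_base)
  then have "(\<Union>i\<in>I. V i) \<subseteq> {v. T v \<in> ?U}" by blast
  then have pres: "T v \<in> ?U" if "v \<in> ?U" for v
    using span_minimal[OF _ subspace_lin_vimage[OF T subspace_span]] that by blast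
  have "trace_on ?U T = (\<Sum>b\<in>?B. representation ?B (T b) b)"
    by (rule trace_on_basis[OF B(1) sB T pres])
  also have "\<dots> = (\<Sum>i\<in>I. \<Sum>b\<in>basis_of (V i). representation ?B (T b) b)"
    using B(2) direct_finite[OF dir] basis_of(3)[OF sub]
    by (intro sum.UNION_disjoint) (auto simp: disjoint_family_on_def)
  also have "\<dots> = (\<Sum>i | i \<in> I \<and> P i. \<Sum>b\<in>basis_of (V i). representation ?B (T b) b)"
  proof (rule sum.mono_neutral_right)
    show "\<forall>i\<in>I - {i \<in> I. P i}. (\<Sum>b\<in>basis_of (V i). representation ?B (T b) b) = 0"
    proof (intro ballI sum.neutral)
      fix i b assume i: "i \<in> I - {i \<in> I. P i}" and b: "b \<in> basis_of (V i)"
      have "T b = 0 \<or> (\<exists>k\<in>I. T b \<in> V k \<and> k \<noteq> i)" using j[of i b] in_V[of b i] i b by auto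
      then show "representation ?B (T b) b = 0"
      proof
        assume "\<exists>k\<in>I. T b \<in> V k \<and> k \<noteq> i"
        then obtain k where k: "k \<in> I" "T b \<in> V k" "k \<noteq> i" by blast
        have "representation ?B (T b) = representation (basis_of (V k)) (T b)"
          by (rule representation_extend[OF B(1)]) (use k basis_of(2)[OF sub] in auto)
        moreover have "b \<notin> basis_of (V k)" using B(2) b i k by (auto simp: disjoint_family_on_def)
        ultimately show ?thesis using representation_ne_zero by metis
      qed (simp add: representation_zero)
    qed
  qed (use direct_finite[OF dir] in auto)
  finally show ?thesis .
qed

lemma trace_on_direct:
  assumes dir: "direct I V" and T: "lin T" and inv: "\<And>i v. i \<in> I \<Longrightarrow> v \<in> V i \<Longrightarrow> T v \<in> V i"
  shows "trace_on (span (\<Union>i\<in>I. V i)) T = (\<Sum>i\<in>I. trace_on (V i) T)"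
proof -
  note sub = direct_subspace[OF dir]
  have "trace_on (span (\<Union>i\<in>I. V i)) T
    = (\<Sum>i | i \<in> I \<and> True. \<Sum>b\<in>basis_of (V i). representation (\<Union>i\<in>I. basis_of (V i)) (T b) b)"
    using inv by (intro trace_on_direct_shift[OF dir T]) auto
  also have "\<dots> = (\<Sum>i\<in>I. trace_on (V i) T)"
  proof (intro sum.cong)
    fix i assume i: "i \<in> I"
    show "(\<Sum>b\<in>basis_of (V i). representation (\<Union>i\<in>I. basis_of (V i)) (T b) b) = trace_on (V i) T"
      unfolding trace_on_def
    proof (rule sum.cong[OF refl])
      fix b assume "b \<in> basis_of (V i)"
      then have "T b \<in> span (basis_of (V i))"
        using basis_of(2)[OF sub[OF i]] inv[OF i, of b] span_base by auto
      from fun_cong[OF representation_extend[OF direct_basis(1)[OF dir] this UN_upper[OF i]]]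
      show "representation (\<Union>i\<in>I. basis_of (V i)) (T b) b = representation (basis_of (V i)) (T b) b" .
    qed
  qed auto
  finally show ?thesis .
qed

lemma trace_on_direct_0:
  assumes dir: "direct I V" and T: "lin T"
    and j: "\<And>i v. i \<in> I \<Longrightarrow> v \<in> V i \<Longrightarrow> T v = 0 \<or> (\<exists>k\<in>I. T v \<in> V k \<and> k \<noteq> i)"
  shows "trace_on (span (\<Union>i\<in>I. V i)) T = 0"
  using trace_on_direct_shift[OF dir T, of "\<lambda>_. False"] j by simp

lemma direct_card_le:
  assumes dir: "direct I V" and nz: "\<And>i. i \<in> I \<Longrightarrow> V i \<noteq> {0}"
  shows "card I \<le> dimension"
proof -
  note sub = direct_subspace[OF dir]
  have "basis_of (V i) \<noteq> {}" if "i \<in> I" for i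
    using basis_of(2)[OF sub[OF that]] nz[OF that] by auto
  then have "1 \<le> card (basis_of (V i))" if "i \<in> I" for i
    using basis_of(3)[OF sub[OF that]] that by (simp add: Suc_leI card_gt_0_iff)
  then have "card I \<le> (\<Sum>i\<in>I. card (basis_of (V i)))"
    using sum_mono[of I "\<lambda>_. 1" "\<lambda>i. card (basis_of (V i))"] by simp
  also have "\<dots> = card (\<Union>i\<in>I. basis_of (V i))"
    using direct_basis(2)[OF dir] basis_of(3)[OF sub] direct_finite[OF dir]
    by (intro card_UN_disjoint[symmetric]) (auto simp: disjoint_family_on_def)
  also have "\<dots> \<le> dimension"
    using independent_card_le_dim[OF subset_UNIV direct_basis(1)[OF dir]] by (simp add: dimension_def)
  finally show ?thesis .
qed

lemma dim_le_kernel: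
  assumes A: "subspace A" and l: "\<And>x y. x \<in> A \<Longrightarrow> y \<in> A \<Longrightarrow> l (x + y) = l x + l y"
    "\<And>c x. x \<in> A \<Longrightarrow> l (c \<cdot> x) = c * l x"
  shows "dim A \<le> dim {x \<in> A. l x = (0::'a)} + 1"
proof (cases "\<forall>x\<in>A. l x = 0")
  case True
  then have "{x \<in> A. l x = 0} = A" by auto
  then show ?thesis by simp
next
  case False
  then obtain v where v: "v \<in> A" "l v \<noteq> 0" by auto
  let ?K = "{x \<in> A. l x = 0}"
  have "x \<in> span (insert v ?K)" if x: "x \<in> A" for x
  proof -
    let ?y = "x + (- (l x / l v)) \<cdot> v"
    have "?y \<in> A" using x v A by (auto intro!: subspace_add subspace_scale simp del: scale_minus_left)
    moreover have "l ?y = l x + (- (l x / l v)) * l v"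
      using l x v A subspace_scale by metis
    ultimately have "?y \<in> ?K" using v by simp
    then show ?thesis unfolding span_breakdown_eq
      by (intro exI[of _ "l x / l v"]) (auto intro: span_base)
  qed
  then have "dim A \<le> dim (insert v ?K)" by (intro dim_mono) auto
  then show ?thesis by (simp add: dim_insert split: if_splits)
qed

end

locale fin_vs_ac = fin_vs scale Basis
  for scale :: "'a::alg_closed_field \<Rightarrow> 'b::ab_group_add \<Rightarrow> 'b" (infixr "\<cdot>" 75) and Basis
begin

lemma annihilating_poly:
  assumes T: "lin T"
  shows "\<exists>p. p \<noteq> 0 \<and> peval T p v = 0"
proof (cases "inj_on (\<lambda>i. (T ^^ i) v) {..dimension}")
  case False
  then obtain i j where ij: "i < j" "(T ^^ i) v = (T ^^ j) v"
    by (auto simp: inj_on_def) (metis linorder_neqE_nat)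
  \<comment> \<open>If two iterates coincide, their set is too small for the linear dependence of
    the other case, but \<open>X^j - X^i\<close> already annihilates \<open>v\<close>.\<close>
  let ?p = "Polynomial.monom 1 j - Polynomial.monom 1 i :: 'a poly"
  have "Polynomial.coeff ?p j \<noteq> 0" using ij by simp
  then have "?p \<noteq> 0" by (rule contrapos_nn) simp
  moreover have "Polynomial.degree ?p \<le> j" using ij by (intro degree_diff_le degree_monom_le order.trans[OF degree_monom_le]) auto
  then have "peval T ?p v = (\<Sum>k\<le>j. (if k = j then (T ^^ k) v else 0) - (if k = i then (T ^^ k) v else 0))"
    by (subst peval_bound) (auto intro!: sum.cong simp: algebra_simps)
  then have "peval T ?p v = 0" using ij by (simp add: sum_subtractf)
  ultimately show ?thesis by blast
next
  case True
  let ?S = "(\<lambda>i. (T ^^ i) v) ` {..dimension}"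
  have "card ?S = Suc dimension" using True by (simp add: card_image)
  then have "dependent ?S"
    using independent_card_le_dim[OF subset_UNIV, of ?S] by (auto simp: dimension_def)
  from iffD1[OF dependent_finite[OF finite_imageI[OF finite_atMost]] this]
  obtain u where u: "\<exists>w\<in>?S. u w \<noteq> 0" "(\<Sum>w\<in>?S. u w \<cdot> w) = 0"
    by (elim exE conjE)
  define c where "c i = (if i \<le> dimension then u ((T ^^ i) v) else 0)" for i
  define p where "p = Abs_poly c"
  have cf: "Polynomial.coeff p = c" unfolding p_def
    by (rule coeff_Abs_poly[of dimension]) (simp add: c_def)
  have "Polynomial.degree p \<le> dimension" by (rule degree_le) (simp add: cf c_def)
  then have "peval T p v = (\<Sum>i\<le>dimension. u ((T ^^ i) v) \<cdot> (T ^^ i) v)"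
    by (subst peval_bound) (auto simp: cf c_def intro!: sum.cong)
  also have "\<dots> = 0" using u(2) by (simp add: sum.reindex[OF True])
  finally have "peval T p v = 0" .
  moreover have "p \<noteq> 0"
  proof
    assume "p = 0"
    then have "c i = 0" for i using cf by auto
    then show False using u(1) by (force simp: c_def split: if_splits)
  qed
  ultimately show ?thesis by blast
qed

text \<open>A root \<open>a\<close> of \<open>p\<close> is split off, so that induction applies to
  \<open>w = T v - a v\<close>. Some \<open>u\<close> in the span has \<open>T u - a u - w\<close>
  in the generalized eigenspace of \<open>a\<close>, and then \<open>u - v\<close> lies there too.
  Intersecting with \<open>V\<close> keeps the summands inside invariant subspaces.\<close>

lemma gen_eigenspace_span_poly:
  assumes T: "lin T" and V: "subspace V" "\<And>x. x \<in> V \<Longrightarrow> T x \<in> V"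
  shows "p \<noteq> 0 \<Longrightarrow> peval T p v = 0 \<Longrightarrow> v \<in> V \<Longrightarrow> v \<in> span (\<Union>c. V \<inter> gen_eigenspace T c)"
proof (induction "Polynomial.degree p" arbitrary: p v)
  case 0
  then obtain a where "p = [:a:]" "a \<noteq> 0" by (metis degree_eq_zeroE pCons_0_0)
  then have "v = 0" using 0 by (simp add: peval_def)
  then show ?case by (simp add: span_zero)
next
  case (Suc n)
  obtain a where "poly p a = 0" using alg_closed_imp_poly_has_root[of p] Suc.hyps(2) by auto
  then obtain q where q: "p = [:- a, 1:] * q" by (auto simp: poly_eq_0_iff_dvd)
  have q0: "q \<noteq> 0" using Suc.prems q by auto
  have "Polynomial.degree p = Suc (Polynomial.degree q)" unfolding q using q0 by (subst degree_mult_eq) auto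
  then have dq: "n = Polynomial.degree q" using Suc.hyps(2) by simp
  let ?w = "shift T a v"
  have "?w \<in> V" using Suc.prems(3) V by (auto simp: shift_def intro: subspace_diff subspace_scale)
  moreover have "peval T q ?w = 0" using Suc.prems(2) by (metis q peval_linear_factor[OF T])
  ultimately have w: "?w \<in> span (\<Union>c. V \<inter> gen_eigenspace T c)" using Suc.hyps(1)[OF dq q0] by blast
  \<comment> \<open>Summands with another eigenvalue have exact preimages; a summand in the
    generalized eigenspace of \<open>a\<close> gets the preimage zero and becomes part of the
    error.\<close>
  have "\<exists>u \<in> span (\<Union>c. V \<inter> gen_eigenspace T c). shift T a u - x \<in> V \<inter> gen_eigenspace T a" if "x \<in> span (\<Union>c. V \<inter> gen_eigenspace T c)" for x
    using that
  proof (induction rule: span_induct_alt)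
    case base
    show ?case using V(1) subspace_gen_eigenspace[OF T] by (auto intro!: bexI[of _ 0] simp: span_zero lin_0[OF lin_shift[OF T]] subspace_0)
  next
    case (step c x y)
    then obtain e where e: "x \<in> V" "x \<in> gen_eigenspace T e" by auto
    have "\<exists>u \<in> span (\<Union>c. V \<inter> gen_eigenspace T c). shift T a u - x \<in> V \<inter> gen_eigenspace T a"
    proof (cases "e = a")
      case True
      then show ?thesis using e V(1) subspace_gen_eigenspace[OF T]
        by (intro bexI[of _ 0]) (auto simp: span_zero lin_0[OF lin_shift[OF T]] intro: subspace_neg)
    next
      case False
      from shift_surj_on_gen_eigenspace[OF T V e False] obtain u where "u \<in> V \<inter> gen_eigenspace T e" "shift T a u = x" by blast
      then show ?thesis using V(1) subspace_gen_eigenspace[OF T] by (intro bexI[of _ u]) (auto intro: span_base subspace_0)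
    qed
    then obtain u where u: "u \<in> span (\<Union>c. V \<inter> gen_eigenspace T c)" "shift T a u - x \<in> V \<inter> gen_eigenspace T a" by blast
    obtain u' where u': "u' \<in> span (\<Union>c. V \<inter> gen_eigenspace T c)" "shift T a u' - y \<in> V \<inter> gen_eigenspace T a" using step.IH by blast
    have sb: "subspace (V \<inter> gen_eigenspace T a)" using V(1) subspace_gen_eigenspace[OF T] by (rule subspace_inter)
    have "shift T a (c \<cdot> u + u') - (c \<cdot> x + y) = c \<cdot> (shift T a u - x) + (shift T a u' - y)"
      by (simp add: lin_add[OF lin_shift[OF T]] lin_scale[OF lin_shift[OF T]] algebra_simps)
    then have "shift T a (c \<cdot> u + u') - (c \<cdot> x + y) \<in> V \<inter> gen_eigenspace T a"
      using subspace_add[OF sb subspace_scale[OF sb u(2)] u'(2)] by (simp only:)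
    then show ?case using u(1) u'(1) by (intro bexI[of _ "c \<cdot> u + u'"]) (auto intro: span_add span_scale)
  qed
  from this[OF w] obtain u where u: "u \<in> span (\<Union>c. V \<inter> gen_eigenspace T c)" "shift T a u - ?w \<in> V \<inter> gen_eigenspace T a" by blast
  have uV: "u \<in> V" using u(1) V(1) span_minimal[of "\<Union>c. V \<inter> gen_eigenspace T c" V] by auto
  have "shift T a (u - v) \<in> gen_eigenspace T a" using u(2) by (simp add: lin_diff[OF lin_shift[OF T]])
  then obtain k where "(shift T a ^^ k) (shift T a (u - v)) = 0" by (auto simp: gen_eigenspace_def)
  then have "u - v \<in> gen_eigenspace T a" by (intro gen_eigenspaceI[where n="Suc k"]) (simp add: funpow_swap1)
  then have "u - v \<in> V \<inter> gen_eigenspace T a" using uV Suc.prems(3) V(1) by (auto intro: subspace_diff)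
  then have "u - v \<in> span (\<Union>c. V \<inter> gen_eigenspace T c)" by (auto intro: span_base)
  then have "u - (u - v) \<in> span (\<Union>c. V \<inter> gen_eigenspace T c)" using u(1) span_diff by blast
  then show ?case by simp
qed

lemma gen_eigenspace_span:
  assumes "lin T" "subspace V" "\<And>x. x \<in> V \<Longrightarrow> T x \<in> V" "v \<in> V"
  shows "v \<in> span (\<Union>c. V \<inter> gen_eigenspace T c)"
  using annihilating_poly[OF assms(1), of v] gen_eigenspace_span_poly[OF assms(1-3)] assms(4) by blast

end

section \<open>Weights and the trace form\<close>

locale fin_lie = lie_algebra scale bracket + fin_vs_ac scale Basis
  for scale :: "'k::{alg_closed_field,field_char_0} \<Rightarrow> 'a::ab_group_add \<Rightarrow> 'a" (infixr "\<cdot>" 75)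
    and bracket and Basis
begin

lemma lin_ad: "lin (bracket x)"
  by (rule linI) (simp_all add: bracket_add_right bracket_scale_right)

lemma lin_ad_left: "lin (\<lambda>x. bracket x y)"
  by (rule linI) (simp_all add: bracket_add_left bracket_scale_left)

lemmas bracket_0_right = lin_0[OF lin_ad] and bracket_0_left = lin_0[OF lin_ad_left]
  and bracket_neg_right = lin_neg[OF lin_ad] and bracket_neg_left = lin_neg[OF lin_ad_left]
  and bracket_diff_right = lin_diff[OF lin_ad] and bracket_diff_left = lin_diff[OF lin_ad_left]
  and bracket_sum_right = lin_sum[OF lin_ad] and bracket_sum_left = lin_sum[OF lin_ad_left]

lemma bracket_swap: "bracket x y = - bracket y x"
proof -
  have "bracket (x + y) (x + y) = bracket x y + bracket y x"
    unfolding bracket_add_left bracket_add_right by (simp add: bracket_self)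
  then show ?thesis by (simp add: bracket_self eq_neg_iff_add_eq_0)
qed

lemma jacobi_ad: "bracket x (bracket y z) = bracket (bracket x y) z + bracket y (bracket x z)"
proof -
  have "bracket y (bracket z x) = - bracket y (bracket x z)"
    using bracket_swap[of z x] by (simp add: bracket_neg_right)
  moreover have "bracket z (bracket x y) = - bracket (bracket x y) z" by (rule bracket_swap)
  ultimately show ?thesis using jacobi[of x y z] by (simp add: algebra_simps)
qed

lemma gen_eigenspace_derivation:
  assumes D: "lin D" "\<And>x y. D (bracket x y) = bracket (D x) y + bracket x (D y)"
    and "x \<in> gen_eigenspace D a" "y \<in> gen_eigenspace D b"
  shows "bracket x y \<in> gen_eigenspace D (a + b)"
proof -
  obtain m n where "(shift D a ^^ m) x = 0" "(shift D b ^^ n) y = 0" using assms by (auto simp: gen_eigenspace_def)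
  then show ?thesis
  proof (induction "m + n" arbitrary: m n x y rule: less_induct)
    case less
    have sub: "subspace (gen_eigenspace D (a + b))" by (rule subspace_gen_eigenspace[OF D(1)])
    show ?case
    proof (cases "m = 0 \<or> n = 0")
      case True
      then show ?thesis using less.prems subspace_0[OF sub] by (auto simp: bracket_0_left bracket_0_right)
    next
      case False
      then obtain m' n' where mn: "m = Suc m'" "n = Suc n'" by (metis not0_implies_Suc)
      \<comment> \<open>The Leibniz rule lowers one of the two exponents in each term.\<close>
      have e: "shift D (a + b) (bracket x y) = bracket (shift D a x) y + bracket x (shift D b y)"
        by (simp add: shift_def D bracket_diff_left bracket_diff_right bracket_scale_left bracket_scale_right algebra_simps)
      have "bracket (shift D a x) y \<in> gen_eigenspace D (a + b)"
        by (rule less.hyps[of m' n]) (use less.prems mn in \<open>simp_all add: funpow_swap1\<close>)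
      moreover have "bracket x (shift D b y) \<in> gen_eigenspace D (a + b)"
        by (rule less.hyps[of m n']) (use less.prems mn in \<open>simp_all add: funpow_swap1\<close>)
      ultimately have "shift D (a + b) (bracket x y) \<in> gen_eigenspace D (a + b)"
        unfolding e by (rule subspace_add[OF sub])
      then obtain k where "(shift D (a + b) ^^ k) (shift D (a + b) (bracket x y)) = 0" by (auto simp: gen_eigenspace_def)
      then show ?thesis by (intro gen_eigenspaceI[where n="Suc k"]) (simp add: funpow_swap1)
    qed
  qed
qed

lemma gen_eigenspace_ad: "x \<in> gen_eigenspace (bracket h) a \<Longrightarrow> y \<in> gen_eigenspace (bracket h) b \<Longrightarrow> bracket x y \<in> gen_eigenspace (bracket h) (a + b)"
  by (rule gen_eigenspace_derivation[where D="bracket h", OF lin_ad]) (rule jacobi_ad | assumption)+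

text \<open>Generalized, because a Cartan subalgebra of \<open>G\<close> is shown to act
  diagonalizably only later, in \<open>cartan_semisimple\<close>. A singleton \<open>H\<close> gives
  the generalized eigenspaces of one element.\<close>

definition gen_weight :: "'a set \<Rightarrow> ('a \<Rightarrow> 'k) \<Rightarrow> 'a set" where
  "gen_weight H \<mu> = {v. \<forall>h\<in>H. v \<in> gen_eigenspace (bracket h) (\<mu> h)}"

text \<open>Vanishing outside \<open>H\<close> makes different weights differ on \<open>H\<close>.
  Linearity is not built in; it is derived from traces in \<open>gen_weights_linear\<close>.\<close>

definition gen_weights :: "'a set \<Rightarrow> ('a \<Rightarrow> 'k) set" where
  "gen_weights H = {\<mu>. (\<forall>x. x \<notin> H \<longrightarrow> \<mu> x = 0) \<and> gen_weight H \<mu> \<noteq> {0}}"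

lemma subspace_gen_weight: "subspace (gen_weight H \<mu>)"
  using subspace_gen_eigenspace[OF lin_ad] unfolding gen_weight_def subspace_def by blast

lemma gen_weight_0: "0 \<in> gen_weight H \<mu>"
  by (rule subspace_0[OF subspace_gen_weight])

lemma gen_weight_bracket: "x \<in> gen_weight H a \<Longrightarrow> y \<in> gen_weight H b \<Longrightarrow> bracket x y \<in> gen_weight H (a + b)"
  by (auto simp: gen_weight_def intro: gen_eigenspace_ad)

lemma gen_weights_add:
  assumes "v \<in> gen_weight H (a + b)" "v \<noteq> 0" "a \<in> gen_weights H" "b \<in> gen_weights H"
  shows "a + b \<in> gen_weights H"
  using assms by (auto simp: gen_weights_def)

lemma gen_weight_independent:
  assumes "finite X" "\<And>\<mu>. \<mu> \<in> X \<Longrightarrow> (\<forall>x. x \<notin> H \<longrightarrow> \<mu> x = 0)" "\<And>\<mu>. \<mu> \<in> X \<Longrightarrow> c \<mu> \<in> gen_weight H \<mu>"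
    "(\<Sum>\<mu>\<in>X. c \<mu>) = 0" "\<mu> \<in> X"
  shows "c \<mu> = 0"
proof (rule joint_gen_eigenspace_independent[where S=H and F=bracket and ev="\<lambda>\<mu>. \<mu>"])
  fix a b assume ab: "a \<in> X" "b \<in> X" "a \<noteq> b"
  then obtain h where "a h \<noteq> b h" by auto
  then show "\<exists>s\<in>H. a s \<noteq> b s" using assms(2) ab by (intro bexI[of _ h]) metis+
qed (use assms lin_ad in \<open>auto simp: gen_weight_def\<close>)

lemma gen_weight_direct:
  assumes "finite X" "X \<subseteq> gen_weights H"
  shows "direct X (gen_weight H)"
  unfolding direct_def
proof (intro conjI allI impI ballI assms(1) subspace_gen_weight)
  fix c \<mu> assume "(\<forall>\<mu>\<in>X. c \<mu> \<in> gen_weight H \<mu>) \<and> sum c X = 0" "\<mu> \<in> X"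
  then show "c \<mu> = 0"
    using assms by (intro gen_weight_independent[of X H c]) (auto simp: gen_weights_def)
qed

lemma finite_gen_weights: "finite (gen_weights H)"
proof (rule ccontr)
  assume "infinite (gen_weights H)"
  then obtain X where X: "finite X" "card X = Suc dimension" "X \<subseteq> gen_weights H"
    using infinite_arbitrarily_large by blast
  then have "card X \<le> dimension"
    by (intro direct_card_le[OF gen_weight_direct[OF X(1,3)]]) (auto simp: gen_weights_def)
  then show False using X by simp
qed

lemmas gen_weight_dir = gen_weight_direct[OF finite_gen_weights subset_refl]

text \<open>If every \<open>h\<close> has a single eigenvalue on \<open>V\<close>, then
  \<open>V\<close> lies in one weight space. Otherwise some \<open>h\<close> splits \<open>V\<close>
  into smaller generalized eigenspaces, which are again stable since \<open>H\<close> lies in the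
  generalized 0-eigenspace of \<open>bracket h\<close>.\<close>

lemma gen_weight_span:
  assumes nil: "\<And>h y. h \<in> H \<Longrightarrow> y \<in> H \<Longrightarrow> y \<in> gen_eigenspace (bracket h) 0"
    and "subspace V" "\<And>h v. h \<in> H \<Longrightarrow> v \<in> V \<Longrightarrow> bracket h v \<in> V"
  shows "V \<subseteq> span (\<Union>\<mu>\<in>gen_weights H. V \<inter> gen_weight H \<mu>)"
  using assms(2,3)
proof (induction "dim V" arbitrary: V rule: less_induct)
  case less
  show ?case
  proof (cases "\<forall>h\<in>H. \<exists>c. V \<subseteq> gen_eigenspace (bracket h) c")
    case True
    then obtain c where c: "\<And>h. h \<in> H \<Longrightarrow> V \<subseteq> gen_eigenspace (bracket h) (c h)" by metis
    define \<mu> where "\<mu> h = (if h \<in> H then c h else 0)" for h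
    have V: "V \<subseteq> gen_weight H \<mu>" using c by (auto simp: gen_weight_def \<mu>_def)
    show ?thesis
    proof (cases "V \<subseteq> {0}")
      case True
      then show ?thesis by (auto simp: span_zero)
    next
      case False
      then have "\<mu> \<in> gen_weights H" using V by (auto simp: gen_weights_def \<mu>_def)
      then show ?thesis using V by (auto intro: span_base)
    qed
  next
    case False
    then obtain h where h: "h \<in> H" "\<And>c. \<not> V \<subseteq> gen_eigenspace (bracket h) c" by auto
    have "V \<inter> gen_eigenspace (bracket h) c \<subseteq> span (\<Union>\<mu>\<in>gen_weights H. V \<inter> gen_weight H \<mu>)" for c
    proof -
      let ?W = "V \<inter> gen_eigenspace (bracket h) c"
      have W: "subspace ?W" by (intro subspace_inter less.prems subspace_gen_eigenspace lin_ad)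
      have "?W \<noteq> V" using h(2)[of c] by auto
      then have "dim ?W < dim V"
        using subspace_dim_equal[OF W less.prems(1)] by (meson inf_le1 not_le)
      moreover have "bracket y v \<in> ?W" if "y \<in> H" "v \<in> ?W" for y v
        using that less.prems(2) gen_eigenspace_ad[OF nil[OF h(1) that(1)], of v c] by auto
      ultimately have "?W \<subseteq> span (\<Union>\<mu>\<in>gen_weights H. ?W \<inter> gen_weight H \<mu>)" using less.hyps W by blast
      also have "\<dots> \<subseteq> span (\<Union>\<mu>\<in>gen_weights H. V \<inter> gen_weight H \<mu>)" by (intro span_mono) auto
      finally show ?thesis .
    qed
    then have "(\<Union>c. V \<inter> gen_eigenspace (bracket h) c) \<subseteq> span (\<Union>\<mu>\<in>gen_weights H. V \<inter> gen_weight H \<mu>)" by blast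
    then have "span (\<Union>c. V \<inter> gen_eigenspace (bracket h) c) \<subseteq> span (\<Union>\<mu>\<in>gen_weights H. V \<inter> gen_weight H \<mu>)"
      by (rule span_minimal) simp
    moreover have "V \<subseteq> span (\<Union>c. V \<inter> gen_eigenspace (bracket h) c)"
      using gen_eigenspace_span[OF lin_ad less.prems(1)] less.prems(2)[OF h(1)] by blast
    ultimately show ?thesis by blast
  qed
qed

section \<open>The Killing form of the whole algebra\<close>

definition kappa :: "'a \<Rightarrow> 'a \<Rightarrow> 'k" where
  "kappa x y = trace_on UNIV (\<lambda>v. bracket x (bracket y v))"

lemma lin_ad2: "lin (\<lambda>v. bracket x (bracket y v))"
  by (rule lin_compose) (rule lin_ad)+

lemma kappa_commute: "kappa x y = kappa y x"
  unfolding kappa_def by (rule trace_on_commute) (auto simp: lin_ad)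

lemma kappa_add_left: "kappa (x + y) z = kappa x z + kappa y z"
  unfolding kappa_def bracket_add_left by (rule trace_on_add) auto

lemma kappa_scale_left: "kappa (c \<cdot> x) z = c * kappa x z"
  unfolding kappa_def bracket_scale_left by (rule trace_on_scale) auto

lemma kappa_add_right: "kappa x (y + z) = kappa x y + kappa x z"
  and kappa_scale_right: "kappa x (c \<cdot> y) = c * kappa x y"
  by (simp_all add: kappa_commute[of x] kappa_add_left kappa_scale_left)

lemma kappa_0_left: "kappa 0 x = 0" and kappa_0_right: "kappa x 0 = 0"
  using kappa_scale_left[of 0 0 x] kappa_scale_right[of x 0 0] by simp_all

lemma kappa_sum_right: "kappa x (sum f A) = (\<Sum>a\<in>A. kappa x (f a))"
  by (induction A rule: infinite_finite_induct) (simp_all add: kappa_0_right kappa_add_right)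

lemma kappa_sum_left: "kappa (sum f A) x = (\<Sum>a\<in>A. kappa (f a) x)"
  by (simp add: kappa_commute[of _ x] kappa_sum_right)

lemma kappa_diff_left: "kappa (x - y) z = kappa x z - kappa y z"
  using kappa_add_left[of "x - y" y z] by simp

lemma kappa_span_0:
  assumes "\<And>x. x \<in> S \<Longrightarrow> kappa z x = 0" "y \<in> span S"
  shows "kappa z y = 0"
proof -
  have "subspace {y. kappa z y = 0}"
    by (auto simp: subspace_def kappa_0_right kappa_add_right kappa_scale_right)
  then show ?thesis using span_minimal[of S "{y. kappa z y = 0}"] assms by auto
qed

lemma trace_ad_bracket:
  assumes V: "subspace V" and x: "\<And>v. v \<in> V \<Longrightarrow> bracket x v \<in> V" and y: "\<And>v. v \<in> V \<Longrightarrow> bracket y v \<in> V"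
  shows "trace_on V (bracket (bracket x y)) = 0"
proof -
  have "trace_on V (bracket (bracket x y)) = trace_on V (\<lambda>v. bracket x (bracket y v) - bracket y (bracket x v))"
    by (rule trace_on_cong[OF V]) (simp add: jacobi_ad[of x y])
  also have "\<dots> = 0"
    using trace_on_commute[OF V lin_ad x lin_ad y] by (subst trace_on_diff[OF V]) (auto simp: x y)
  finally show ?thesis .
qed

lemma kappa_invariant: "kappa (bracket x y) z = kappa x (bracket y z)"
proof -
  have "kappa (bracket x y) z = trace_on UNIV (\<lambda>v. bracket x (bracket y (bracket z v)) - bracket y (bracket x (bracket z v)))"
    unfolding kappa_def by (rule trace_on_cong) (simp_all add: jacobi_ad[of x y])
  also have "\<dots> = trace_on UNIV (\<lambda>v. bracket x (bracket y (bracket z v))) - trace_on UNIV (\<lambda>v. bracket y (bracket x (bracket z v)))"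
    by (rule trace_on_diff) auto
  also have "trace_on UNIV (\<lambda>v. bracket y (bracket x (bracket z v))) = trace_on UNIV (\<lambda>v. bracket x (bracket z (bracket y v)))"
    by (rule trace_on_commute[where S="bracket y" and T="\<lambda>v. bracket x (bracket z v)"]) (auto simp: lin_ad lin_ad2)
  also have "trace_on UNIV (\<lambda>v. bracket x (bracket y (bracket z v))) - \<dots>
      = trace_on UNIV (\<lambda>v. bracket x (bracket y (bracket z v)) - bracket x (bracket z (bracket y v)))"
    by (rule trace_on_diff[symmetric]) auto
  also have "\<dots> = kappa x (bracket y z)"
    unfolding kappa_def by (rule trace_on_cong) (simp_all add: jacobi_ad[of y z] bracket_add_right)
  finally show ?thesis .
qed

text \<open>The two adjoint maps commute, so their product is nilpotent along with
  \<open>bracket n\<close>.\<close>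

lemma kappa_nilpotent:
  assumes "\<And>v. v \<in> gen_eigenspace (bracket n) 0" "bracket n z = 0"
  shows "kappa n z = 0"
proof -
  obtain k where k: "\<And>v. (shift (bracket n) 0 ^^ k) v = 0"
    using nilpotent_uniform[of UNIV "bracket n" 0] assms(1) lin_ad by auto
  have s: "shift (bracket n) 0 = bracket n" by (auto simp: shift_def)
  have c: "bracket n (bracket z v) = bracket z (bracket n v)" for v
    by (simp add: jacobi_ad[of n z] assms(2) bracket_0_left)
  have cz: "(bracket n ^^ i) (bracket z v) = bracket z ((bracket n ^^ i) v)" for i v
    by (induction i) (simp_all add: c)
  have "((\<lambda>v. bracket n (bracket z v)) ^^ i) v = (bracket z ^^ i) ((bracket n ^^ i) v)" for i v
  proof (induction i arbitrary: v)
    case (Suc i)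
    have cz2: "bracket n ((bracket z ^^ j) v) = (bracket z ^^ j) (bracket n v)" for j v
      by (induction j) (simp_all add: c)
    show ?case by (simp only: funpow.simps o_apply Suc.IH) (simp only: c cz2)
  qed simp
  moreover have "lin (bracket z ^^ k)" by (intro lin_funpow lin_ad)
  ultimately have "((\<lambda>v. bracket n (bracket z v)) ^^ k) v = 0" for v using k[of v] s by (simp add: lin_0)
  then show ?thesis unfolding kappa_def
    by (intro trace_on_nilpotent[where n=k] lin_ad2) auto
qed

lemma gen_eigenspace_square:
  assumes T: "lin T" and "v \<in> gen_eigenspace T c"
  shows "v \<in> gen_eigenspace (\<lambda>v. T (T v)) (c * c)"
proof -
  obtain n where "(shift T c ^^ n) v = 0" using assms by (auto simp: gen_eigenspace_def)
  then have "(shift (\<lambda>v. T (T v)) (c * c) ^^ n) v = 0"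
  proof (induction n arbitrary: v)
    case (Suc n)
    \<comment> \<open>\<open>T^2 - c^2\<close> is \<open>T - c\<close> followed by the commuting map
      \<open>T + c\<close>.\<close>
    let ?R = "\<lambda>v. T v + c \<cdot> v"
    have R: "lin ?R" by (rule linI) (simp_all add: T lin_add lin_scale algebra_simps)
    have "shift (\<lambda>v. T (T v)) (c * c) v = ?R (shift T c v)"
      by (simp add: shift_def T lin_diff lin_scale algebra_simps)
    then have "(shift (\<lambda>v. T (T v)) (c * c) ^^ Suc n) v = (shift (\<lambda>v. T (T v)) (c * c) ^^ n) (?R (shift T c v))"
      by (simp add: funpow_swap1)
    also have "\<dots> = ?R ((shift (\<lambda>v. T (T v)) (c * c) ^^ n) (shift T c v))"
      by (rule shift_pow_commute[OF R]) (simp add: T lin_add lin_scale)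
    also have "(shift (\<lambda>v. T (T v)) (c * c) ^^ n) (shift T c v) = 0"
      using Suc.prems by (intro Suc.IH) (simp add: funpow_swap1)
    finally show ?case using T by (simp add: lin_0)
  qed simp
  then show ?thesis by (rule gen_eigenspaceI)
qed

section \<open>Semisimple parts of adjoint maps\<close>

definition ss_part :: "'a \<Rightarrow> 'a \<Rightarrow> bool" where
  "ss_part x s \<longleftrightarrow> (\<forall>c v. v \<in> gen_eigenspace (bracket x) c \<longrightarrow> bracket s v = c \<cdot> v)"

text \<open>A subspace stable under \<open>bracket x\<close> is the sum of its intersections with
  the generalized eigenspaces, on which \<open>s\<close> acts by scalars.\<close>

lemma ss_part_invariant:
  assumes "ss_part x s" "subspace W" "\<And>w. w \<in> W \<Longrightarrow> bracket x w \<in> W" "w \<in> W"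
  shows "bracket s w \<in> W"
proof -
  have "(\<Union>c. W \<inter> gen_eigenspace (bracket x) c) \<subseteq> {w. bracket s w \<in> W}"
    using assms(1,2) by (auto simp: ss_part_def subspace_scale)
  then have "span (\<Union>c. W \<inter> gen_eigenspace (bracket x) c) \<subseteq> {w. bracket s w \<in> W}"
    by (rule span_minimal) (intro subspace_lin_vimage lin_ad assms)
  then show ?thesis using gen_eigenspace_span[OF lin_ad assms(2-4)] by auto
qed

lemma gen_eigenspace_ad_span: "v \<in> span (\<Union>c. gen_eigenspace (bracket x) c)"
  using gen_eigenspace_span[OF lin_ad subspace_UNIV, of x v] by simp

lemma ss_part_nilpotent:
  assumes s: "ss_part x s"
  shows "v \<in> gen_eigenspace (bracket (x - s)) 0"
proof -
  have "(\<Union>c. gen_eigenspace (bracket x) c) \<subseteq> gen_eigenspace (bracket (x - s)) 0"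
  proof safe
    fix c v assume v: "v \<in> gen_eigenspace (bracket x) c"
    have "(shift (bracket (x - s)) 0 ^^ n) v = (shift (bracket x) c ^^ n) v \<and> (shift (bracket x) c ^^ n) v \<in> gen_eigenspace (bracket x) c" for n
    proof (induction n)
      case (Suc n)
      let ?w = "(shift (bracket x) c ^^ n) v"
      have w: "?w \<in> gen_eigenspace (bracket x) c" using Suc by simp
      have "shift (bracket x) c ?w \<in> gen_eigenspace (bracket x) c"
        by (rule gen_eigenspace_commute[OF lin_shift[OF lin_ad] _ w])
          (simp add: shift_def bracket_diff_right bracket_scale_right)
      moreover have "shift (bracket (x - s)) 0 ?w = shift (bracket x) c ?w"
        using s w by (simp add: shift_def bracket_diff_left ss_part_def)
      ultimately show ?case using Suc by simp
    qed (use v in simp)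
    then show "v \<in> gen_eigenspace (bracket (x - s)) 0" using v unfolding gen_eigenspace_def by auto
  qed
  then have "span (\<Union>c. gen_eigenspace (bracket x) c) \<subseteq> gen_eigenspace (bracket (x - s)) 0"
    by (rule span_minimal) (intro subspace_gen_eigenspace lin_ad)
  then show ?thesis using gen_eigenspace_ad_span by blast
qed

text \<open>Eigenvalues of a single \<open>x\<close> are recast as weights of the set
  \<open>{x}\<close>, so that finiteness and directness of weights apply to them.\<close>

lemma gen_weight_singleton: "gen_weight {x} \<mu> = gen_eigenspace (bracket x) (\<mu> x)"
  by (simp add: gen_weight_def)

lemma singleton_nil: "h \<in> {x} \<Longrightarrow> y \<in> {x} \<Longrightarrow> y \<in> gen_eigenspace (bracket h) 0"
  by (auto intro: eigen_in_gen_eigenspace simp: bracket_self)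

lemma singleton_gen_weight_span: "v \<in> span (\<Union>\<mu>\<in>gen_weights {x}. gen_weight {x} \<mu>)"
proof -
  have "UNIV \<subseteq> span (\<Union>\<mu>\<in>gen_weights {x}. UNIV \<inter> gen_weight {x} \<mu>)"
    by (rule gen_weight_span) (simp_all add: singleton_nil)
  then show ?thesis by auto
qed

text \<open>\<open>ss_part s s\<close> is the way to say that \<open>s\<close> acts diagonalizably.
  In a decomposition along the eigenvalues of \<open>x\<close>, powers of
  \<open>bracket s - c\<close> multiply each summand by powers of its eigenvalue minus
  \<open>c\<close>, so only the summands with eigenvalue \<open>c\<close> survive.\<close>

lemma ss_part_semisimple:
  assumes s: "ss_part x s"
  shows "ss_part s s"
  unfolding ss_part_def
proof (intro allI impI)
  fix c v assume v: "v \<in> gen_eigenspace (bracket s) c"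
  let ?X = "gen_weights {x}"
  obtain k where k: "(shift (bracket s) c ^^ k) v = 0" using v by (auto simp: gen_eigenspace_def)
  obtain w where w: "\<forall>\<mu>\<in>?X. w \<mu> \<in> gen_weight {x} \<mu>" "v = (\<Sum>\<mu>\<in>?X. w \<mu>)"
    using span_Union_subspaces[OF finite_gen_weights subspace_gen_weight singleton_gen_weight_span, of x v] by blast
  have sw: "bracket s (w \<mu>) = \<mu> x \<cdot> w \<mu>" if "\<mu> \<in> ?X" for \<mu>
    using s w(1) that by (simp add: ss_part_def gen_weight_singleton)
  have pw: "(shift (bracket s) c ^^ i) (w \<mu>) = (\<mu> x - c) ^ i \<cdot> w \<mu>" if "\<mu> \<in> ?X" for \<mu> i
    by (induction i) (simp_all add: shift_def bracket_scale_right sw that algebra_simps)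
  have "(\<Sum>\<mu>\<in>?X. (\<mu> x - c) ^ k \<cdot> w \<mu>) = 0"
    using k w(2) by (simp add: lin_sum[OF lin_shift_pow[OF lin_ad]] pw)
  then have z: "(\<mu> x - c) ^ k \<cdot> w \<mu> = 0" if "\<mu> \<in> ?X" for \<mu>
    using that w(1) by (intro directD[OF gen_weight_dir, where c="\<lambda>\<mu>. (\<mu> x - c) ^ k \<cdot> w \<mu>"])
      (auto intro: subspace_scale[OF subspace_gen_weight])
  have "bracket s (w \<mu>) = c \<cdot> w \<mu>" if "\<mu> \<in> ?X" for \<mu>
    using z[OF that] sw[OF that] by (auto simp: bracket_0_right)
  then show "bracket s v = c \<cdot> v" by (simp add: w(2) bracket_sum_right scale_sum_right)
qed

section \<open>Nondegeneracy and inner derivations\<close>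

definition nondeg_on :: "'a set \<Rightarrow> bool" where
  "nondeg_on A \<longleftrightarrow> (\<forall>x\<in>A. (\<forall>y\<in>A. kappa x y = 0) \<longrightarrow> x = 0)"

text \<open>By invariance the radical of the form on \<open>A\<close> is an ideal, and one nonzero
  value shows that it is not all of \<open>A\<close>.\<close>

lemma simple_nondeg:
  assumes A: "simple_lie A" and nz: "x \<in> A" "y \<in> A" "kappa x y \<noteq> 0"
  shows "nondeg_on A"
proof -
  let ?I = "{x \<in> A. \<forall>y\<in>A. kappa x y = 0}"
  have sub: "subspace A" "\<And>x y. x \<in> A \<Longrightarrow> y \<in> A \<Longrightarrow> bracket x y \<in> A"
    using A by (auto simp: simple_lie_def subalgebra_def)
  have "subspace ?I" using sub(1) by (auto simp: subspace_def kappa_0_left kappa_add_left kappa_scale_left)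
  moreover have "kappa (bracket z w) y = 0" if "z \<in> A" "w \<in> ?I" "y \<in> A" for z w y
  proof -
    have "kappa (bracket z w) y = - kappa (bracket w z) y"
      using kappa_scale_left[of "-1" "bracket w z" y] bracket_swap[of z w] by simp
    also have "\<dots> = 0" using that sub(2) by (simp add: kappa_invariant)
    finally show ?thesis .
  qed
  ultimately have "lie_ideal A ?I" using sub by (auto simp: lie_ideal_def)
  then have "?I = {0} \<or> ?I = A" using A by (auto simp: simple_lie_def)
  then show ?thesis using nz by (auto simp: nondeg_on_def)
qed

lemma simple_perfect:
  assumes A: "simple_lie A"
  shows "A = span {bracket x y | x y. x \<in> A \<and> y \<in> A}"
proof -
  let ?I = "span {bracket x y | x y. x \<in> A \<and> y \<in> A}"
  have sub: "subspace A" "\<And>x y. x \<in> A \<Longrightarrow> y \<in> A \<Longrightarrow> bracket x y \<in> A"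
    using A by (auto simp: simple_lie_def subalgebra_def)
  have IA: "?I \<subseteq> A" by (rule span_minimal) (use sub in auto)
  then have "lie_ideal A ?I" by (auto simp: lie_ideal_def intro!: span_base)
  then have "?I = {0} \<or> ?I = A" using A by (auto simp: simple_lie_def)
  moreover have "?I \<noteq> {0}"
  proof
    assume "?I = {0}"
    moreover obtain x y where "x \<in> A" "y \<in> A" "bracket x y \<noteq> 0" using A by (auto simp: simple_lie_def)
    moreover from this have "bracket x y \<in> ?I" by (auto intro: span_base)
    ultimately show False by auto
  qed
  ultimately show ?thesis by simp
qed

lemma simple_center:
  assumes A: "simple_lie A" and x: "x \<in> A" "\<And>y. y \<in> A \<Longrightarrow> bracket x y = 0"
  shows "x = 0"
proof -
  let ?I = "{x \<in> A. \<forall>y\<in>A. bracket x y = 0}"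
  have sub: "subspace A" "\<And>x y. x \<in> A \<Longrightarrow> y \<in> A \<Longrightarrow> bracket x y \<in> A"
    using A by (auto simp: simple_lie_def subalgebra_def)
  have "subspace ?I" using sub(1) by (auto simp: subspace_def bracket_0_left bracket_add_left bracket_scale_left)
  moreover have "bracket z w = 0" if "z \<in> A" "w \<in> ?I" for z w
    using that bracket_swap[of z w] by auto
  ultimately have "lie_ideal A ?I"
    using subspace_0[OF sub(1)] by (auto simp: lie_ideal_def bracket_0_left)
  then have "?I = {0} \<or> ?I = A" using A by (simp add: simple_lie_def)
  moreover have "?I \<noteq> A" using A by (auto simp: simple_lie_def)
  ultimately show ?thesis using x by auto
qed

text \<open>Nondegeneracy makes the map from \<open>d\<close> to the values of
  \<open>kappa d\<close> on \<open>Basis\<close> injective. Storing these values as the coefficients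
  of a vector turns it into an endomorphism, which is then surjective.\<close>

lemma nondeg_represent:
  assumes nd: "nondeg_on UNIV" and l: "\<And>x y. l (x + y) = l x + l y" "\<And>c x. l (c \<cdot> x) = c * (l x :: 'k)"
  shows "\<exists>d. \<forall>y. kappa d y = l y"
proof -
  let ?F = "\<lambda>d. \<Sum>b\<in>Basis. kappa d b \<cdot> b"
  have linF: "lin ?F"
    by (rule linI) (simp_all add: kappa_add_left kappa_scale_left scale_left_distrib sum.distrib scale_sum_right)
  have lB: "l y = 0" if "\<And>b. b \<in> Basis \<Longrightarrow> l b = 0" "\<And>x y. l (x + y) = l x + l y" "\<And>c x. l (c \<cdot> x) = c * l x"
    for l :: "'a \<Rightarrow> 'k" and y
  proof -
    have "l 0 = 0" using that(3)[of 0 0] by simp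
    then have "subspace {y. l y = 0}" by (auto simp: subspace_def that(2,3))
    then have "span Basis \<subseteq> {y. l y = 0}" by (intro span_minimal) (auto simp: that)
    then show ?thesis by (auto simp: span_Basis)
  qed
  have ind: "(\<Sum>b\<in>Basis. c b \<cdot> b) = 0 \<Longrightarrow> b \<in> Basis \<Longrightarrow> c b = 0" for c b
    using independent_Basis finite_Basis by (auto simp: independent_explicit)
  have "inj ?F"
  proof (rule injI)
    fix d e assume "?F d = ?F e"
    then have "(\<Sum>b\<in>Basis. kappa (d - e) b \<cdot> b) = 0"
      by (simp add: kappa_diff_left scale_left_diff_distrib sum_subtractf)
    then have "kappa (d - e) b = 0" if "b \<in> Basis" for b using ind that by blast
    then have "kappa (d - e) y = 0" for y
      by (rule lB) (simp_all add: kappa_add_right kappa_scale_right)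
    then have "d - e = 0" using nd unfolding nondeg_on_def by blast
    then show "d = e" by simp
  qed
  then have "surj ?F" by (rule linear_inj_imp_surj[OF linF])
  then have "(\<Sum>b\<in>Basis. l b \<cdot> b) \<in> range ?F" by simp
  then obtain d where d: "(\<Sum>b\<in>Basis. l b \<cdot> b) = ?F d" by (rule rangeE)
  have "kappa d b - l b = 0" if "b \<in> Basis" for b
    using d that by (intro ind[of "\<lambda>b. kappa d b - l b"]) (simp_all add: scale_left_diff_distrib sum_subtractf)
  then have "kappa d y - l y = 0" for y
    by (rule lB[of "\<lambda>y. kappa d y - l y"]) (simp_all add: kappa_add_right kappa_scale_right l algebra_simps)
  then show ?thesis by auto
qed

text \<open>Represent the functional \<open>y \<mapsto> tr(D ad y)\<close> as \<open>kappa d\<close>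
  and put \<open>E = D - ad d\<close>, so that \<open>tr(E ad y) = 0\<close>. As
  \<open>ad (E x)\<close> is the commutator of \<open>E\<close> and \<open>ad x\<close>, cyclicity
  of the trace gives \<open>kappa (E x) y = tr(E ad [x, y]) = 0\<close>.\<close>

lemma derivation_inner:
  assumes nd: "nondeg_on UNIV" and D: "lin D" "\<And>x y. D (bracket x y) = bracket (D x) y + bracket x (D y)"
  shows "\<exists>s. \<forall>v. D v = bracket s v"
proof -
  let ?l = "\<lambda>y. trace_on UNIV (\<lambda>v. D (bracket y v))"
  have "\<exists>d. \<forall>y. kappa d y = ?l y"
  proof (rule nondeg_represent[OF nd])
    show "?l (x + y) = ?l x + ?l y" for x y
      by (simp add: bracket_add_left lin_add[OF D(1)] trace_on_add)
    show "?l (c \<cdot> x) = c * ?l x" for c x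
      by (simp add: bracket_scale_left lin_scale[OF D(1)] trace_on_scale)
  qed
  then obtain d where d: "\<And>y. kappa d y = ?l y" by blast
  define E where "E v = D v - bracket d v" for v
  have linE: "lin E" by (rule linI) (simp_all add: E_def lin_add[OF D(1)] lin_scale[OF D(1)] bracket_add_right bracket_scale_right algebra_simps)
  have derE: "E (bracket x y) = bracket (E x) y + bracket x (E y)" for x y
    by (simp add: E_def D(2) jacobi_ad[of d] bracket_diff_left bracket_diff_right)
  have trE: "trace_on UNIV (\<lambda>v. E (bracket y v)) = 0" for y
    unfolding E_def by (subst trace_on_diff) (auto simp: d[symmetric] kappa_def)
  have linEb: "lin (\<lambda>v. E (bracket x (bracket y v)))" for x y by (intro lin_compose[OF linE] lin_ad2)
  have "kappa (E x) y = 0" for x y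
  proof -
    have "kappa (E x) y = trace_on UNIV (\<lambda>v. E (bracket x (bracket y v)) - bracket x (E (bracket y v)))"
      unfolding kappa_def by (rule trace_on_cong) (simp_all add: derE[of x])
    also have "\<dots> = trace_on UNIV (\<lambda>v. E (bracket x (bracket y v))) - trace_on UNIV (\<lambda>v. bracket x (E (bracket y v)))"
      by (rule trace_on_diff) auto
    also have "trace_on UNIV (\<lambda>v. bracket x (E (bracket y v))) = trace_on UNIV (\<lambda>v. E (bracket y (bracket x v)))"
      by (rule trace_on_commute[where S="bracket x" and T="\<lambda>v. E (bracket y v)"]) (auto intro: lin_ad lin_compose[OF linE])
    also have "trace_on UNIV (\<lambda>v. E (bracket x (bracket y v))) - \<dots>
        = trace_on UNIV (\<lambda>v. E (bracket x (bracket y v)) - E (bracket y (bracket x v)))"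
      by (rule trace_on_diff[symmetric]) auto
    also have "\<dots> = trace_on UNIV (\<lambda>v. E (bracket (bracket x y) v))"
      by (rule trace_on_cong) (simp_all add: jacobi_ad[of x y] lin_add[OF linE])
    finally show ?thesis by (simp add: trE)
  qed
  then have "E x = 0" for x using nd by (auto simp: nondeg_on_def)
  then show ?thesis by (auto simp: E_def)
qed

text \<open>Multiplying each generalized eigenspace of \<open>bracket x\<close> by its eigenvalue is
  a derivation, because eigenvalues add under the bracket; it is therefore inner.\<close>

lemma ss_part_exists:
  assumes nd: "nondeg_on UNIV"
  shows "\<exists>s. ss_part x s"
proof -
  let ?X = "gen_weights {x}"
  let ?c = "component ?X (gen_weight {x})"
  define D where "D v = (\<Sum>\<mu>\<in>?X. \<mu> x \<cdot> ?c \<mu> v)" for v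
  note sp = singleton_gen_weight_span
  have linD: "lin D"
    by (rule linI) (simp_all add: D_def component_add[OF gen_weight_dir sp sp] component_scale[OF gen_weight_dir sp]
        scale_right_distrib sum.distrib scale_sum_right mult.commute)
  have D_gen_weight: "D v = \<mu> x \<cdot> v" if "v \<in> gen_weight {x} \<mu>" "\<mu> \<in> ?X" for v \<mu>
    using that finite_gen_weights by (simp add: D_def component_of_mem[OF gen_weight_dir, OF that(2,1)] if_distrib cong: if_cong)
  have D_gen_eigenspace: "D v = c \<cdot> v" if "v \<in> gen_eigenspace (bracket x) c" for v c
  proof (cases "v = 0")
    case False
    have "v \<in> gen_weight {x} (\<lambda>z. if z = x then c else 0)" using that by (simp add: gen_weight_singleton)
    moreover from this False have "(\<lambda>z. if z = x then c else 0) \<in> ?X" by (auto simp: gen_weights_def)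
    ultimately show ?thesis using D_gen_weight by fastforce
  qed (simp add: lin_0[OF linD])
  have "\<exists>s. \<forall>v. D v = bracket s v"
  proof (rule derivation_inner[OF nd linD])
    fix u v
    obtain a where a: "\<forall>\<mu>\<in>?X. a \<mu> \<in> gen_weight {x} \<mu>" "u = (\<Sum>\<mu>\<in>?X. a \<mu>)"
      using span_Union_subspaces[OF finite_gen_weights subspace_gen_weight sp] by blast
    obtain b where b: "\<forall>\<mu>\<in>?X. b \<mu> \<in> gen_weight {x} \<mu>" "v = (\<Sum>\<mu>\<in>?X. b \<mu>)"
      using span_Union_subspaces[OF finite_gen_weights subspace_gen_weight sp] by blast
    have "D (bracket (a \<mu>) (b \<eta>)) = bracket (D (a \<mu>)) (b \<eta>) + bracket (a \<mu>) (D (b \<eta>))"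
      if "\<mu> \<in> ?X" "\<eta> \<in> ?X" for \<mu> \<eta>
    proof -
      have "a \<mu> \<in> gen_eigenspace (bracket x) (\<mu> x)" "b \<eta> \<in> gen_eigenspace (bracket x) (\<eta> x)"
        using a b that by (auto simp: gen_weight_singleton)
      then show ?thesis
        by (simp add: D_gen_eigenspace[OF gen_eigenspace_ad] D_gen_eigenspace bracket_scale_left bracket_scale_right scale_left_distrib)
    qed
    then show "D (bracket u v) = bracket (D u) v + bracket u (D v)"
      by (simp add: a(2) b(2) bracket_sum_left bracket_sum_right lin_sum[OF linD] sum.distrib)
  qed
  then show ?thesis using D_gen_eigenspace unfolding ss_part_def by metis
qed

end

section \<open>Cartan subalgebras of the fixed points\<close>

locale fixed_lie = fin_lie scale bracket Basis
  for scale :: "'k::{alg_closed_field,field_char_0} \<Rightarrow> 'a::ab_group_add \<Rightarrow> 'a" (infixr "\<cdot>" 75)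
    and bracket and Basis +
  fixes \<sigma> :: "'n::finite \<Rightarrow> 'a \<Rightarrow> 'a"
  assumes simple: "simple_lie UNIV"
    and automorphism: "\<sigma> j \<in> carrier aut_group"
    and simple_fixed: "simple_lie (fixed_points \<sigma>)"
begin

declare dim_eq_0 [simp del]

abbreviation G :: "'a set" where "G \<equiv> fixed_points \<sigma>"

lemma lin_\<sigma>: "lin (\<sigma> j)" and \<sigma>_bracket: "\<sigma> j (bracket x y) = bracket (\<sigma> j x) (\<sigma> j y)" and bij_\<sigma>: "bij (\<sigma> j)"
  using automorphism[of j] by (auto simp: aut_group_def algebra_iso_def intro: linI)

lemma subspace_G: "subspace G"
  and G_bracket: "x \<in> G \<Longrightarrow> y \<in> G \<Longrightarrow> bracket x y \<in> G"
  using simple_fixed by (auto simp: simple_lie_def subalgebra_def)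

text \<open>\<open>\<sigma> j\<close> commutes with \<open>bracket x\<close>, so
  \<open>\<sigma> j s\<close> acts on the generalized eigenspaces of \<open>x\<close> by the same
  scalars as \<open>s\<close>. The difference is central, hence zero.\<close>

lemma ss_part_fixed:
  assumes s: "ss_part x s" and x: "x \<in> G"
  shows "s \<in> G"
proof -
  have "\<sigma> j s = s" for j
  proof -
    have xj: "\<sigma> j x = x" using x by (simp add: fixed_points_def)
    have "(\<Union>c. gen_eigenspace (bracket x) c) \<subseteq> {v. bracket (\<sigma> j s - s) v \<in> {0}}"
    proof safe
      fix c v assume v: "v \<in> gen_eigenspace (bracket x) c"
      obtain w where w: "v = \<sigma> j w" using bij_\<sigma>[of j] by (metis bij_pointE)
      obtain n where n: "(shift (bracket x) c ^^ n) v = 0" using v by (auto simp: gen_eigenspace_def)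
      have "(shift (bracket x) c ^^ n) (\<sigma> j w) = \<sigma> j ((shift (bracket x) c ^^ n) w)"
        by (rule shift_pow_commute[OF lin_\<sigma>]) (simp add: \<sigma>_bracket xj)
      then have "\<sigma> j ((shift (bracket x) c ^^ n) w) = \<sigma> j 0" using n w by (simp add: lin_0[OF lin_\<sigma>])
      then have "(shift (bracket x) c ^^ n) w = 0" using bij_\<sigma>[of j] by (meson bij_is_inj injD)
      then have "w \<in> gen_eigenspace (bracket x) c" by (rule gen_eigenspaceI)
      then have "bracket s w = c \<cdot> w" using s by (simp add: ss_part_def)
      then have "bracket (\<sigma> j s) v = c \<cdot> v" using w by (metis \<sigma>_bracket lin_scale lin_\<sigma>)
      then show "bracket (\<sigma> j s - s) v = 0" using s v by (simp add: ss_part_def bracket_diff_left)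
    qed
    then have "span (\<Union>c. gen_eigenspace (bracket x) c) \<subseteq> {v. bracket (\<sigma> j s - s) v \<in> {0}}"
      by (rule span_minimal) (intro subspace_lin_vimage lin_ad subspace_single_0)
    then have "bracket (\<sigma> j s - s) v = 0" for v using gen_eigenspace_ad_span[of v x] by auto
    from simple_center[OF simple UNIV_I this] have "\<sigma> j s - s = 0" .
    then show ?thesis by simp
  qed
  then show ?thesis by (simp add: fixed_points_def)
qed

section \<open>Weights of a Cartan subalgebra of the fixed points\<close>

context
  fixes H
  assumes cartan: "cartan_subalgebra G H"
begin

lemma cartan_subset: "H \<subseteq> G" and subspace_cartan: "subspace H"
  and cartan_bracket: "x \<in> H \<Longrightarrow> y \<in> H \<Longrightarrow> bracket x y \<in> H"
  and cartan_normalizer: "x \<in> G \<Longrightarrow> (\<And>y. y \<in> H \<Longrightarrow> bracket x y \<in> H) \<Longrightarrow> x \<in> H"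
  using cartan by (auto simp: cartan_subalgebra_def subalgebra_def)

lemma lower_central_bracket: "x \<in> H \<Longrightarrow> y \<in> lower_central H i \<Longrightarrow> bracket x y \<in> lower_central H (Suc i)"
  by (auto intro: span_base)

lemma subspace_lower_central: "subspace (lower_central H i)"
  using subspace_cartan by (cases i) auto

lemma lower_central_Suc_subset: "lower_central H (Suc i) \<subseteq> lower_central H i"
proof (induction i)
  case 0
  show ?case unfolding lower_central.simps
    by (rule span_minimal) (use cartan_bracket subspace_cartan in auto)
next
  case (Suc i)
  then show ?case unfolding lower_central.simps(2)[of H "Suc i"] lower_central.simps(2)[of H i]
    by (intro span_mono) auto
qed

lemma lower_central_subset: "lower_central H i \<subseteq> H"
  by (induction i) (use lower_central_Suc_subset in auto)

lemma lower_central_nilpotent: obtains N where "lower_central H N = {0}"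
  using cartan by (auto simp: cartan_subalgebra_def nilpotent_lie_def)

lemma cartan_nil: 
  assumes "h \<in> H" "y \<in> H"
  shows "y \<in> gen_eigenspace (bracket h) 0"
proof -
  obtain N where N: "lower_central H N = {0}" by (rule lower_central_nilpotent)
  have "(shift (bracket h) 0 ^^ n) y \<in> lower_central H n" for n
  proof (induction n)
    case (Suc n)
    then show ?case using lower_central_bracket[OF assms(1) Suc] by (simp add: shift_def)
  qed (use assms in auto)
  then have "(shift (bracket h) 0 ^^ N) y = 0" using N by blast
  then show ?thesis by (rule gen_eigenspaceI)
qed

lemma cartan_in_gen_weight_0: "H \<subseteq> gen_weight H 0"
  using cartan_nil by (auto simp: gen_weight_def)

lemma cartan_ad_gen_weight: "h \<in> H \<Longrightarrow> v \<in> gen_weight H b \<Longrightarrow> bracket h v \<in> gen_weight H b"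
  using gen_weight_bracket[of h H 0 v b] cartan_in_gen_weight_0 by auto

lemmas cartan_span = gen_weight_span[OF cartan_nil]

lemma cartan_span_UNIV: "v \<in> span (\<Union>\<mu>\<in>gen_weights H. gen_weight H \<mu>)"
proof -
  have "UNIV \<subseteq> span (\<Union>\<mu>\<in>gen_weights H. UNIV \<inter> gen_weight H \<mu>)" by (rule cartan_span) auto
  then show ?thesis by auto
qed

lemma G_span: "G \<subseteq> span (\<Union>\<mu>\<in>gen_weights H. G \<inter> gen_weight H \<mu>)"
  by (rule cartan_span[OF _ _ subspace_G]) (use cartan_subset G_bracket in auto)

lemma invariant_decomp:
  assumes V: "subspace V" "\<And>h v. h \<in> H \<Longrightarrow> v \<in> V \<Longrightarrow> bracket h v \<in> V" and x: "x \<in> V"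
  shows "\<exists>u. (\<forall>\<mu>\<in>gen_weights H. u \<mu> \<in> V \<inter> gen_weight H \<mu>) \<and> x = sum u (gen_weights H)"
proof -
  have "x \<in> span (\<Union>\<mu>\<in>gen_weights H. V \<inter> gen_weight H \<mu>)" using cartan_span[OF _ _ V] x by blast
  from span_Union_subspaces[OF finite_gen_weights _ this] show ?thesis
    using V(1) subspace_gen_weight by (auto intro: subspace_inter)
qed

lemma G_decomp:
  assumes "x \<in> G"
  shows "\<exists>u. (\<forall>\<mu>\<in>gen_weights H. u \<mu> \<in> G \<inter> gen_weight H \<mu>) \<and> x = sum u (gen_weights H)"
  by (rule invariant_decomp[OF subspace_G _ assms]) (use cartan_subset G_bracket in auto)

text \<open>The Engel step for \<open>G_gen_weight_0\<close>: a vector that term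
  \<open>i + 1\<close> of the series moves into \<open>H\<close> is improved until term
  \<open>i\<close> does so, by treating a finite spanning set of term \<open>i\<close> one element
  at a time.\<close>

lemma normalizer_step:
  assumes ex: "\<exists>v\<in>G \<inter> gen_weight H 0 - H. \<forall>c\<in>lower_central H (Suc i). bracket c v \<in> H"
  shows "\<exists>v\<in>G \<inter> gen_weight H 0 - H. \<forall>c\<in>lower_central H i. bracket c v \<in> H"
proof -
  let ?L = "lower_central H i"
  define W where "W B = {u \<in> G \<inter> gen_weight H 0. (\<forall>c\<in>lower_central H (Suc i). bracket c u \<in> H) \<and> (\<forall>b\<in>B. bracket b u \<in> H)}" for B
  have LH: "b \<in> H" if "b \<in> ?L" for b using that lower_central_subset by auto
  \<comment> \<open>\<open>bracket c (bracket b u)\<close> differs from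
    \<open>bracket b (bracket c u)\<close> by the action of \<open>[c, b]\<close>, which lies in the
    next term of the series; so the conditions collected in \<open>W B\<close> survive the
    application of \<open>b\<close>.\<close>
  have closed: "bracket b u \<in> W B" if b: "b \<in> ?L" and B: "B \<subseteq> ?L" and u: "u \<in> W B" for b u B
  proof -
    have 1: "bracket b u \<in> G \<inter> gen_weight H 0"
      using u cartan_ad_gen_weight[OF LH[OF b]] cartan_subset LH[OF b] G_bracket by (auto simp: W_def)
    have 2: "bracket c (bracket b u) \<in> H" if "bracket c b \<in> lower_central H (Suc i)" "bracket c u \<in> H" for c
    proof -
      have "bracket (bracket c b) u \<in> H" using that(1) u by (auto simp: W_def)
      moreover have "bracket b (bracket c u) \<in> H" using that(2) LH[OF b] cartan_bracket by auto
      ultimately show ?thesis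
        unfolding jacobi_ad[of c b u] by (rule subspace_add[OF subspace_cartan])
    qed
    have "bracket c b \<in> lower_central H (Suc i)" if "c \<in> H" for c
      by (rule lower_central_bracket[OF that b])
    then show ?thesis using 1 2 B u LH lower_central_subset[of "Suc i"] by (auto simp: W_def)
  qed
  have fin: "\<exists>w\<in>W B - H. True" if "finite B" "B \<subseteq> ?L" for B
    using that
  proof (induction B rule: finite_induct)
    case empty
    then show ?case using ex by (auto simp: W_def)
  next
    case (insert b B)
    then obtain w where w: "w \<in> W B" "w \<notin> H" by auto
    have b: "b \<in> ?L" and B: "B \<subseteq> ?L" using insert.prems by auto
    have "w \<in> gen_eigenspace (bracket b) 0" using w(1) LH[OF b] by (auto simp: W_def gen_weight_def)
    moreover have "shift (bracket b) 0 = bracket b" by (auto simp: shift_def)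
    ultimately obtain n0 where "(bracket b ^^ n0) w = 0" by (auto simp: gen_eigenspace_def)
    then have n0: "(bracket b ^^ n0) w \<in> H" using subspace_0[OF subspace_cartan] by simp
    \<comment> \<open>The iterate before this one is the last outside \<open>H\<close>; applying
      \<open>b\<close> to it lands in \<open>H\<close>.\<close>
    define n where "n = (LEAST n. (bracket b ^^ n) w \<in> H)"
    have n: "(bracket b ^^ n) w \<in> H" unfolding n_def by (rule LeastI[of _ n0]) (rule n0)
    have "n \<noteq> 0" using n w(2) by (metis funpow_0)
    then obtain m where m: "n = Suc m" by (metis not0_implies_Suc)
    let ?u = "(bracket b ^^ m) w"
    have "?u \<notin> H" using not_less_Least[of m "\<lambda>n. (bracket b ^^ n) w \<in> H"] m by (simp add: n_def)
    moreover have "(bracket b ^^ k) w \<in> W B" for k by (induction k) (use w closed[OF b B] in auto)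
    then have "?u \<in> W B" .
    moreover have "bracket b ?u \<in> H" using n m by simp
    ultimately have "?u \<in> W (insert b B) - H" by (auto simp: W_def)
    then show ?case by blast
  qed
  obtain B where B: "finite B" "B \<subseteq> ?L" "span B = ?L"
    using basis_subspace_exists[OF subspace_lower_central] by metis
  from fin[OF B(1,2)] obtain w where w: "w \<in> W B" "w \<notin> H" by auto
  have "B \<subseteq> {c. bracket c w \<in> H}" using w(1) by (auto simp: W_def)
  then have "span B \<subseteq> {c. bracket c w \<in> H}"
    by (rule span_minimal) (intro subspace_lin_vimage lin_ad_left subspace_cartan)
  then show ?thesis using w B(3) by (auto simp: W_def)
qed

text \<open>Engel's argument for the nilpotent algebra \<open>H\<close> acting on \<open>(G \<inter> gen_weight H 0) / H\<close>, run down the lower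
  central series: consecutive terms act by commuting nilpotent maps.\<close>

lemma G_gen_weight_0: "G \<inter> gen_weight H 0 = H"
proof (rule ccontr)
  assume "G \<inter> gen_weight H 0 \<noteq> H"
  then obtain v where v: "v \<in> G \<inter> gen_weight H 0 - H" using cartan_subset cartan_in_gen_weight_0 by blast
  obtain N where N: "lower_central H N = {0}" by (rule lower_central_nilpotent)
  have "\<exists>v\<in>G \<inter> gen_weight H 0 - H. \<forall>c\<in>lower_central H N. bracket c v \<in> H"
    using v N subspace_0[OF subspace_cartan] by (auto simp: bracket_0_left)
  then have "\<exists>v\<in>G \<inter> gen_weight H 0 - H. \<forall>c\<in>lower_central H 0. bracket c v \<in> H"
    by (induction N) (use normalizer_step in blast)+
  then obtain v where v: "v \<in> G" "v \<notin> H" "\<And>c. c \<in> H \<Longrightarrow> bracket c v \<in> H" by auto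
  have "bracket v c \<in> H" if "c \<in> H" for c
    using v(3)[OF that] subspace_neg[OF subspace_cartan] bracket_swap[of v c] by metis
  then show False using cartan_normalizer v by blast
qed

lemma dim_gen_weight_pos: "\<beta> \<in> gen_weights H \<Longrightarrow> dim (gen_weight H \<beta>) > 0"
proof -
  assume "\<beta> \<in> gen_weights H"
  then have "\<not> gen_weight H \<beta> \<subseteq> {0}" using gen_weight_0[of H \<beta>] by (auto simp: gen_weights_def)
  then have "dim (gen_weight H \<beta>) \<noteq> 0" by (simp only: dim_eq_0 not_False_eq_True)
  then show "dim (gen_weight H \<beta>) > 0" by (rule neq0_conv[THEN iffD1])
qed

lemma trace_on_gen_weight:
  assumes "h \<in> H"
  shows "trace_on (gen_weight H \<beta>) (bracket h) = \<beta> h * of_nat (dim (gen_weight H \<beta>))"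
  by (rule trace_on_gen_eigenspace[OF subspace_gen_weight lin_ad cartan_ad_gen_weight[OF assms]]) (use assms in \<open>auto simp: gen_weight_def\<close>)

text \<open>\<open>\<beta> h\<close> is the trace of \<open>bracket h\<close> on the weight space
  divided by the dimension, and traces are linear in \<open>h\<close>; characteristic 0 permits the
  division.\<close>

lemma gen_weights_linear:
  assumes \<beta>: "\<beta> \<in> gen_weights H" and h: "h \<in> H" "h' \<in> H"
  shows "\<beta> (h + h') = \<beta> h + \<beta> h'" "\<beta> (c \<cdot> h) = c * \<beta> h"
proof -
  have d: "of_nat (dim (gen_weight H \<beta>)) \<noteq> (0::'k)" using dim_gen_weight_pos[OF \<beta>] by simp
  have "trace_on (gen_weight H \<beta>) (bracket (h + h')) = trace_on (gen_weight H \<beta>) (bracket h) + trace_on (gen_weight H \<beta>) (bracket h')"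
    using trace_on_add[OF subspace_gen_weight cartan_ad_gen_weight[OF h(1)] cartan_ad_gen_weight[OF h(2)]]
    by (simp add: bracket_add_left[abs_def])
  then show "\<beta> (h + h') = \<beta> h + \<beta> h'"
    using d by (simp add: trace_on_gen_weight h subspace_add[OF subspace_cartan] flip: distrib_right)
  have "trace_on (gen_weight H \<beta>) (bracket (c \<cdot> h)) = c * trace_on (gen_weight H \<beta>) (bracket h)"
    using trace_on_scale[OF subspace_gen_weight cartan_ad_gen_weight[OF h(1)]] by (simp add: bracket_scale_left[abs_def])
  then show "\<beta> (c \<cdot> h) = c * \<beta> h"
    using d by (simp add: trace_on_gen_weight h subspace_scale[OF subspace_cartan])
qed

lemma kappa_cartan_square:
  assumes h: "h \<in> H"
  shows "kappa h h = (\<Sum>\<beta>\<in>gen_weights H. (\<beta> h * \<beta> h) * of_nat (dim (gen_weight H \<beta>)))"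
proof -
  have U: "span (\<Union>\<mu>\<in>gen_weights H. gen_weight H \<mu>) = UNIV" using cartan_span_UNIV by auto
  have "kappa h h = (\<Sum>\<beta>\<in>gen_weights H. trace_on (gen_weight H \<beta>) (\<lambda>v. bracket h (bracket h v)))"
    using trace_on_direct[OF gen_weight_dir lin_ad2, of H h h] cartan_ad_gen_weight[OF h] unfolding kappa_def U by blast
  also have "\<dots> = (\<Sum>\<beta>\<in>gen_weights H. (\<beta> h * \<beta> h) * of_nat (dim (gen_weight H \<beta>)))"
    by (intro sum.cong refl trace_on_gen_eigenspace subspace_gen_weight lin_ad2 gen_eigenspace_square lin_ad)
      (use cartan_ad_gen_weight h in \<open>auto simp: gen_weight_def\<close>)
  finally show ?thesis .
qed

text \<open>The trace of a commutator vanishes on the \<open>a\<close>-string through \<open>\<beta>\<close>.\<close>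

lemma weight_string:
  assumes x: "x \<in> gen_weight H a" and y: "y \<in> gen_weight H (- a)" and h: "bracket x y \<in> H"
    and a: "\<And>z. z \<notin> H \<Longrightarrow> a z = 0" and \<beta>: "\<beta> \<in> gen_weights H"
  shows "\<exists>(D::nat) (N::int). D > 0 \<and> of_nat D * \<beta> (bracket x y) = of_int N * a (bracket x y)"
proof -
  \<comment> \<open>All integer translates of \<open>\<beta>\<close> by \<open>a\<close> that are
    weights, gaps allowed. For \<open>a = 0\<close> this is \<open>\<beta>\<close> alone, the case
    used for commutators inside \<open>H\<close>.\<close>
  define S where "S = {\<gamma> \<in> gen_weights H. \<exists>n::int. \<gamma> = (\<lambda>z. \<beta> z + of_int n * a z)}"
  have "\<forall>\<gamma>\<in>S. \<exists>n::int. \<gamma> = (\<lambda>z. \<beta> z + of_int n * a z)" by (auto simp: S_def)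
  then obtain n :: "('a \<Rightarrow> 'k) \<Rightarrow> int" where n: "\<And>\<gamma>. \<gamma> \<in> S \<Longrightarrow> \<gamma> = (\<lambda>z. \<beta> z + of_int (n \<gamma>) * a z)" by metis
  have fS: "finite S" unfolding S_def using finite_gen_weights by auto
  have dS: "direct S (gen_weight H)" by (rule gen_weight_direct[OF fS]) (auto simp: S_def)
  have \<beta>S: "\<beta> \<in> S" using \<beta> by (auto simp: S_def intro!: exI[of _ 0])
  let ?U = "span (\<Union>\<gamma>\<in>S. gen_weight H \<gamma>)"
  have step: "bracket z v \<in> ?U" if z: "z \<in> gen_weight H b" and b: "b = a \<or> b = - a" and v: "v \<in> ?U" for z v b
  proof -
    have "(\<Union>\<gamma>\<in>S. gen_weight H \<gamma>) \<subseteq> {v. bracket z v \<in> ?U}"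
    proof safe
      fix \<gamma> v assume \<gamma>: "\<gamma> \<in> S" and v: "v \<in> gen_weight H \<gamma>"
      show "bracket z v \<in> ?U"
      proof (cases "bracket z v = 0")
        case False
        have m: "bracket z v \<in> gen_weight H (b + \<gamma>)" by (rule gen_weight_bracket[OF z v])
        have "b + \<gamma> \<in> gen_weights H" using m False \<gamma> a b by (auto simp: gen_weights_def S_def)
        moreover have "\<exists>k::int. b + \<gamma> = (\<lambda>z. \<beta> z + of_int k * a z)"
        proof -
          obtain k :: int where k: "\<gamma> = (\<lambda>z. \<beta> z + of_int k * a z)" using n[OF \<gamma>] by blast
          show ?thesis using b
          proof
            assume "b = a"
            then show ?thesis using k by (intro exI[of _ "k + 1"]) (auto simp: fun_eq_iff algebra_simps)
          next
            assume "b = - a"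
            then show ?thesis using k by (intro exI[of _ "k - 1"]) (auto simp: fun_eq_iff algebra_simps)
          qed
        qed
        ultimately have "b + \<gamma> \<in> S" by (auto simp: S_def)
        then show ?thesis using m by (auto intro: span_base)
      qed (simp add: span_zero)
    qed
    then have "?U \<subseteq> {v. bracket z v \<in> ?U}"
      by (rule span_minimal) (intro subspace_lin_vimage lin_ad subspace_span)
    then show ?thesis using v by auto
  qed
  let ?h = "bracket x y"
  let ?d = "\<lambda>\<gamma>. dim (gen_weight H \<gamma>)"
  have "0 = trace_on ?U (bracket ?h)"
    by (rule trace_ad_bracket[symmetric, OF subspace_span]) (use step x y in blast)+
  also have "\<dots> = (\<Sum>\<gamma>\<in>S. trace_on (gen_weight H \<gamma>) (bracket ?h))"
    by (rule trace_on_direct[OF dS lin_ad]) (rule cartan_ad_gen_weight[OF h])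
  also have "\<dots> = (\<Sum>\<gamma>\<in>S. \<gamma> ?h * of_nat (?d \<gamma>))" by (simp add: trace_on_gen_weight[OF h])
  also have "\<dots> = (\<Sum>\<gamma>\<in>S. (\<beta> ?h + of_int (n \<gamma>) * a ?h) * of_nat (?d \<gamma>))"
  proof (rule sum.cong[OF refl])
    fix \<gamma> assume "\<gamma> \<in> S"
    from fun_cong[OF n[OF this], of ?h]
    show "\<gamma> ?h * of_nat (?d \<gamma>) = (\<beta> ?h + of_int (n \<gamma>) * a ?h) * of_nat (?d \<gamma>)" by simp
  qed
  also have "\<dots> = of_nat (\<Sum>\<gamma>\<in>S. ?d \<gamma>) * \<beta> ?h + of_int (\<Sum>\<gamma>\<in>S. n \<gamma> * int (?d \<gamma>)) * a ?h"
    by (simp add: sum_distrib_left sum_distrib_right sum.distrib algebra_simps)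
  finally have "of_nat (\<Sum>\<gamma>\<in>S. ?d \<gamma>) * \<beta> ?h = of_int (- (\<Sum>\<gamma>\<in>S. n \<gamma> * int (?d \<gamma>))) * a ?h"
    by (simp add: eq_neg_iff_add_eq_0)
  moreover have "(\<Sum>\<gamma>\<in>S. ?d \<gamma>) > 0"
    using sum_pos2[OF fS \<beta>S, of ?d] dim_gen_weight_pos[OF \<beta>] by simp
  ultimately show ?thesis by blast
qed

lemma bracket_opposite_in_cartan: "x \<in> G \<inter> gen_weight H a \<Longrightarrow> y \<in> G \<inter> gen_weight H (- a) \<Longrightarrow> bracket x y \<in> H"
  using G_gen_weight_0 gen_weight_bracket[of x H a y "- a"] G_bracket by auto

text \<open>If the form vanished on \<open>G\<close>, so would all weights on brackets of opposite
  weight vectors. As \<open>G\<close> is perfect, these brackets span its weight 0 part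
  \<open>H\<close>. Without nonzero weights \<open>G = H\<close> would be both perfect and
  nilpotent.\<close>

lemma kappa_G_nonzero: "\<exists>x\<in>G. \<exists>y\<in>G. kappa x y \<noteq> 0"
proof (rule ccontr)
  assume "\<not> ?thesis"
  then have k0: "\<And>x y. x \<in> G \<Longrightarrow> y \<in> G \<Longrightarrow> kappa x y = 0" by auto
  let ?X = "gen_weights H"
  have van: "\<beta> (bracket x y) = 0" if a: "a \<in> ?X" and x: "x \<in> G \<inter> gen_weight H a" and y: "y \<in> G \<inter> gen_weight H (- a)" and \<beta>: "\<beta> \<in> ?X" for a x y \<beta>
  proof -
    let ?h = "bracket x y"
    have h: "?h \<in> H" by (rule bracket_opposite_in_cartan[OF x y])
    have az: "a z = 0" if "z \<notin> H" for z using a that by (auto simp: gen_weights_def)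
    have "\<forall>\<beta>\<in>?X. \<exists>D N. D > (0::nat) \<and> of_nat D * \<beta> ?h = of_int N * a ?h"
    proof
      fix \<beta> assume \<beta>: "\<beta> \<in> ?X"
      from weight_string[OF IntD2[OF x] IntD2[OF y] h _ \<beta>] az
      show "\<exists>D N. D > (0::nat) \<and> of_nat D * \<beta> ?h = of_int N * a ?h" by simp
    qed
    then obtain D N where DN: "\<And>\<beta>. \<beta> \<in> ?X \<Longrightarrow> D \<beta> > (0::nat)" "\<And>\<beta>. \<beta> \<in> ?X \<Longrightarrow> of_nat (D \<beta>) * \<beta> ?h = of_int (N \<beta>) * a ?h"
      by metis
    have "a ?h = 0"
    proof (rule ccontr)
      assume ah: "a ?h \<noteq> 0"
      \<comment> \<open>All weights are rational multiples of \<open>a\<close> at \<open>?h\<close>,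
        so \<open>kappa ?h ?h = 0\<close> becomes a vanishing sum of rational squares with positive
        multiplicities; its term for \<open>a\<close> itself contradicts
        \<open>a ?h \<noteq> 0\<close>.\<close>
      define q :: "('a \<Rightarrow> 'k) \<Rightarrow> rat" where "q \<beta> = of_int (N \<beta>) / of_nat (D \<beta>)" for \<beta>
      have q: "\<beta> ?h = of_rat (q \<beta>) * a ?h" if "\<beta> \<in> ?X" for \<beta>
        using DN[OF that] by (simp add: q_def of_rat_divide field_simps)
      have "0 = (\<Sum>\<beta>\<in>?X. (\<beta> ?h * \<beta> ?h) * of_nat (dim (gen_weight H \<beta>)))"
        using kappa_cartan_square[OF h] k0 h cartan_subset by auto
      also have "\<dots> = (\<Sum>\<beta>\<in>?X. of_rat (q \<beta> * q \<beta> * of_nat (dim (gen_weight H \<beta>))) * (a ?h * a ?h))"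
        by (intro sum.cong refl) (simp add: q of_rat_mult algebra_simps)
      also have "\<dots> = of_rat (\<Sum>\<beta>\<in>?X. q \<beta> * q \<beta> * of_nat (dim (gen_weight H \<beta>))) * (a ?h * a ?h)"
        by (simp add: of_rat_sum sum_distrib_right)
      finally have "(\<Sum>\<beta>\<in>?X. q \<beta> * q \<beta> * of_nat (dim (gen_weight H \<beta>))) = 0" using ah by simp
      then have "q a * q a * of_nat (dim (gen_weight H a)) = 0"
        using a finite_gen_weights by (subst (asm) sum_nonneg_eq_0_iff) auto
      then have "q a = 0" using dim_gen_weight_pos[OF a] by simp
      then show False using q[OF a] ah by simp
    qed
    then show ?thesis using DN[OF \<beta>] by simp
  qed
  let ?c = "component ?X (gen_weight H) 0"
  \<comment> \<open>Only products of opposite weight vectors contribute to the weight 0 component of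
    a bracket, and this component fixes every element of \<open>H\<close>.\<close>
  define P where "P = {bracket x y | x y a. a \<in> ?X \<and> x \<in> G \<inter> gen_weight H a \<and> y \<in> G \<inter> gen_weight H (- a)}"
  have linc: "lin ?c"
    by (rule linI) (simp_all add: component_add[OF gen_weight_dir cartan_span_UNIV cartan_span_UNIV] component_scale[OF gen_weight_dir cartan_span_UNIV])
  have cP: "?c (bracket x y) \<in> span P" if x: "x \<in> G" and y: "y \<in> G" for x y
  proof -
    obtain u where u: "\<forall>\<mu>\<in>?X. u \<mu> \<in> G \<inter> gen_weight H \<mu>" "x = sum u ?X"
      using G_decomp[OF x] by blast
    obtain v where v: "\<forall>\<mu>\<in>?X. v \<mu> \<in> G \<inter> gen_weight H \<mu>" "y = sum v ?X"
      using G_decomp[OF y] by blast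
    have t: "?c (bracket (u a) (v b)) \<in> span P" if ab: "a \<in> ?X" "b \<in> ?X" for a b
    proof (cases "bracket (u a) (v b) = 0")
      case True
      then show ?thesis by (simp add: lin_0[OF linc] span_zero)
    next
      case False
      have m: "bracket (u a) (v b) \<in> gen_weight H (a + b)" using u v ab by (intro gen_weight_bracket) auto
      have X: "a + b \<in> ?X" by (rule gen_weights_add[OF m False ab])
      show ?thesis
      proof (cases "a + b = 0")
        case True
        then have "b = - a" by (simp add: add_eq_0_iff)
        then have "bracket (u a) (v b) \<in> P" using u v ab unfolding P_def by blast
        then show ?thesis using True component_of_mem[OF gen_weight_dir, OF X m, of 0] by (auto intro: span_base)
      next
        case False
        then show ?thesis using component_of_mem[OF gen_weight_dir, OF X m, of 0] by (auto intro: span_zero)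
      qed
    qed
    have "?c (bracket x y) = (\<Sum>a\<in>?X. \<Sum>b\<in>?X. ?c (bracket (u a) (v b)))"
      by (simp add: u(2) v(2) bracket_sum_left bracket_sum_right lin_sum[OF linc]) (rule sum.swap)
    then show ?thesis using t by (auto intro: span_sum)
  qed
  have "{bracket x y | x y. x \<in> G \<and> y \<in> G} \<subseteq> {z. ?c z \<in> span P}" using cP by auto
  then have "span {bracket x y | x y. x \<in> G \<and> y \<in> G} \<subseteq> {z. ?c z \<in> span P}"
    by (rule span_minimal) (intro subspace_lin_vimage linc subspace_span)
  then have cG: "?c z \<in> span P" if "z \<in> G" for z using that simple_perfect[OF simple_fixed] by auto
  have \<beta>0: "\<beta> h = 0" if \<beta>: "\<beta> \<in> ?X" and h: "h \<in> H" for \<beta> h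
  proof -
    have "subspace {z \<in> H. \<beta> z = 0}"
      using gen_weights_linear[OF \<beta>] subspace_cartan gen_weights_linear(2)[OF \<beta>, of 0 0 0] by (auto simp: subspace_def)
    moreover have "P \<subseteq> {z \<in> H. \<beta> z = 0}" using van \<beta> bracket_opposite_in_cartan unfolding P_def by blast
    ultimately have "span P \<subseteq> {z \<in> H. \<beta> z = 0}" by (intro span_minimal)
    then have "?c h \<in> {z \<in> H. \<beta> z = 0}" using cG[of h] h cartan_subset by auto
    moreover have "?c h = h"
    proof (cases "h = 0")
      case False
      have m: "h \<in> gen_weight H 0" using h cartan_in_gen_weight_0 by auto
      then have "0 \<in> ?X" using False by (auto simp: gen_weights_def)
      from component_of_mem[OF gen_weight_dir, OF this m] show ?thesis by simp
    qed (simp add: lin_0[OF linc])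
    ultimately show ?thesis by simp
  qed
  have "?X \<subseteq> {0}"
  proof
    fix \<beta> assume \<beta>: "\<beta> \<in> ?X"
    then have "\<beta> z = 0" for z using \<beta>0[OF \<beta>, of z] by (cases "z \<in> H") (auto simp: gen_weights_def)
    then show "\<beta> \<in> {0}" by (auto simp: fun_eq_iff)
  qed
  then have "(\<Union>\<mu>\<in>?X. gen_weight H \<mu>) \<subseteq> gen_weight H 0" by auto
  then have "span (\<Union>\<mu>\<in>?X. gen_weight H \<mu>) \<subseteq> gen_weight H 0" by (rule span_minimal) (rule subspace_gen_weight)
  \<comment> \<open>The whole algebra now has weight 0, so \<open>G\<close> coincides with its
    weight 0 part.\<close>
  then have GH: "G = H" using cartan_span_UNIV G_gen_weight_0 by blast
  have "lower_central H n = H" for n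
  proof (induction n)
    case (Suc n)
    then show ?case using simple_perfect[OF simple_fixed] GH by simp
  qed simp
  then have "H = {0}" using lower_central_nilpotent by metis
  then show False using simple_fixed GH by (auto simp: simple_lie_def bracket_0_left)
qed

lemma nondeg_G: "nondeg_on G" and nondeg_UNIV: "nondeg_on UNIV"
  using kappa_G_nonzero simple_nondeg[OF simple_fixed] simple_nondeg[OF simple] by blast+

text \<open>The product of the adjoint maps translates weights by the nonzero \<open>a + b\<close>,
  so it has no diagonal blocks. The last condition keeps the translate zero outside
  \<open>H\<close>, as \<open>gen_weights\<close> requires.\<close>

lemma kappa_gen_weight_orth:
  assumes x: "x \<in> gen_weight H a" and y: "y \<in> gen_weight H b" and ab: "a + b \<noteq> 0" "\<And>z. z \<notin> H \<Longrightarrow> a z + b z = 0"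
  shows "kappa x y = 0"
proof -
  have U: "span (\<Union>\<mu>\<in>gen_weights H. gen_weight H \<mu>) = UNIV" using cartan_span_UNIV by auto
  have "trace_on (span (\<Union>\<mu>\<in>gen_weights H. gen_weight H \<mu>)) (\<lambda>v. bracket x (bracket y v)) = 0"
  proof (rule trace_on_direct_0[OF gen_weight_dir lin_ad2])
    fix \<mu> v assume \<mu>: "\<mu> \<in> gen_weights H" and v: "v \<in> gen_weight H \<mu>"
    let ?w = "bracket x (bracket y v)"
    have m: "?w \<in> gen_weight H (a + (b + \<mu>))" by (intro gen_weight_bracket x y v)
    have ne: "a + (b + \<mu>) \<noteq> \<mu>" using ab(1) by (simp add: add.assoc[symmetric])
    show "?w = 0 \<or> (\<exists>\<nu>\<in>gen_weights H. ?w \<in> gen_weight H \<nu> \<and> \<nu> \<noteq> \<mu>)"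
    proof (cases "?w = 0")
      case False
      have "a + (b + \<mu>) \<in> gen_weights H"
        using m False \<mu> ab(2) by (auto simp: gen_weights_def add.assoc[symmetric])
      then show ?thesis using m ne by blast
    qed simp
  qed
  then show ?thesis by (simp add: kappa_def U)
qed

text \<open>\<open>H\<close> is the weight 0 part of \<open>G\<close> and orthogonal to the other
  weight spaces, so an element of \<open>H\<close> orthogonal to \<open>H\<close> is orthogonal to
  \<open>G\<close>.\<close>

lemma nondeg_cartan:
  assumes x: "x \<in> H" and z: "\<And>z. z \<in> H \<Longrightarrow> kappa x z = 0"
  shows "x = 0"
proof -
  have "kappa x y = 0" if "y \<in> G" for y
  proof (rule kappa_span_0)
    show "y \<in> span (\<Union>\<mu>\<in>gen_weights H. G \<inter> gen_weight H \<mu>)" using that G_span by blast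
    fix w assume "w \<in> (\<Union>\<mu>\<in>gen_weights H. G \<inter> gen_weight H \<mu>)"
    then obtain \<mu> where \<mu>: "\<mu> \<in> gen_weights H" "w \<in> G \<inter> gen_weight H \<mu>" by blast
    show "kappa x w = 0"
    proof (cases "\<mu> = 0")
      case True
      then show ?thesis using \<mu> G_gen_weight_0 z by auto
    next
      case False
      show ?thesis
        by (rule kappa_gen_weight_orth[of x 0 w \<mu>]) (use x \<mu> False cartan_in_gen_weight_0 in \<open>auto simp: gen_weights_def\<close>)
    qed
  qed
  then show ?thesis using nondeg_G x cartan_subset by (auto simp: nondeg_on_def)
qed

text \<open>Otherwise the last nonzero term of the lower central series is central and lies in
  \<open>[H, H]\<close>. Weights vanish there by \<open>weight_string\<close> with
  \<open>a = 0\<close>, so its elements are ad-nilpotent, hence orthogonal to \<open>H\<close>,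
  hence zero.\<close>

lemma cartan_abelian:
  assumes "x \<in> H" "y \<in> H"
  shows "bracket x y = 0"
proof (rule ccontr)
  assume nz: "bracket x y \<noteq> 0"
  have L1: "lower_central H (Suc 0) \<noteq> {0}"
    using lower_central_bracket[of x y 0] assms nz by auto
  obtain N where N: "lower_central H N = {0}" by (rule lower_central_nilpotent)
  define n where "n = (LEAST n. lower_central H n = {0})"
  have n: "lower_central H n = {0}" unfolding n_def by (rule LeastI[of _ N]) (rule N)
  have "n \<noteq> 0"
  proof
    assume "n = 0"
    then have "x = 0" using n assms(1) by simp
    then show False using nz bracket_0_left by simp
  qed
  moreover have "n \<noteq> Suc 0" using n L1 by metis
  \<comment> \<open>An index of at least 2 ensures that the last nonzero term is spanned by
    commutators.\<close>
  ultimately obtain i where i: "n = Suc (Suc i)" using not0_implies_Suc by blast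
  have "lower_central H (Suc i) \<noteq> {0}"
    using not_less_Least[of "Suc i" "\<lambda>n. lower_central H n = {0}"] i by (simp add: n_def)
  then obtain c where c: "c \<in> lower_central H (Suc i)" "c \<noteq> 0"
    using subspace_0[OF subspace_lower_central] by blast
  have cH: "c \<in> H" using c lower_central_subset by blast
  have central: "bracket c z = 0" if "z \<in> H" for z
    using lower_central_bracket[OF that c(1)] n i bracket_swap[of c z] by simp
  have \<beta>c: "\<beta> c = 0" if \<beta>: "\<beta> \<in> gen_weights H" for \<beta>
  proof -
    have "\<beta> (bracket u v) = 0" if uv: "u \<in> H" "v \<in> H" for u v
    proof -
      have uu: "u \<in> gen_weight H 0" "v \<in> gen_weight H (- 0)" using uv cartan_in_gen_weight_0 by auto
      have "\<exists>(D::nat) (N::int). D > 0 \<and> of_nat D * \<beta> (bracket u v) = of_int N * (0::'a \<Rightarrow> 'k) (bracket u v)"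
        by (rule weight_string[OF uu cartan_bracket[OF uv] _ \<beta>]) simp
      then show ?thesis by auto
    qed
    then have "{bracket u v | u v. u \<in> H \<and> v \<in> lower_central H i} \<subseteq> {z \<in> H. \<beta> z = 0}"
      using cartan_bracket lower_central_subset by blast
    moreover have "subspace {z \<in> H. \<beta> z = 0}"
      using gen_weights_linear[OF \<beta>] subspace_cartan gen_weights_linear(2)[OF \<beta>, of 0 0 0] by (auto simp: subspace_def)
    ultimately have "span {bracket u v | u v. u \<in> H \<and> v \<in> lower_central H i} \<subseteq> {z \<in> H. \<beta> z = 0}"
      by (rule span_minimal)
    then show ?thesis using c(1) by auto
  qed
  have "(\<Union>\<mu>\<in>gen_weights H. gen_weight H \<mu>) \<subseteq> gen_eigenspace (bracket c) 0"
    using \<beta>c cH by (force simp: gen_weight_def)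
  then have "span (\<Union>\<mu>\<in>gen_weights H. gen_weight H \<mu>) \<subseteq> gen_eigenspace (bracket c) 0"
    by (rule span_minimal) (intro subspace_gen_eigenspace lin_ad)
  then have nil: "v \<in> gen_eigenspace (bracket c) 0" for v using cartan_span_UNIV by blast
  have "c = 0" by (rule nondeg_cartan[OF cH]) (use nil central kappa_nilpotent in blast)
  then show False using c by simp
qed

text \<open>The semisimple part \<open>s\<close> lies in \<open>G\<close> and centralizes
  \<open>H\<close>, hence lies in \<open>H\<close>. Then \<open>h - s\<close> is an ad-nilpotent
  element of the abelian algebra \<open>H\<close>, so it is orthogonal to \<open>H\<close> and
  zero.\<close>

lemma cartan_semisimple:
  assumes h: "h \<in> H"
  shows "ss_part h h"
proof -
  obtain s where s: "ss_part h s" using ss_part_exists[OF nondeg_UNIV] by blast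
  have sG: "s \<in> G" using ss_part_fixed[OF s] h cartan_subset by auto
  have s0: "bracket s y = 0" if "y \<in> H" for y
    using s cartan_nil[OF h that] by (simp add: ss_part_def)
  then have "s \<in> H" using subspace_0[OF subspace_cartan] by (intro cartan_normalizer[OF sG]) auto
  then have n: "h - s \<in> H" using h by (intro subspace_diff subspace_cartan)
  have "h - s = 0"
    by (rule nondeg_cartan[OF n], rule kappa_nilpotent) (use ss_part_nilpotent[OF s] cartan_abelian[OF n] in auto)
  then show ?thesis using s by simp
qed

lemma gen_weight_eigen: "v \<in> gen_weight H \<mu> \<Longrightarrow> h \<in> H \<Longrightarrow> bracket h v = \<mu> h \<cdot> v"
  using cartan_semisimple by (auto simp: gen_weight_def ss_part_def)

lemma gen_weight_eq_weight_space: "gen_weight H \<mu> = weight_space H UNIV \<mu>"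
  by (auto simp: weight_space_def gen_weight_eigen) (auto simp: gen_weight_def intro: eigen_in_gen_eigenspace)

lemma gen_weights_eq_weights: "gen_weights H = weights H UNIV"
  using gen_weights_linear by (auto simp: weights_def gen_weight_eq_weight_space[symmetric] dual_space_def)
    (auto simp: gen_weights_def)

end

end

section \<open>Exponentials of nilpotent derivations\<close>

context fin_lie
begin

text \<open>Divided powers, for which the Leibniz rule has no binomial coefficients.\<close>

definition dpow :: "'a \<Rightarrow> nat \<Rightarrow> 'a \<Rightarrow> 'a" where
  "dpow y n v = (1 / fact n) \<cdot> (bracket y ^^ n) v"

definition expo :: "nat \<Rightarrow> 'a \<Rightarrow> 'a \<Rightarrow> 'a" where
  "expo N y v = (\<Sum>n<N. dpow y n v)"

lemma lin_dpow: "lin (dpow y n)"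
  by (rule linI) (simp_all add: dpow_def lin_add[OF lin_funpow[OF lin_ad]] lin_scale[OF lin_funpow[OF lin_ad]]
      scale_right_distrib mult.commute)

lemma bracket_dpow: "bracket y (dpow y n v) = of_nat (Suc n) \<cdot> dpow y (Suc n) v"
  by (simp add: dpow_def bracket_scale_right field_simps del: of_nat_Suc)

text \<open>After multiplication by \<open>n + 1\<close>, the product of the divided powers of index
  \<open>i\<close> and \<open>n + 1 - i\<close> arises \<open>i\<close> times from differentiating
  the first factor and \<open>n + 1 - i\<close> times from the second.\<close>

lemma dpow_bracket: "dpow y n (bracket u v) = (\<Sum>i\<le>n. bracket (dpow y i u) (dpow y (n - i) v))"
proof (induction n)
  case 0
  show ?case by (simp add: dpow_def)
next
  case (Suc n)
  let ?a = "\<lambda>i. bracket (dpow y i u) (dpow y (Suc n - i) v)"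
  have "of_nat (Suc n) \<cdot> dpow y (Suc n) (bracket u v) = bracket y (dpow y n (bracket u v))"
    by (simp only: bracket_dpow)
  also have "\<dots> = (\<Sum>i\<le>n. bracket (bracket y (dpow y i u)) (dpow y (n - i) v) + bracket (dpow y i u) (bracket y (dpow y (n - i) v)))"
    by (simp only: Suc bracket_sum_right jacobi_ad[of y "dpow y i u" for i])
  also have "\<dots> = (\<Sum>i\<le>n. of_nat (Suc i) \<cdot> ?a (Suc i)) + (\<Sum>i\<le>n. of_nat (Suc n - i) \<cdot> ?a i)"
    unfolding sum.distrib
    by (intro arg_cong2[where f="(+)"] sum.cong refl)
      (simp_all add: bracket_dpow bracket_scale_left bracket_scale_right Suc_diff_le del: of_nat_Suc)
  also have "(\<Sum>i\<le>n. of_nat (Suc i) \<cdot> ?a (Suc i)) = (\<Sum>i\<le>Suc n. of_nat i \<cdot> ?a i)"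
    by (subst sum.atMost_Suc_shift) simp
  also have "(\<Sum>i\<le>n. of_nat (Suc n - i) \<cdot> ?a i) = (\<Sum>i\<le>Suc n. of_nat (Suc n - i) \<cdot> ?a i)"
    by simp
  also have "(\<Sum>i\<le>Suc n. of_nat i \<cdot> ?a i) + \<dots> = (\<Sum>i\<le>Suc n. of_nat (Suc n) \<cdot> ?a i)"
    unfolding sum.distrib[symmetric] scale_left_distrib[symmetric] of_nat_add[symmetric]
    by (intro sum.cong refl) simp
  also have "\<dots> = of_nat (Suc n) \<cdot> (\<Sum>i\<le>Suc n. ?a i)" by (rule scale_sum_right[symmetric])
  finally show ?case by (simp only: scale_cancel_left of_nat_eq_0_iff) simp
qed

lemma lin_expo: "lin (expo N y)"
  by (rule linI) (simp_all add: expo_def lin_add[OF lin_dpow] lin_scale[OF lin_dpow] sum.distrib scale_sum_right)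

context
  fixes N y
  assumes nil: "\<And>v. (bracket y ^^ N) v = 0"
begin

lemma nil_ge: "n \<ge> N \<Longrightarrow> (bracket y ^^ n) v = 0"
  using funpow_add[of "n - N" N "bracket y"] nil lin_0[OF lin_funpow[OF lin_ad]] by simp

lemma dpow_ge: "n \<ge> N \<Longrightarrow> dpow y n v = 0"
  by (simp add: dpow_def nil_ge)

lemma expo_ge: "M \<ge> N \<Longrightarrow> expo M y v = expo N y v"
  unfolding expo_def by (rule sum.mono_neutral_right) (auto simp: dpow_ge)

lemma expo_bracket: "expo N y (bracket u v) = bracket (expo N y u) (expo N y v)"
proof -
  let ?f = "\<lambda>i j. bracket (dpow y i u) (dpow y j v)"
  \<comment> \<open>Truncating at \<open>2 * N\<close> makes the triangle
    \<open>i + j < 2 * N\<close> contain all pairs of indices below \<open>N\<close>; outside this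
    square one factor vanishes.\<close>
  have "expo N y (bracket u v) = expo (2 * N) y (bracket u v)" by (rule expo_ge[symmetric]) simp
  also have "\<dots> = (\<Sum>n<2 * N. \<Sum>i\<le>n. ?f i (n - i))" by (simp add: expo_def dpow_bracket)
  also have "\<dots> = (\<Sum>(i, j)\<in>{(i, j). i + j < 2 * N}. ?f i j)" by (rule sum.triangle_reindex[symmetric])
  also have "\<dots> = (\<Sum>(i, j)\<in>{..<N} \<times> {..<N}. ?f i j)"
  proof (rule sum.mono_neutral_right)
    show "finite {(i, j). i + j < 2 * N}"
      by (rule finite_subset[of _ "{..<2 * N} \<times> {..<2 * N}"]) auto
    show "\<forall>x\<in>{(i, j). i + j < 2 * N} - {..<N} \<times> {..<N}. (case x of (i, j) \<Rightarrow> ?f i j) = 0"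
    proof
      fix x assume x: "x \<in> {(i, j). i + j < 2 * N} - {..<N} \<times> {..<N}"
      obtain i j where ij: "x = (i, j)" by fastforce
      then have "i \<ge> N \<or> j \<ge> N" using x by auto
      then show "(case x of (i, j) \<Rightarrow> ?f i j) = 0"
        by (auto simp: ij dpow_ge bracket_0_left bracket_0_right)
    qed
  qed auto
  also have "\<dots> = bracket (expo N y u) (expo N y v)"
    by (simp add: expo_def bracket_sum_left bracket_sum_right sum.cartesian_product[symmetric])
      (rule sum.swap)
  finally show ?thesis .
qed

text \<open>For a nonzero vector in the kernel, apply the last power of \<open>bracket y\<close>
  that does not kill it: in the exponential sum only the term of index 0 survives, and it is
  nonzero.\<close>

lemma expo_inj: "inj (expo N y)"
proof (rule injI)
  fix v w assume "expo N y v = expo N y w"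
  then have z: "expo N y (v - w) = 0" by (simp add: lin_diff[OF lin_expo])
  show "v = w"
  proof (rule ccontr)
    assume vw: "v \<noteq> w"
    let ?P = "\<lambda>k. (bracket y ^^ k) (v - w) = 0"
    define k where "k = (LEAST k. ?P k)"
    have k: "?P k" unfolding k_def by (rule LeastI[of ?P N]) (rule nil)
    have "k \<noteq> 0" using k vw by (metis funpow_0 right_minus_eq)
    then obtain m where m: "k = Suc m" using not0_implies_Suc by blast
    have nm: "\<not> ?P m" using not_less_Least[of m ?P] m by (simp add: k_def)
    have N: "N > 0" using nil[of "v - w"] vw by (cases N) auto
    have pz: "(bracket y ^^ m) ((bracket y ^^ n) (v - w)) = 0" if n0: "n > 0" for n
    proof -
      obtain j where j: "n = Suc j" using gr0_implies_Suc[OF n0] by blast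
      have "(bracket y ^^ m) ((bracket y ^^ n) (v - w)) = (bracket y ^^ (m + n)) (v - w)"
        by (simp only: funpow_add o_apply)
      also have "m + n = j + k" using j m by simp
      also have "(bracket y ^^ (j + k)) (v - w) = (bracket y ^^ j) ((bracket y ^^ k) (v - w))"
        by (simp only: funpow_add o_apply)
      finally have "(bracket y ^^ m) ((bracket y ^^ n) (v - w)) = (bracket y ^^ j) ((bracket y ^^ k) (v - w))" .
      then show ?thesis by (simp add: k lin_0[OF lin_funpow[OF lin_ad]])
    qed
    have "0 = (bracket y ^^ m) (expo N y (v - w))" by (simp add: z lin_0[OF lin_funpow[OF lin_ad]])
    also have "\<dots> = (\<Sum>n<N. (1 / fact n) \<cdot> (bracket y ^^ m) ((bracket y ^^ n) (v - w)))"
      by (simp add: expo_def dpow_def lin_sum[OF lin_funpow[OF lin_ad]] lin_scale[OF lin_funpow[OF lin_ad]])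
    also have "\<dots> = (\<Sum>n\<in>{0}. (1 / fact n) \<cdot> (bracket y ^^ m) ((bracket y ^^ n) (v - w)))"
      by (rule sum.mono_neutral_right) (use N pz in auto)
    also have "\<dots> = (bracket y ^^ m) (v - w)" by simp
    finally show False using nm by simp
  qed
qed

lemma expo_bij: "bij (expo N y)"
  using expo_inj linear_inj_imp_surj[OF lin_expo expo_inj] by (simp add: bij_def)

end

section \<open>Dimensions of annihilators\<close>

lemma dim_le_annihilator:
  assumes "subspace A" "finite B"
  shows "dim A \<le> dim {x \<in> A. \<forall>b\<in>B. kappa x b = 0} + card B"
  using assms(2)
proof (induction B rule: finite_induct)
  case (insert b B)
  let ?A = "{x \<in> A. \<forall>b\<in>B. kappa x b = 0}"
  have "subspace ?A" using assms(1) by (auto simp: subspace_def kappa_0_left kappa_add_left kappa_scale_left)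
  then have "dim ?A \<le> dim {x \<in> ?A. kappa x b = 0} + 1"
    by (rule dim_le_kernel) (simp_all add: kappa_add_left kappa_scale_left)
  also have "{x \<in> ?A. kappa x b = 0} = {x \<in> A. \<forall>b\<in>insert b B. kappa x b = 0}" by auto
  finally show ?case using insert by simp
qed simp

lemma annihilator_span: "{x \<in> A. \<forall>b\<in>span B. kappa x b = 0} = {x \<in> A. \<forall>b\<in>B. kappa x b = 0}"
  using kappa_span_0 span_base by blast

lemma dim_annihilator_ge:
  assumes "subspace A" "subspace W"
  shows "dim A \<le> dim {x \<in> A. \<forall>w\<in>W. kappa x w = 0} + dim W"
proof -
  obtain B where B: "finite B" "span B = W" "card B = dim W" using basis_subspace_exists[OF assms(2)] by metis
  show ?thesis using dim_le_annihilator[OF assms(1) B(1)] B(3) annihilator_span[of A B] B(2) by simp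
qed

text \<open>Complete a basis of \<open>W\<close> to one of \<open>A\<close>. An element of the
  annihilator that is also orthogonal to the added vectors is orthogonal to \<open>A\<close>, so
  \<open>dim A - dim W\<close> equations cut the annihilator down to zero.\<close>

lemma dim_annihilator_le:
  assumes A: "subspace A" "nondeg_on A" and W: "subspace W" "W \<subseteq> A"
  shows "dim {x \<in> A. \<forall>w\<in>W. kappa x w = 0} + dim W \<le> dim A"
proof -
  obtain C where C: "C \<subseteq> W" "independent C" "span C = W" "card C = dim W"
    using basis_subspace_exists[OF W(1)] by metis
  have "C \<subseteq> A" using C W by auto
  from maximal_independent_subset_extend[OF this C(2)] obtain E
    where E: "C \<subseteq> E" "E \<subseteq> A" "independent E" "A \<subseteq> span E" by blast
  have sE: "span E = A" using E A by (simp add: span_subspace)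
  have cE: "card E = dim A" using basis_card_eq_dim[OF E(2,4,3)] .
  have fE: "finite E" by (rule finiteI_independent[OF E(3)])
  let ?K = "{x \<in> A. \<forall>w\<in>W. kappa x w = 0}"
  have K: "subspace ?K" using A(1) by (auto simp: subspace_def kappa_0_left kappa_add_left kappa_scale_left)
  have "{x \<in> ?K. \<forall>b\<in>E - C. kappa x b = 0} \<subseteq> {0}"
  proof
    fix x assume x: "x \<in> {x \<in> ?K. \<forall>b\<in>E - C. kappa x b = 0}"
    then have "kappa x b = 0" if "b \<in> E" for b using that C(1) by blast
    then have "kappa x b = 0" if "b \<in> A" for b using kappa_span_0[of E x b] that sE by blast
    then show "x \<in> {0}" using x A(2) by (auto simp: nondeg_on_def)
  qed
  then have z: "dim {x \<in> ?K. \<forall>b\<in>E - C. kappa x b = 0} = 0" by (simp only: dim_eq_0)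
  have "dim ?K \<le> dim {x \<in> ?K. \<forall>b\<in>E - C. kappa x b = 0} + card (E - C)"
    by (rule dim_le_annihilator[OF K]) (use fE in simp)
  then have "dim ?K \<le> card (E - C)" unfolding z by (simp only: add_0)
  also have "card (E - C) = dim A - dim W" using E(1) C(4) cE fE by (simp add: card_Diff_subset finite_subset)
  finally have "dim ?K \<le> dim A - dim W" .
  moreover have "dim W \<le> dim A" by (rule dim_subset[OF W(2)])
  ultimately show ?thesis by linarith
qed

end

section \<open>Rational functionals and integral levels\<close>

lemma rational_functional:
  fixes rs :: "rat \<Rightarrow> 'v::ab_group_add \<Rightarrow> 'v"
  assumes "vector_space rs" "finite \<Phi>"
  shows "\<exists>f. Vector_Spaces.linear rs (*) f \<and> (\<forall>\<alpha>\<in>\<Phi>. \<alpha> \<noteq> 0 \<longrightarrow> f \<alpha> \<noteq> (0::rat))"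
proof -
  interpret V: vector_space rs by fact
  have Q: "vector_space ((*) :: rat \<Rightarrow> rat \<Rightarrow> rat)" by unfold_locales (simp_all add: algebra_simps)
  interpret P: vector_space_pair rs "(*) :: rat \<Rightarrow> rat \<Rightarrow> rat"
    by (intro vector_space_pair.intro assms Q)
  have iff: "Vector_Spaces.linear rs (*) f \<longleftrightarrow> (\<forall>x y. f (x + y) = f x + f y) \<and> (\<forall>c x. f (rs c x) = c * f x)" for f
    using V.vector_space_axioms Q by (simp add: Vector_Spaces.linear_iff)
  show ?thesis using assms(2)
  proof (induction \<Phi> rule: finite_induct)
    case empty
    show ?case by (intro exI[of _ "\<lambda>_. 0"]) (simp add: iff)
  next
    case (insert \<beta> \<Phi>)
    then obtain f where f: "Vector_Spaces.linear rs (*) f" "\<And>\<alpha>. \<alpha> \<in> \<Phi> \<Longrightarrow> \<alpha> \<noteq> 0 \<Longrightarrow> f \<alpha> \<noteq> 0" by blast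
    show ?case
    proof (cases "\<beta> = 0 \<or> f \<beta> \<noteq> 0")
      case True
      then show ?thesis using f by blast
    next
      case False
      then have "V.independent {\<beta>}" by simp
      from P.linear_independent_extend[OF this, of "\<lambda>_. 1"] obtain g
        where g: "Vector_Spaces.linear rs (*) g" "g \<beta> = 1" by auto
      \<comment> \<open>A nonzero multiple of \<open>g\<close> makes the value at
        \<open>\<beta>\<close> nonzero; the finitely many other excluded factors would spoil a value
        on \<open>\<Phi>\<close>.\<close>
      have "finite (insert 0 ((\<lambda>\<alpha>. - f \<alpha> / g \<alpha>) ` \<Phi>))" using insert.hyps by simp
      then obtain t where t: "t \<notin> insert 0 ((\<lambda>\<alpha>. - f \<alpha> / g \<alpha>) ` \<Phi>)"
        using ex_new_if_finite[OF infinite_UNIV_char_0] by blast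
      have "f \<alpha> + t * g \<alpha> \<noteq> 0" if "\<alpha> \<in> \<Phi>" "\<alpha> \<noteq> 0" for \<alpha>
      proof (cases "g \<alpha> = 0")
        case False
        have "t \<noteq> - f \<alpha> / g \<alpha>" using t that by blast
        then show ?thesis using False by (simp add: field_simps eq_neg_iff_add_eq_0)
      qed (use f that in simp)
      moreover have "f \<beta> + t * g \<beta> \<noteq> 0" using False g t by simp
      ultimately show ?thesis using f g
        by (intro exI[of _ "\<lambda>x. f x + t * g x"]) (auto simp: iff algebra_simps)
    qed
  qed
qed

lemma common_denominator:
  assumes "finite A"
  shows "\<exists>D>0. \<forall>q\<in>A. of_int D * q \<in> (\<int> :: rat set)"
  using assms
proof (induction A rule: finite_induct)
  case empty
  show ?case by (intro exI[of _ 1]) simp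
next
  case (insert q A)
  then obtain D where D: "D > 0" "\<And>q. q \<in> A \<Longrightarrow> of_int D * q \<in> (\<int> :: rat set)" by blast
  obtain a b where ab: "quotient_of q = (a, b)" by fastforce
  have b: "b > 0" using quotient_of_denom_pos[OF ab] .
  have q: "q = of_int a / of_int b" by (rule quotient_of_div[OF ab])
  have "of_int (b * D) * q = of_int (D * a)" using b by (simp add: q)
  then have "of_int (b * D) * q \<in> \<int>" by (metis Ints_of_int)
  moreover have "of_int (b * D) * r \<in> \<int>" if "r \<in> A" for r
    using Ints_mult[OF Ints_of_int[of b] D(2)[OF that]] by (simp add: mult.assoc)
  ultimately show ?case using b D by (intro exI[of _ "b * D"]) auto
qed

text \<open>The functions are treated as vectors over the rationals, and a functional nonzero on the
  nonzero ones replaces a choice of positive roots. Clearing denominators gives integer levels,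
  along which one can induct.\<close>

lemma integral_level:
  fixes \<Phi> :: "('v \<Rightarrow> 'k::field_char_0) set"
  assumes fin: "finite \<Phi>"
  shows "\<exists>lv :: ('v \<Rightarrow> 'k) \<Rightarrow> int. (\<forall>\<alpha>\<in>\<Phi>. \<forall>\<beta>\<in>\<Phi>. lv (\<alpha> + \<beta>) = lv \<alpha> + lv \<beta>) \<and>
    (\<forall>\<alpha>\<in>\<Phi>. lv (- \<alpha>) = - lv \<alpha>) \<and> lv 0 = 0 \<and> (\<forall>\<alpha>\<in>\<Phi>. lv \<alpha> = 0 \<longrightarrow> \<alpha> = 0)"
proof -
  let ?rs = "\<lambda>(q::rat) (\<alpha>::'v \<Rightarrow> 'k) x. of_rat q * \<alpha> x"
  have "vector_space ?rs"
    by unfold_locales (auto simp: fun_eq_iff algebra_simps of_rat_add of_rat_mult)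
  from rational_functional[OF this fin] obtain f where
    f: "Vector_Spaces.linear ?rs (*) f" "\<And>\<alpha>. \<alpha> \<in> \<Phi> \<Longrightarrow> \<alpha> \<noteq> 0 \<Longrightarrow> f \<alpha> \<noteq> 0" by blast
  have fadd: "f (\<alpha> + \<beta>) = f \<alpha> + f \<beta>" for \<alpha> \<beta> using f(1) by (simp add: Vector_Spaces.linear_iff)
  have f0: "f 0 = 0" using fadd[of 0 0] by simp
  have fneg: "f (- \<alpha>) = - f \<alpha>" for \<alpha> using fadd[of \<alpha> "- \<alpha>"] f0 by (simp add: eq_neg_iff_add_eq_0 add.commute)
  obtain D where D: "D > 0" "\<And>\<alpha>. \<alpha> \<in> \<Phi> \<Longrightarrow> of_int D * f \<alpha> \<in> \<int>"
    using common_denominator[of "f ` \<Phi>"] fin by auto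
  \<comment> \<open>The floor is exact on \<open>\<Phi>\<close>, and thereby also on sums and
    negatives of its elements.\<close>
  define lv where "lv \<alpha> = \<lfloor>of_int D * f \<alpha>\<rfloor>" for \<alpha>
  have lv: "of_int (lv \<alpha>) = of_int D * f \<alpha>" if "\<alpha> \<in> \<Phi>" for \<alpha>
    using D(2)[OF that] by (simp add: lv_def)
  have "lv (\<alpha> + \<beta>) = lv \<alpha> + lv \<beta>" if "\<alpha> \<in> \<Phi>" "\<beta> \<in> \<Phi>" for \<alpha> \<beta>
  proof -
    have "of_int D * f (\<alpha> + \<beta>) = of_int (lv \<alpha> + lv \<beta>)" by (simp add: lv that fadd distrib_left)
    then show ?thesis by (simp only: lv_def[of "\<alpha> + \<beta>"] floor_of_int)
  qed
  moreover have "lv (- \<alpha>) = - lv \<alpha>" if "\<alpha> \<in> \<Phi>" for \<alpha>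
  proof -
    have "of_int D * f (- \<alpha>) = of_int (- lv \<alpha>)" by (simp add: lv that fneg)
    then show ?thesis by (simp only: lv_def[of "- \<alpha>"] floor_of_int)
  qed
  moreover have "lv 0 = 0" by (simp add: lv_def f0)
  moreover have "\<alpha> = 0" if "\<alpha> \<in> \<Phi>" "lv \<alpha> = 0" for \<alpha>
    using lv[OF that(1)] that f(2)[OF that(1)] D(1) by auto
  ultimately show ?thesis by blast
qed

context fixed_lie
begin

text \<open>The automorphisms with which an isomorphism may be composed without changing its
  relation to \<open>\<sigma>\<close>; they preserve \<open>G\<close> and permute its Cartan
  subalgebras.\<close>

definition equivariant_aut :: "('a \<Rightarrow> 'a) \<Rightarrow> bool" where
  "equivariant_aut g \<longleftrightarrow> lin g \<and> bij g \<and> (\<forall>x y. g (bracket x y) = bracket (g x) (g y)) \<and> (\<forall>j v. g (\<sigma> j v) = \<sigma> j (g v))"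

lemma equivariant_autD:
  assumes "equivariant_aut g"
  shows equivariant_aut_lin: "lin g" and equivariant_aut_bij: "bij g" and equivariant_aut_bracket: "g (bracket x y) = bracket (g x) (g y)"
    and equivariant_aut_\<sigma>: "g (\<sigma> j v) = \<sigma> j (g v)"
  using assms by (auto simp: equivariant_aut_def)

lemma equivariant_aut_id: "equivariant_aut (\<lambda>x. x)"
  by (auto simp: equivariant_aut_def intro: linI bij_id[unfolded id_def])

lemma equivariant_aut_compose: "equivariant_aut f \<Longrightarrow> equivariant_aut g \<Longrightarrow> equivariant_aut (\<lambda>x. f (g x))"
  using bij_comp[of g f] unfolding equivariant_aut_def by (auto simp: comp_def intro: lin_compose)

lemma equivariant_aut_inv:
  assumes g: "equivariant_aut g"
  shows "equivariant_aut (inv_into UNIV g)"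
proof -
  note b = equivariant_aut_bij[OF g]
  have r: "g (inv_into UNIV g x) = x" for x using b by (simp add: bij_is_surj surj_f_inv_f)
  have i: "g x = g y \<Longrightarrow> x = y" for x y using b by (meson bij_is_inj injD)
  show ?thesis unfolding equivariant_aut_def
    by (intro conjI allI linI bij_imp_bij_inv b; rule i)
      (simp_all add: r lin_add[OF equivariant_aut_lin[OF g]] lin_scale[OF equivariant_aut_lin[OF g]] equivariant_autD(3,4)[OF g])
qed

lemma equivariant_aut_G: "equivariant_aut g \<Longrightarrow> x \<in> G \<longleftrightarrow> g x \<in> G"
  unfolding fixed_points_def by (auto simp: equivariant_aut_\<sigma>[symmetric]) (metis bij_is_inj equivariant_aut_bij injD equivariant_aut_\<sigma>)

lemma equivariant_aut_cartan:
  assumes g: "equivariant_aut g" and C: "cartan_subalgebra G H"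
  shows "cartan_subalgebra G (g ` H)"
proof -
  have i: "g x \<in> g ` S \<longleftrightarrow> x \<in> S" for x S using equivariant_aut_bij[OF g] by (auto simp: bij_is_inj inj_image_mem_iff)
  have lc: "lower_central (g ` H) n = g ` lower_central H n" for n
  proof (induction n)
    case (Suc n)
    have "{bracket x y | x y. x \<in> g ` H \<and> y \<in> g ` lower_central H n} = g ` {bracket x y | x y. x \<in> H \<and> y \<in> lower_central H n}"
      using equivariant_aut_bracket[OF g] by (auto simp: image_iff) metis+
    then show ?case
      using Suc module_hom.span_image[OF Vector_Spaces.linear.axioms(3)[OF equivariant_aut_lin[OF g]]] by simp
  qed simp
  obtain N where N: "lower_central H N = {0}" using C by (auto simp: cartan_subalgebra_def nilpotent_lie_def)
  have norm: "{x \<in> G. \<forall>y\<in>g ` H. bracket x y \<in> g ` H} = g ` H"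
  proof (intro equalityI subsetI)
    fix x assume x: "x \<in> {x \<in> G. \<forall>y\<in>g ` H. bracket x y \<in> g ` H}"
    obtain w where w: "x = g w" using equivariant_aut_bij[OF g] by (metis bij_pointE)
    have "bracket w y \<in> H" if "y \<in> H" for y using x that i by (auto simp: w equivariant_aut_bracket[OF g, symmetric])
    moreover have "w \<in> G" using x w equivariant_aut_G[OF g] by auto
    ultimately show "x \<in> g ` H" using C w by (auto simp: cartan_subalgebra_def)
  next
    fix x assume "x \<in> g ` H"
    then show "x \<in> {x \<in> G. \<forall>y\<in>g ` H. bracket x y \<in> g ` H}"
      using C equivariant_aut_G[OF g] by (auto simp: equivariant_aut_bracket[OF g, symmetric] i cartan_subalgebra_def subalgebra_def)
  qed
  have "subspace (g ` H)" using C by (auto simp: cartan_subalgebra_def subalgebra_def intro: subspace_lin_image equivariant_aut_lin[OF g])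
  moreover have "nilpotent_lie (g ` H)"
    unfolding nilpotent_lie_def by (intro exI[of _ N]) (simp add: lc N lin_0[OF equivariant_aut_lin[OF g]])
  ultimately show ?thesis
    using C equivariant_aut_G[OF g] norm equivariant_aut_bracket[OF g]
    by (auto simp: cartan_subalgebra_def subalgebra_def simp flip: equivariant_aut_bracket[OF g])
qed

lemma equivariant_aut_shift: "equivariant_aut g \<Longrightarrow> (shift (bracket (g x)) c ^^ n) (g v) = g ((shift (bracket x) c ^^ n) v)"
  by (induction n) (simp_all add: shift_def equivariant_autD lin_diff[OF equivariant_aut_lin] lin_scale[OF equivariant_aut_lin])

lemma equivariant_aut_semisimple:
  assumes g: "equivariant_aut g" and s: "ss_part s s"
  shows "ss_part (g s) (g s)"
  unfolding ss_part_def
proof (intro allI impI)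
  fix c v assume v: "v \<in> gen_eigenspace (bracket (g s)) c"
  obtain w where w: "v = g w" using equivariant_aut_bij[OF g] by (metis bij_pointE)
  obtain n where "(shift (bracket (g s)) c ^^ n) v = 0" using v by (auto simp: gen_eigenspace_def)
  then have "g ((shift (bracket s) c ^^ n) w) = g 0" by (simp add: w equivariant_aut_shift[OF g] lin_0[OF equivariant_aut_lin[OF g]])
  then have "(shift (bracket s) c ^^ n) w = 0" using equivariant_aut_bij[OF g] by (meson bij_is_inj injD)
  then have "bracket s w = c \<cdot> w" using s gen_eigenspaceI by (auto simp: ss_part_def)
  then show "bracket (g s) v = c \<cdot> v"
    by (simp add: w equivariant_aut_bracket[OF g, symmetric] lin_scale[OF equivariant_aut_lin[OF g]])
qed

lemma expo_equivariant_aut: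
  assumes y: "y \<in> G" and nil: "\<And>v. (bracket y ^^ N) v = 0"
  shows "equivariant_aut (expo N y)"
proof -
  have "(bracket y ^^ n) (\<sigma> j v) = \<sigma> j ((bracket y ^^ n) v)" for n j v
    by (induction n) (use y in \<open>simp_all add: \<sigma>_bracket fixed_points_def\<close>)
  then have "expo N y (\<sigma> j v) = \<sigma> j (expo N y v)" for j v
    by (simp add: expo_def dpow_def lin_sum[OF lin_\<sigma>] lin_scale[OF lin_\<sigma>])
  then show ?thesis using lin_expo expo_bij[OF nil] expo_bracket[OF nil] by (auto simp: equivariant_aut_def)
qed

definition centralizer_G :: "'a set \<Rightarrow> 'a set" where
  "centralizer_G T = {x \<in> G. \<forall>t\<in>T. bracket t x = 0}"

section \<open>The level filtration and Borel subalgebras of a centralizer\<close>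

context
  fixes H T :: "'a set" and lv :: "('a \<Rightarrow> 'k) \<Rightarrow> int"
  assumes cartan: "cartan_subalgebra G H" and T: "T \<subseteq> H"
    and lv_add: "\<And>\<alpha> \<beta>. \<alpha> \<in> gen_weights H \<Longrightarrow> \<beta> \<in> gen_weights H \<Longrightarrow> lv (\<alpha> + \<beta>) = lv \<alpha> + lv \<beta>"
    and lv_neg: "\<And>\<alpha>. \<alpha> \<in> gen_weights H \<Longrightarrow> lv (- \<alpha>) = - lv \<alpha>"
    and lv_0: "lv 0 = 0" and lv_eq_0: "\<And>\<alpha>. \<alpha> \<in> gen_weights H \<Longrightarrow> lv \<alpha> = 0 \<Longrightarrow> \<alpha> = 0"
begin

abbreviation "cp \<alpha> x \<equiv> component (gen_weights H) (gen_weight H) \<alpha> x"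

text \<open>The sum of the weight spaces of level at least \<open>a\<close>, described by components
  so that membership can be tested weight by weight.\<close>

definition filtration :: "int \<Rightarrow> 'a set" where
  "filtration a = {x. \<forall>\<alpha>\<in>gen_weights H. cp \<alpha> x \<noteq> 0 \<longrightarrow> a \<le> lv \<alpha>}"

abbreviation M :: "'a set" where "M \<equiv> centralizer_G T"

lemmas weights_span = cartan_span_UNIV[OF cartan]
  and finite_weights = finite_gen_weights[of H]
  and cp_in = component_in[OF gen_weight_dir cartan_span_UNIV[OF cartan]]
  and cp_sum = sum_component[OF gen_weight_dir cartan_span_UNIV[OF cartan]]
  and cp_mem = component_of_mem[OF gen_weight_dir[of H]]

lemma lin_cp: "lin (\<lambda>x. cp \<alpha> x)"
  by (rule linI) (simp_all add: component_add[OF gen_weight_dir weights_span weights_span] component_scale[OF gen_weight_dir weights_span])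

lemma cp_invariant:
  assumes V: "subspace V" "\<And>h v. h \<in> H \<Longrightarrow> v \<in> V \<Longrightarrow> bracket h v \<in> V" and x: "x \<in> V"
  shows "cp \<alpha> x \<in> V"
proof -
  have "x \<in> span (\<Union>\<mu>\<in>gen_weights H. V \<inter> gen_weight H \<mu>)" using cartan_span[OF cartan _ _ V] x by blast
  from component_invariant[OF gen_weight_dir this V(1)] show ?thesis .
qed

lemma subspace_M: "subspace M"
  using subspace_G by (auto simp: centralizer_G_def subspace_def bracket_0_right bracket_add_right bracket_scale_right)

lemma M_bracket: "x \<in> M \<Longrightarrow> y \<in> M \<Longrightarrow> bracket x y \<in> M"
  by (auto simp: centralizer_G_def G_bracket jacobi_ad[of _ x y] bracket_0_left bracket_0_right)

lemma H_M: "H \<subseteq> M"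
  using cartan_subset[OF cartan] cartan_abelian[OF cartan] T by (auto simp: centralizer_G_def)

lemma cp_M: "x \<in> M \<Longrightarrow> cp \<alpha> x \<in> M"
  by (rule cp_invariant[OF subspace_M M_bracket]) (use H_M in auto)

lemma cp_G: "x \<in> G \<Longrightarrow> cp \<alpha> x \<in> G"
  by (rule cp_invariant[OF subspace_G G_bracket]) (use cartan_subset[OF cartan] in auto)

lemma subspace_filtration: "subspace (filtration a)"
proof (rule subspaceI)
  fix x y assume "x \<in> filtration a" "y \<in> filtration a"
  then show "x + y \<in> filtration a" by (force simp: filtration_def lin_add[OF lin_cp])
qed (auto simp: filtration_def lin_0[OF lin_cp] lin_scale[OF lin_cp])

lemma filtration_mono: "a \<le> b \<Longrightarrow> filtration b \<subseteq> filtration a"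
  by (auto simp: filtration_def)

lemma gen_weight_filtration:
  assumes v: "v \<in> gen_weight H \<alpha>" and a: "v \<noteq> 0 \<Longrightarrow> \<alpha> \<in> gen_weights H \<Longrightarrow> a \<le> lv \<alpha>" and \<alpha>: "\<And>z. z \<notin> H \<Longrightarrow> \<alpha> z = 0"
  shows "v \<in> filtration a"
proof (cases "v = 0")
  case True
  then show ?thesis using subspace_0[OF subspace_filtration] by simp
next
  case False
  then have X: "\<alpha> \<in> gen_weights H" using v \<alpha> by (auto simp: gen_weights_def)
  then show ?thesis using False a by (auto simp: filtration_def cp_mem[OF X v])
qed

lemma weight_outside: "\<alpha> \<in> gen_weights H \<Longrightarrow> z \<notin> H \<Longrightarrow> \<alpha> z = 0"
  by (auto simp: gen_weights_def)

lemma filtration_bracket: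
  assumes x: "x \<in> filtration a" and y: "y \<in> filtration b"
  shows "bracket x y \<in> filtration (a + b)"
proof -
  have "bracket (cp \<alpha> x) (cp \<beta> y) \<in> filtration (a + b)" if \<alpha>: "\<alpha> \<in> gen_weights H" and \<beta>: "\<beta> \<in> gen_weights H" for \<alpha> \<beta>
  proof (rule gen_weight_filtration)
    show "bracket (cp \<alpha> x) (cp \<beta> y) \<in> gen_weight H (\<alpha> + \<beta>)" by (intro gen_weight_bracket cp_in \<alpha> \<beta>)
    assume nz: "bracket (cp \<alpha> x) (cp \<beta> y) \<noteq> 0"
    then have "cp \<alpha> x \<noteq> 0" "cp \<beta> y \<noteq> 0" by (auto simp: bracket_0_left bracket_0_right)
    then show "a + b \<le> lv (\<alpha> + \<beta>)" using x y \<alpha> \<beta> by (auto simp: filtration_def lv_add intro: add_mono)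
  qed (simp add: weight_outside[OF \<alpha>] weight_outside[OF \<beta>])
  then have "(\<Sum>\<alpha>\<in>gen_weights H. \<Sum>\<beta>\<in>gen_weights H. bracket (cp \<alpha> x) (cp \<beta> y)) \<in> filtration (a + b)"
    by (intro subspace_sum[OF subspace_filtration])
  also have "(\<Sum>\<alpha>\<in>gen_weights H. \<Sum>\<beta>\<in>gen_weights H. bracket (cp \<alpha> x) (cp \<beta> y)) = bracket x y"
  proof -
    have "bracket (\<Sum>\<alpha>\<in>gen_weights H. cp \<alpha> x) (\<Sum>\<beta>\<in>gen_weights H. cp \<beta> y)
        = (\<Sum>\<alpha>\<in>gen_weights H. \<Sum>\<beta>\<in>gen_weights H. bracket (cp \<alpha> x) (cp \<beta> y))"
      unfolding bracket_sum_left by (intro sum.cong refl bracket_sum_right)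
    then show ?thesis by (simp only: cp_sum)
  qed
  finally show ?thesis .
qed

lemma filtration_bounds: obtains K :: nat where "filtration (int K) = {0}" "filtration (- int K) = UNIV"
proof -
  define K where "K = Suc (nat (Max (insert 0 ((\<lambda>\<alpha>. \<bar>lv \<alpha>\<bar>) ` gen_weights H))))"
  have K: "\<bar>lv \<alpha>\<bar> < int K" if "\<alpha> \<in> gen_weights H" for \<alpha>
  proof -
    have "\<bar>lv \<alpha>\<bar> \<le> Max (insert 0 ((\<lambda>\<alpha>. \<bar>lv \<alpha>\<bar>) ` gen_weights H))" using finite_weights that by (intro Max_ge) auto
    moreover have "0 \<le> Max (insert 0 ((\<lambda>\<alpha>. \<bar>lv \<alpha>\<bar>) ` gen_weights H))" using finite_weights by (intro Max_ge) auto
    ultimately show ?thesis by (simp add: K_def)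
  qed
  have "x = 0" if "x \<in> filtration (int K)" for x
  proof -
    have "cp \<alpha> x = 0" if "\<alpha> \<in> gen_weights H" for \<alpha> using \<open>x \<in> filtration (int K)\<close> K[OF that] that by (force simp: filtration_def)
    then show ?thesis using cp_sum[of x] by simp
  qed
  then have "filtration (int K) = {0}" using subspace_0[OF subspace_filtration] by auto
  moreover have "filtration (- int K) = UNIV" using K by (force simp: filtration_def)
  ultimately show ?thesis using that by blast
qed

lemma filtration_pow: "y \<in> filtration a \<Longrightarrow> v \<in> filtration b \<Longrightarrow> (bracket y ^^ n) v \<in> filtration (int n * a + b)"
proof (induction n)
  case (Suc n)
  then show ?case using filtration_bracket[of y a "(bracket y ^^ n) v" "int n * a + b"] by (simp add: algebra_simps)
qed simp

lemma filtration_nilpotent: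
  assumes y: "y \<in> filtration 1"
  obtains N where "N \<ge> 2" "\<And>v. (bracket y ^^ N) v = 0"
proof -
  obtain K :: nat where K: "filtration (int K) = {0}" "filtration (- int K) = UNIV" by (rule filtration_bounds)
  \<comment> \<open>\<open>2 * K\<close> steps lead from level \<open>- K\<close> to level
    \<open>K\<close>, where only 0 is left; the 2 extra steps ensure \<open>N \<ge> 2\<close>, so
    that the first two terms of the exponential can be split off.\<close>
  have "(bracket y ^^ (2 * K + 2)) v = 0" for v
  proof -
    have "(bracket y ^^ (2 * K + 2)) v \<in> filtration (int (2 * K + 2) * 1 + (- int K))" by (rule filtration_pow[OF y]) (simp add: K)
    also have "\<dots> \<subseteq> filtration (int K)" by (rule filtration_mono) simp
    finally show ?thesis using K by auto
  qed
  then show ?thesis using that[of "2 * K + 2"] by auto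
qed

lemma H_filtration: "H \<subseteq> filtration 0"
proof
  fix h assume "h \<in> H"
  then have "h \<in> gen_weight H 0" using cartan_in_gen_weight_0[OF cartan] by auto
  then show "h \<in> filtration 0" by (rule gen_weight_filtration) (simp_all add: lv_0)
qed

text \<open>A Newton step. In the level \<open>a\<close> part of \<open>n1\<close>, the weights
  nonzero at \<open>h\<close> give \<open>p = [h, y]\<close>; \<open>expo N y\<close> moves
  \<open>h\<close> to \<open>h - p\<close> up to higher levels and so cancels \<open>p\<close>. The
  weights vanishing at \<open>h\<close> give \<open>z\<close>, which commutes with \<open>h\<close>
  and is moved over to \<open>n0\<close>.\<close>

lemma expo_step:
  assumes h: "h \<in> H" and n0: "n0 \<in> M \<inter> filtration 1" "bracket h n0 = 0" and n1: "n1 \<in> M \<inter> filtration a" and a: "a \<ge> 1"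
  shows "\<exists>g n0' n1'. equivariant_aut g \<and> (\<forall>t\<in>T. g t = t) \<and> g (h + n0 + n1) = h + n0' + n1' \<and>
    n0' \<in> M \<inter> filtration 1 \<and> bracket h n0' = 0 \<and> n1' \<in> M \<inter> filtration (a + 1)"
proof -
  let ?X = "gen_weights H"
  define y where "y = (\<Sum>\<alpha>\<in>{\<alpha>\<in>?X. lv \<alpha> = a \<and> \<alpha> h \<noteq> 0}. (1 / \<alpha> h) \<cdot> cp \<alpha> n1)"
  define p where "p = (\<Sum>\<alpha>\<in>{\<alpha>\<in>?X. lv \<alpha> = a \<and> \<alpha> h \<noteq> 0}. cp \<alpha> n1)"
  define z where "z = (\<Sum>\<alpha>\<in>{\<alpha>\<in>?X. lv \<alpha> = a \<and> \<alpha> h = 0}. cp \<alpha> n1)"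
  have cpF: "cp \<alpha> n1 \<in> filtration b" if "\<alpha> \<in> ?X" "b \<le> lv \<alpha>" for \<alpha> b
    by (rule gen_weight_filtration[OF cp_in[OF that(1)]]) (use that weight_outside in auto)
  have yM: "y \<in> M" and zM: "z \<in> M" unfolding y_def z_def
    using n1 by (auto intro!: subspace_sum[OF subspace_M] subspace_scale[OF subspace_M] cp_M)
  have yF: "y \<in> filtration a" and zF: "z \<in> filtration a" unfolding y_def z_def
    by (auto intro!: subspace_sum[OF subspace_filtration] subspace_scale[OF subspace_filtration] cpF)
  have hcp: "bracket h (cp \<alpha> n1) = \<alpha> h \<cdot> cp \<alpha> n1" if "\<alpha> \<in> ?X" for \<alpha>
    by (rule gen_weight_eigen[OF cartan cp_in[OF that] h])
  have hy: "bracket h y = p" unfolding y_def p_def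
    by (simp add: bracket_sum_right bracket_scale_right) (intro sum.cong refl, simp add: hcp)
  have hz: "bracket h z = 0" unfolding z_def
    by (simp add: bracket_sum_right) (intro sum.neutral ballI, simp add: hcp)
  have r: "n1 - p - z \<in> filtration (a + 1)"
  proof -
    have "n1 = (\<Sum>\<alpha>\<in>{\<alpha>\<in>?X. lv \<alpha> = a} \<union> {\<alpha>\<in>?X. lv \<alpha> \<noteq> a}. cp \<alpha> n1)"
      by (subst cp_sum[of n1, symmetric]) (rule sum.cong, auto)
    also have "\<dots> = (\<Sum>\<alpha>\<in>{\<alpha>\<in>?X. lv \<alpha> = a}. cp \<alpha> n1) + (\<Sum>\<alpha>\<in>{\<alpha>\<in>?X. lv \<alpha> \<noteq> a}. cp \<alpha> n1)"
      using finite_weights by (intro sum.union_disjoint) auto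
    also have "(\<Sum>\<alpha>\<in>{\<alpha>\<in>?X. lv \<alpha> = a}. cp \<alpha> n1)
        = (\<Sum>\<alpha>\<in>{\<alpha>\<in>?X. lv \<alpha> = a \<and> \<alpha> h \<noteq> 0} \<union> {\<alpha>\<in>?X. lv \<alpha> = a \<and> \<alpha> h = 0}. cp \<alpha> n1)"
      by (rule sum.cong) auto
    also have "\<dots> = p + z" unfolding p_def z_def using finite_weights by (intro sum.union_disjoint) auto
    finally have e: "n1 - p - z = (\<Sum>\<alpha>\<in>{\<alpha>\<in>?X. lv \<alpha> \<noteq> a}. cp \<alpha> n1)" by (simp add: algebra_simps)
    show ?thesis unfolding e
    proof (intro subspace_sum[OF subspace_filtration])
      fix \<alpha> assume \<alpha>: "\<alpha> \<in> {\<alpha>\<in>?X. lv \<alpha> \<noteq> a}"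
      show "cp \<alpha> n1 \<in> filtration (a + 1)"
      proof (cases "cp \<alpha> n1 = 0")
        case False
        then have "a \<le> lv \<alpha>" using n1 \<alpha> by (auto simp: filtration_def)
        then show ?thesis using \<alpha> by (intro cpF) auto
      qed (simp add: subspace_0[OF subspace_filtration])
    qed
  qed
  have "y \<in> filtration 1" using yF filtration_mono[OF a] by blast
  then obtain N where N: "N \<ge> 2" "\<And>v. (bracket y ^^ N) v = 0" using filtration_nilpotent by blast
  let ?E = "expo N y"
  have yG: "y \<in> G" using yM by (simp add: centralizer_G_def)
  have E: "equivariant_aut ?E" by (rule expo_equivariant_aut[OF yG N(2)])
  have dF: "dpow y n v \<in> filtration (int n * a + b)" if "v \<in> filtration b" for n v b
    unfolding dpow_def by (intro subspace_scale[OF subspace_filtration] filtration_pow yF that)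
  have split: "?E v = v + bracket y v + (\<Sum>n\<in>{2..<N}. dpow y n v)" for v
  proof -
    have "{..<N} = {0, 1} \<union> {2..<N}" using N(1) by auto
    then have "?E v = (\<Sum>n\<in>{0, 1}. dpow y n v) + (\<Sum>n\<in>{2..<N}. dpow y n v)"
      unfolding expo_def by (simp only:) (rule sum.union_disjoint, auto)
    then show ?thesis by (simp add: dpow_def)
  qed
  have tail: "(\<Sum>n\<in>{2..<N}. dpow y n v) \<in> filtration (a + 1)" if "v \<in> filtration 0" for v
  proof (intro subspace_sum[OF subspace_filtration])
    fix n assume n: "n \<in> {2..<N}"
    \<comment> \<open>Terms of order at least 2 have level at least \<open>2 * a\<close>, which
      exceeds \<open>a\<close> because \<open>a \<ge> 1\<close>.\<close>
    have "2 * a \<le> int n * a" using n a by (intro mult_right_mono) auto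
    then have "a + 1 \<le> int n * a + 0" using a by linarith
    then show "dpow y n v \<in> filtration (a + 1)" using dF[OF that, of n] filtration_mono by blast
  qed
  have brF: "bracket y v \<in> filtration (a + 1)" if "v \<in> filtration 1" for v
    using filtration_bracket[OF yF that] .
  have F10: "v \<in> filtration 1 \<Longrightarrow> v \<in> filtration 0" for v using filtration_mono[of 0 1] by auto
  have n01: "n0 \<in> filtration 1" "n1 \<in> filtration 1" using n0 n1 filtration_mono[OF a] by auto
  have th: "(\<Sum>n\<in>{2..<N}. dpow y n h) \<in> filtration (a + 1)" "(\<Sum>n\<in>{2..<N}. dpow y n n0) \<in> filtration (a + 1)"
    "(\<Sum>n\<in>{2..<N}. dpow y n n1) \<in> filtration (a + 1)"
    by (rule tail subsetD[OF H_filtration h] F10[OF n01(1)] F10[OF n01(2)])+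
  have yh: "bracket y h = - p" using bracket_swap[of y h] hy by simp
  define n1' where "n1' = ?E (h + n0 + n1) - (h + (n0 + z))"
  let ?t = "\<lambda>v. \<Sum>n\<in>{2..<N}. dpow y n v"
  have "?E (h + n0 + n1) = (h - p + ?t h) + (n0 + bracket y n0 + ?t n0) + (n1 + bracket y n1 + ?t n1)"
    by (simp only: lin_add[OF lin_expo] split yh) (simp add: algebra_simps)
  then have "n1' = (n1 - p - z) + ?t h + (bracket y n0 + ?t n0) + (bracket y n1 + ?t n1)"
    by (simp add: n1'_def algebra_simps)
  also have "\<dots> \<in> filtration (a + 1)"
    by (rule subspace_add[OF subspace_filtration] r brF n01 th)+
  finally have F: "n1' \<in> filtration (a + 1)" .
  have powM: "(bracket y ^^ n) v \<in> M" if "v \<in> M" for n v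
    by (induction n) (use that M_bracket[OF yM] in auto)
  have EM: "?E v \<in> M" if "v \<in> M" for v
    unfolding expo_def dpow_def by (intro subspace_sum[OF subspace_M] subspace_scale[OF subspace_M] powM that)
  have hM: "h \<in> M" using h H_M by auto
  have "n1' \<in> M" unfolding n1'_def
    using n0(1) n1 zM hM by (intro subspace_diff[OF subspace_M] EM subspace_add[OF subspace_M]) auto
  moreover have "n0 + z \<in> M \<inter> filtration 1"
    using n0(1) zM zF filtration_mono[OF a] by (auto intro: subspace_add[OF subspace_M] subspace_add[OF subspace_filtration])
  moreover have "bracket h (n0 + z) = 0" by (simp add: bracket_add_right n0 hz)
  moreover have "?E t = t" if "t \<in> T" for t
  proof -
    have "bracket y t = 0" using yM that bracket_swap[of y t] by (auto simp: centralizer_G_def)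
    then have "(bracket y ^^ n) t = 0" if "n > 0" for n
      using that by (cases n) (simp_all add: funpow_swap1 lin_0[OF lin_funpow[OF lin_ad]] del: funpow.simps(2), simp add: funpow_Suc_right lin_0[OF lin_funpow[OF lin_ad]] del: funpow.simps(2))
    then show ?thesis using \<open>bracket y t = 0\<close> by (simp add: split dpow_def)
  qed
  moreover have "?E (h + n0 + n1) = h + (n0 + z) + n1'" by (simp add: n1'_def)
  ultimately show ?thesis using E F by blast
qed

text \<open>Repeated steps push \<open>n1\<close> beyond the top level and leave
  \<open>h + n0\<close> with \<open>n0\<close> ad-nilpotent and commuting with \<open>h\<close>.
  This is a Jordan decomposition of a semisimple element, so \<open>n0\<close> kills all weight
  vectors and is central, hence zero.\<close>

lemma conj_into_cartan:
  assumes h: "h \<in> H" and n: "n \<in> M \<inter> filtration 1" and ss: "ss_part (h + n) (h + n)"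
  shows "\<exists>g. equivariant_aut g \<and> (\<forall>t\<in>T. g t = t) \<and> g (h + n) = h"
proof -
  have ind: "\<exists>g n0 n1. equivariant_aut g \<and> (\<forall>t\<in>T. g t = t) \<and> g (h + n) = h + n0 + n1 \<and>
      n0 \<in> M \<inter> filtration 1 \<and> bracket h n0 = 0 \<and> n1 \<in> M \<inter> filtration (1 + int k)" for k
  proof (induction k)
    case 0
    show ?case
      by (intro exI[of _ "\<lambda>x. x"] exI[of _ 0] exI[of _ n])
        (use n equivariant_aut_id subspace_0[OF subspace_M] subspace_0[OF subspace_filtration] in \<open>auto simp: bracket_0_right\<close>)
  next
    case (Suc k)
    then obtain g n0 n1 where g: "equivariant_aut g" "\<forall>t\<in>T. g t = t" "g (h + n) = h + n0 + n1"
      "n0 \<in> M \<inter> filtration 1" "bracket h n0 = 0" "n1 \<in> M \<inter> filtration (1 + int k)" by blast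
    from expo_step[OF h g(4-6)] obtain g' n0' n1' where g': "equivariant_aut g'" "\<forall>t\<in>T. g' t = t"
      "g' (h + n0 + n1) = h + n0' + n1'" "n0' \<in> M \<inter> filtration 1" "bracket h n0' = 0" "n1' \<in> M \<inter> filtration (1 + int k + 1)"
      by auto
    show ?case
      by (intro exI[of _ "\<lambda>x. g' (g x)"] exI[of _ n0'] exI[of _ n1'])
        (use g g' equivariant_aut_compose in \<open>auto simp: algebra_simps\<close>)
  qed
  obtain K :: nat where K: "filtration (int K) = {0}" by (rule filtration_bounds)
  have "filtration (1 + int K) \<subseteq> {0}" using filtration_mono[of "int K" "1 + int K"] K by auto
  with ind[of K] obtain g n0 where g: "equivariant_aut g" "\<forall>t\<in>T. g t = t" "g (h + n) = h + n0"
    and n0: "n0 \<in> filtration 1" "bracket h n0 = 0" by fastforce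
  obtain N where N: "\<And>v. (bracket n0 ^^ N) v = 0" using filtration_nilpotent[OF n0(1)] by blast
  have ss': "ss_part (h + n0) (h + n0)" using equivariant_aut_semisimple[OF g(1) ss] g(3) by simp
  have "bracket n0 v = 0" if v: "v \<in> gen_weight H \<alpha>" for \<alpha> v
  proof -
    have hv: "bracket h v = \<alpha> h \<cdot> v" by (rule gen_weight_eigen[OF cartan v h])
    have "(shift (bracket (h + n0)) (\<alpha> h) ^^ i) v = (bracket n0 ^^ i) v \<and> bracket h ((bracket n0 ^^ i) v) = \<alpha> h \<cdot> (bracket n0 ^^ i) v" for i
    proof (induction i)
      case (Suc i)
      let ?w = "(bracket n0 ^^ i) v"
      have w: "bracket h ?w = \<alpha> h \<cdot> ?w" using Suc by simp
      have "bracket h (bracket n0 ?w) = \<alpha> h \<cdot> bracket n0 ?w"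
        using jacobi_ad[of h n0 ?w] by (simp add: n0 bracket_0_left w bracket_scale_right)
      then show ?case using Suc w by (simp add: shift_def bracket_add_left)
    qed (simp add: hv)
    from this[of N] have "v \<in> gen_eigenspace (bracket (h + n0)) (\<alpha> h)" using N by (intro gen_eigenspaceI[where n=N]) auto
    then have "bracket (h + n0) v = \<alpha> h \<cdot> v" using ss' unfolding ss_part_def by blast
    then show ?thesis using hv by (simp add: bracket_add_left)
  qed
  then have "(\<Union>\<mu>\<in>gen_weights H. gen_weight H \<mu>) \<subseteq> {v. bracket n0 v \<in> {0}}" by auto
  then have "span (\<Union>\<mu>\<in>gen_weights H. gen_weight H \<mu>) \<subseteq> {v. bracket n0 v \<in> {0}}"
    by (rule span_minimal) (intro subspace_lin_vimage lin_ad subspace_single_0)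
  then have z: "bracket n0 v = 0" for v using weights_span by blast
  have "n0 = 0" by (rule simple_center[OF simple UNIV_I]) (rule z)
  then show ?thesis using g by auto
qed

text \<open>Modulo higher levels \<open>h + n\<close> acts on a vector of weight
  \<open>\<beta>\<close> by the scalar \<open>\<beta> h\<close>. Nilpotency makes these scalars
  vanish, so \<open>h\<close> is central.\<close>

lemma nilpotent_cartan_part:
  assumes h: "h \<in> H" and n: "n \<in> filtration 1" and nil: "\<And>v. v \<in> gen_eigenspace (bracket (h + n)) 0"
  shows "h = 0"
proof -
  have "bracket h v = 0" if \<beta>: "\<beta> \<in> gen_weights H" and v: "v \<in> gen_weight H \<beta>" for \<beta> v
  proof (cases "v = 0")
    case False
    let ?D = "bracket (h + n)"
    have hF: "h + n \<in> filtration 0" using h n H_filtration filtration_mono[of 0 1] by (intro subspace_add[OF subspace_filtration]) auto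
    have vF: "v \<in> filtration (lv \<beta>)" by (rule gen_weight_filtration[OF v]) (use weight_outside[OF \<beta>] in auto)
    have pw: "(?D ^^ k) v - (\<beta> h) ^ k \<cdot> v \<in> filtration (lv \<beta> + 1)" for k
    proof (induction k)
      case 0
      show ?case by (simp add: subspace_0[OF subspace_filtration])
    next
      case (Suc k)
      let ?u = "(?D ^^ k) v - (\<beta> h) ^ k \<cdot> v"
      have "?D ?u \<in> filtration (0 + (lv \<beta> + 1))" by (rule filtration_bracket[OF hF Suc])
      moreover have "(\<beta> h) ^ k \<cdot> bracket n v \<in> filtration (lv \<beta> + 1)"
        using filtration_bracket[OF n vF] by (intro subspace_scale[OF subspace_filtration]) (simp add: add.commute)
      moreover have "(?D ^^ Suc k) v - (\<beta> h) ^ Suc k \<cdot> v = ?D ?u + (\<beta> h) ^ k \<cdot> bracket n v"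
        by (simp add: bracket_diff_right bracket_scale_right bracket_add_left gen_weight_eigen[OF cartan v h] algebra_simps)
      ultimately show ?case using subspace_add[OF subspace_filtration] by simp
    qed
    obtain k where "(shift ?D 0 ^^ k) v = 0" using nil[of v] by (auto simp: gen_eigenspace_def)
    moreover have "shift ?D 0 = ?D" by (auto simp: shift_def)
    ultimately have "- ((\<beta> h) ^ k \<cdot> v) \<in> filtration (lv \<beta> + 1)" using pw[of k] by simp
    then have "(\<beta> h) ^ k \<cdot> v \<in> filtration (lv \<beta> + 1)" using subspace_neg[OF subspace_filtration] by fastforce
    moreover have "cp \<beta> ((\<beta> h) ^ k \<cdot> v) = (\<beta> h) ^ k \<cdot> v"
      using cp_mem[OF \<beta> subspace_scale[OF subspace_gen_weight v]] by simp
    ultimately have "(\<beta> h) ^ k \<cdot> v = 0" using \<beta> by (force simp: filtration_def)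
    then have "\<beta> h = 0" using False by simp
    then show ?thesis using gen_weight_eigen[OF cartan v h] by simp
  qed (simp add: bracket_0_right)
  then have "(\<Union>\<mu>\<in>gen_weights H. gen_weight H \<mu>) \<subseteq> {v. bracket h v \<in> {0}}" by auto
  then have "span (\<Union>\<mu>\<in>gen_weights H. gen_weight H \<mu>) \<subseteq> {v. bracket h v \<in> {0}}"
    by (rule span_minimal) (intro subspace_lin_vimage lin_ad subspace_single_0)
  then have z: "bracket h v = 0" for v using weights_span by blast
  show ?thesis by (rule simple_center[OF simple UNIV_I]) (rule z)
qed

lemma kappa_components:
  assumes "\<And>\<alpha> \<beta>. \<alpha> \<in> gen_weights H \<Longrightarrow> \<beta> \<in> gen_weights H \<Longrightarrow> \<alpha> + \<beta> = 0 \<Longrightarrow> cp \<alpha> x \<noteq> 0 \<Longrightarrow> cp \<beta> y \<noteq> 0 \<Longrightarrow> False"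
  shows "kappa x y = 0"
proof -
  have "kappa (cp \<alpha> x) (cp \<beta> y) = 0" if ab: "\<alpha> \<in> gen_weights H" "\<beta> \<in> gen_weights H" for \<alpha> \<beta>
  proof (cases "\<alpha> + \<beta> = 0")
    case True
    then have "cp \<alpha> x = 0 \<or> cp \<beta> y = 0" using assms[OF ab] by blast
    then show ?thesis by (auto simp: kappa_0_left kappa_0_right)
  next
    case False
    then show ?thesis
      by (intro kappa_gen_weight_orth[OF cartan cp_in[OF ab(1)] cp_in[OF ab(2)]])
        (simp_all add: weight_outside[OF ab(1)] weight_outside[OF ab(2)])
  qed
  then have "(\<Sum>\<alpha>\<in>gen_weights H. \<Sum>\<beta>\<in>gen_weights H. kappa (cp \<alpha> x) (cp \<beta> y)) = 0" by (simp add: sum.neutral)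
  also have "(\<Sum>\<alpha>\<in>gen_weights H. \<Sum>\<beta>\<in>gen_weights H. kappa (cp \<alpha> x) (cp \<beta> y))
      = kappa (\<Sum>\<alpha>\<in>gen_weights H. cp \<alpha> x) (\<Sum>\<beta>\<in>gen_weights H. cp \<beta> y)"
    unfolding kappa_sum_left by (intro sum.cong refl kappa_sum_right[symmetric])
  finally show ?thesis by (simp only: cp_sum)
qed

lemma kappa_opposite:
  assumes \<alpha>: "\<alpha> \<in> gen_weights H" and x: "x \<in> gen_weight H \<alpha>"
  shows "kappa x y = kappa x (cp (- \<alpha>) y)"
proof -
  have "kappa x (y - cp (- \<alpha>) y) = 0"
  proof (rule kappa_components)
    fix \<gamma> \<beta> assume g: "\<gamma> \<in> gen_weights H" "\<beta> \<in> gen_weights H" "\<gamma> + \<beta> = 0" "cp \<gamma> x \<noteq> 0" "cp \<beta> (y - cp (- \<alpha>) y) \<noteq> 0"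
    have "\<gamma> = \<alpha>" using g(4) by (auto simp: cp_mem[OF \<alpha> x] split: if_splits)
    then have \<beta>: "\<beta> = - \<alpha>" using g(3) by (simp add: add_eq_0_iff)
    have "cp \<beta> (cp (- \<alpha>) y) = cp \<beta> y"
      using cp_mem[OF g(2) cp_in[OF g(2)], of \<beta> y] \<beta> by simp
    then show False using g(5) by (simp add: lin_diff[OF lin_cp])
  qed
  then show ?thesis using kappa_add_right[of x "y - cp (- \<alpha>) y" "cp (- \<alpha>) y"] by simp
qed

lemma M_weight_zero_on_T:
  assumes "x \<in> M" "\<alpha> \<in> gen_weights H" "cp \<alpha> x \<noteq> 0" "t \<in> T"
  shows "\<alpha> t = 0"
  using gen_weight_eigen[OF cartan cp_in[OF assms(2), of x], of t] cp_M[OF assms(1), of \<alpha>] assms T by (auto simp: centralizer_G_def)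

lemma cp_in_M:
  assumes y: "y \<in> G" and \<alpha>: "\<alpha> \<in> gen_weights H" and t: "\<And>t. t \<in> T \<Longrightarrow> \<alpha> t = 0"
  shows "cp \<alpha> y \<in> M"
  using cp_G[OF y] gen_weight_eigen[OF cartan cp_in[OF \<alpha>, of y]] t T by (auto simp: centralizer_G_def)

text \<open>Collects what the conjugacy argument uses about a Borel subalgebra \<open>B\<close> of
  the centralizer \<open>M\<close> of \<open>T\<close> and the ideal \<open>N\<close> of its
  ad-nilpotent elements; afterwards the level function can be forgotten.\<close>

lemma borel_facts:
  defines "B \<equiv> M \<inter> filtration 0" and "N \<equiv> M \<inter> filtration 1"
  shows "subspace B" "subspace N" "N \<subseteq> B" "H \<subseteq> B" "dim B = dim H + dim N"
    "N = {x \<in> M. \<forall>y\<in>B. kappa x y = 0}"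
    "\<And>x. x \<in> B \<Longrightarrow> (\<And>v. v \<in> gen_eigenspace (bracket x) 0) \<Longrightarrow> x \<in> N"
    "\<And>s. s \<in> B \<Longrightarrow> ss_part s s \<Longrightarrow> \<exists>g. equivariant_aut g \<and> (\<forall>t\<in>T. g t = t) \<and> g s \<in> H"
    "\<And>u. u \<in> M \<Longrightarrow> (\<And>b. b \<in> B \<Longrightarrow> bracket u b \<in> B) \<Longrightarrow> u \<in> B"
    "\<And>x b. x \<in> B \<Longrightarrow> b \<in> B \<Longrightarrow> bracket x b \<in> B"
    "nondeg_on M"
proof -
  show B: "subspace B" and N: "subspace N"
    by (auto simp: B_def N_def intro: subspace_inter subspace_M subspace_filtration)
  show NB: "N \<subseteq> B" using filtration_mono[of 0 1] by (auto simp: B_def N_def)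
  show HB: "H \<subseteq> B" using H_M H_filtration by (auto simp: B_def)
  \<comment> \<open>Level 0 means weight 0, since the level function vanishes at no other weight,
    and the weight 0 part of \<open>G\<close> is \<open>H\<close>.\<close>
  have decomp: "cp 0 x \<in> H \<and> x - cp 0 x \<in> N" if x: "x \<in> B" for x
  proof
    have xM: "x \<in> M" using x by (simp add: B_def)
    show c: "cp 0 x \<in> H"
    proof (cases "0 \<in> gen_weights H")
      case True
      then show ?thesis using cp_in[OF True, of x] cp_G[of x 0] xM G_gen_weight_0[OF cartan] by (auto simp: centralizer_G_def)
    next
      case False
      then show ?thesis using component_outside[OF gen_weight_dir weights_span False] subspace_0[OF subspace_cartan[OF cartan]] by simp
    qed
    have "x - cp 0 x \<in> filtration 1"
      unfolding filtration_def
    proof (clarsimp simp: lin_diff[OF lin_cp])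
      fix \<alpha> assume \<alpha>: "\<alpha> \<in> gen_weights H" "cp \<alpha> x \<noteq> cp \<alpha> (cp 0 x)"
      have "cp 0 x \<in> gen_weight H 0" using c cartan_in_gen_weight_0[OF cartan] by auto
      have a0: "\<alpha> \<noteq> 0"
      proof
        assume "\<alpha> = 0"
        then show False using \<alpha> cp_mem[OF \<alpha>(1), of "cp 0 x" \<alpha>] \<open>cp 0 x \<in> gen_weight H 0\<close> by simp
      qed
      have "cp \<alpha> (cp 0 x) = 0"
      proof (cases "0 \<in> gen_weights H")
        case True
        then show ?thesis using cp_mem[OF True \<open>cp 0 x \<in> gen_weight H 0\<close>, of \<alpha>] a0 by simp
      next
        case False
        then show ?thesis using component_outside[OF gen_weight_dir weights_span False] lin_0[OF lin_cp] by simp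
      qed
      then have "lv \<alpha> \<ge> 0" using \<alpha> x by (auto simp: B_def filtration_def)
      moreover have "lv \<alpha> \<noteq> 0" using lv_eq_0[OF \<alpha>(1)] a0 by blast
      ultimately show "1 \<le> lv \<alpha>" by simp
    qed
    moreover have "x - cp 0 x \<in> M" using xM c H_M by (auto intro: subspace_diff[OF subspace_M])
    ultimately show "x - cp 0 x \<in> N" by (simp add: N_def)
  qed
  have HN: "H \<inter> N \<subseteq> {0}"
  proof
    fix x assume x: "x \<in> H \<inter> N"
    have x0: "x \<in> gen_weight H 0" using x cartan_in_gen_weight_0[OF cartan] by auto
    show "x \<in> {0}"
    proof (rule ccontr)
      assume nz: "x \<notin> {0}"
      then have X: "0 \<in> gen_weights H" using x0 by (auto simp: gen_weights_def)
      then have "cp 0 x \<noteq> 0" using cp_mem[OF X x0, of 0] nz by simp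
      then show False using x X lv_0 by (auto simp: N_def filtration_def)
    qed
  qed
  have sumB: "{x + y |x y. x \<in> H \<and> y \<in> N} = B"
  proof (intro equalityI subsetI)
    fix b assume "b \<in> B"
    from decomp[OF this] show "b \<in> {x + y |x y. x \<in> H \<and> y \<in> N}"
      by (intro CollectI exI[of _ "cp 0 b"] exI[of _ "b - cp 0 b"]) simp
  qed (use HB NB subspace_add[OF B] in blast)
  have "dim (H \<inter> N) = 0" using HN by (simp only: dim_eq_0)
  then show "dim B = dim H + dim N"
    using dim_sums_Int[OF subspace_cartan[OF cartan] N] unfolding sumB by linarith
  \<comment> \<open>\<open>M\<close> is spanned by the weight vectors of \<open>G\<close> whose
    weights vanish on \<open>T\<close>. Opposite weights vanish on \<open>T\<close> together, so the
    remaining weight spaces are orthogonal to \<open>M\<close>.\<close>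
  show nd: "nondeg_on M" unfolding nondeg_on_def
  proof (intro ballI impI)
    fix x assume x: "x \<in> M" and k: "\<forall>y\<in>M. kappa x y = 0"
    have "kappa x y = 0" if y: "y \<in> G" for y
    proof -
      have "kappa x (cp \<beta> y) = 0" if \<beta>: "\<beta> \<in> gen_weights H" for \<beta>
      proof (cases "\<forall>t\<in>T. \<beta> t = 0")
        case True
        then show ?thesis using k cp_in_M[OF y \<beta>] by auto
      next
        case False
        show ?thesis
        proof (rule kappa_components)
          fix \<alpha> \<gamma> assume g: "\<alpha> \<in> gen_weights H" "\<gamma> \<in> gen_weights H" "\<alpha> + \<gamma> = 0" "cp \<alpha> x \<noteq> 0" "cp \<gamma> (cp \<beta> y) \<noteq> 0"
          have "\<gamma> = \<beta>" using g(5) by (auto simp: cp_mem[OF \<beta> cp_in[OF \<beta>]] split: if_splits)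
          then have "\<beta> = - \<alpha>" using g(3) by (simp add: add_eq_0_iff)
          then show False using False M_weight_zero_on_T[OF x g(1,4)] by auto
        qed
      qed
      then have "kappa x (\<Sum>\<beta>\<in>gen_weights H. cp \<beta> y) = 0" by (simp only: kappa_sum_right) (simp add: sum.neutral)
      then show ?thesis by (simp only: cp_sum)
    qed
    then show "x = 0" using x nondeg_G[OF cartan] by (auto simp: nondeg_on_def centralizer_G_def)
  qed
  show "N = {x \<in> M. \<forall>y\<in>B. kappa x y = 0}"
  proof (intro equalityI subsetI CollectI conjI ballI)
    fix x y assume x: "x \<in> N" and y: "y \<in> B"
    show "kappa x y = 0"
    proof (rule kappa_components)
      fix \<alpha> \<beta> assume g: "\<alpha> \<in> gen_weights H" "\<beta> \<in> gen_weights H" "\<alpha> + \<beta> = 0" "cp \<alpha> x \<noteq> 0" "cp \<beta> y \<noteq> 0"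
      have "lv \<alpha> \<ge> 1" "lv \<beta> \<ge> 0" using x y g by (auto simp: N_def B_def filtration_def)
      moreover have "lv \<alpha> + lv \<beta> = 0" using lv_add[OF g(1,2)] g(3) lv_0 by simp
      ultimately show False by simp
    qed
  next
    fix x assume x: "x \<in> {x \<in> M. \<forall>y\<in>B. kappa x y = 0}"
    then have xM: "x \<in> M" by simp
    \<comment> \<open>For \<open>\<alpha>\<close> of level at most 0, vectors of weight
      \<open>- \<alpha>\<close> in \<open>M\<close> lie in \<open>B\<close>. Hence the component of
      \<open>x\<close> at \<open>\<alpha>\<close> is orthogonal to all of \<open>G\<close>.\<close>
    have "cp \<alpha> x = 0" if \<alpha>: "\<alpha> \<in> gen_weights H" and l: "lv \<alpha> < 1" for \<alpha>
    proof (rule ccontr)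
      assume nz: "cp \<alpha> x \<noteq> 0"
      have "kappa (cp \<alpha> x) y = 0" if y: "y \<in> G" for y
      proof (cases "- \<alpha> \<in> gen_weights H")
        case True
        let ?y = "cp (- \<alpha>) y"
        have yM: "?y \<in> M" by (rule cp_in_M[OF y True]) (use M_weight_zero_on_T[OF xM \<alpha> nz] in simp)
        have yg: "?y \<in> gen_weight H (- \<alpha>)" by (rule cp_in[OF True])
        have "?y \<in> filtration 0" by (rule gen_weight_filtration[OF yg]) (use lv_neg[OF \<alpha>] l weight_outside[OF \<alpha>] in auto)
        then have "kappa x ?y = 0" using x yM by (auto simp: B_def)
        moreover have "kappa ?y x = kappa ?y (cp (- (- \<alpha>)) x)" by (rule kappa_opposite[OF True yg])
        ultimately have "kappa (cp \<alpha> x) ?y = 0" by (simp add: kappa_commute)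
        then show ?thesis using kappa_opposite[OF \<alpha> cp_in[OF \<alpha>], of x y] by simp
      next
        case False
        then show ?thesis
          using kappa_opposite[OF \<alpha> cp_in[OF \<alpha>], of x y] component_outside[OF gen_weight_dir weights_span False] by (simp add: kappa_0_right)
      qed
      then show False using nz cp_M[OF xM, of \<alpha>] nondeg_G[OF cartan] by (auto simp: nondeg_on_def centralizer_G_def)
    qed
    then have "x \<in> filtration 1" by (force simp: filtration_def)
    then show "x \<in> N" using xM by (simp add: N_def)
  qed (simp add: N_def)
  show "x \<in> N" if x: "x \<in> B" and nil: "\<And>v. v \<in> gen_eigenspace (bracket x) 0" for x
  proof -
    have "cp 0 x = 0"
      by (rule nilpotent_cartan_part[of _ "x - cp 0 x"]) (use decomp[OF x] nil in \<open>auto simp: N_def\<close>)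
    then show ?thesis using decomp[OF x] by simp
  qed
  show "\<exists>g. equivariant_aut g \<and> (\<forall>t\<in>T. g t = t) \<and> g s \<in> H" if s: "s \<in> B" and ss: "ss_part s s" for s
    using conj_into_cartan[of "cp 0 s" "s - cp 0 s"] decomp[OF s] ss by (auto simp: N_def)
  show "bracket x b \<in> B" if "x \<in> B" "b \<in> B" for x b
    using that M_bracket filtration_bracket[of x 0 b 0] by (auto simp: B_def)
  show "u \<in> B" if u: "u \<in> M" and b: "\<And>b. b \<in> B \<Longrightarrow> bracket u b \<in> B" for u
  proof -
    \<comment> \<open>Bracketing with an \<open>h\<close> at which \<open>\<alpha>\<close> is
      nonzero keeps the component at \<open>\<alpha>\<close> up to a nonzero factor, so the level of
      \<open>\<alpha>\<close> is bounded by that of an element of \<open>B\<close>.\<close>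
    have "0 \<le> lv \<alpha>" if \<alpha>: "\<alpha> \<in> gen_weights H" and nz: "cp \<alpha> u \<noteq> 0" for \<alpha>
    proof (cases "\<alpha> = 0")
      case False
      then obtain h where "\<alpha> h \<noteq> 0" by (auto simp: fun_eq_iff)
      then have h: "h \<in> H" "\<alpha> h \<noteq> 0" using weight_outside[OF \<alpha>] by auto
      have "bracket u h \<in> filtration 0" using b h HB by (auto simp: B_def)
      then have F: "bracket h u \<in> filtration 0" using subspace_neg[OF subspace_filtration] bracket_swap[of h u] by metis
      have "bracket h u = (\<Sum>\<beta>\<in>gen_weights H. \<beta> h \<cdot> cp \<beta> u)"
      proof -
        have "bracket h u = bracket h (\<Sum>\<beta>\<in>gen_weights H. cp \<beta> u)" by (simp only: cp_sum)
        also have "\<dots> = (\<Sum>\<beta>\<in>gen_weights H. \<beta> h \<cdot> cp \<beta> u)"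
          unfolding bracket_sum_right by (intro sum.cong refl gen_weight_eigen[OF cartan cp_in h(1)])
        finally show ?thesis .
      qed
      then have "cp \<alpha> (bracket h u) = \<alpha> h \<cdot> cp \<alpha> u"
        by (intro component_eq[OF gen_weight_dir weights_span _ _ \<alpha>]) (auto intro: subspace_scale[OF subspace_gen_weight] cp_in)
      then show ?thesis using F \<alpha> nz h by (auto simp: filtration_def)
    qed (simp add: lv_0)
    then show ?thesis using u by (auto simp: B_def filtration_def)
  qed
qed

end

end

section \<open>Conjugacy of Cartan subalgebras\<close>

context fixed_lie
begin

text \<open>The two Cartan subalgebras to be conjugated come with unrelated level functions; this
  interface hides them.\<close>

definition borel_pair :: "'a set \<Rightarrow> 'a set \<Rightarrow> 'a set \<Rightarrow> 'a set \<Rightarrow> bool" where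
  "borel_pair T H B N \<longleftrightarrow> subspace B \<and> subspace N \<and> B \<subseteq> centralizer_G T \<and> N \<subseteq> B \<and> H \<subseteq> B \<and> dim B = dim H + dim N \<and>
    N = {x \<in> centralizer_G T. \<forall>y\<in>B. kappa x y = 0} \<and>
    (\<forall>x\<in>B. (\<forall>v. v \<in> gen_eigenspace (bracket x) 0) \<longrightarrow> x \<in> N) \<and>
    (\<forall>s\<in>B. ss_part s s \<longrightarrow> (\<exists>g. equivariant_aut g \<and> (\<forall>t\<in>T. g t = t) \<and> g s \<in> H)) \<and>
    (\<forall>u\<in>centralizer_G T. (\<forall>b\<in>B. bracket u b \<in> B) \<longrightarrow> u \<in> B) \<and>
    (\<forall>x\<in>B. \<forall>b\<in>B. bracket x b \<in> B) \<and> nondeg_on (centralizer_G T)"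

lemma borel_pairD:
  assumes "borel_pair T H B N"
  shows "subspace B" "subspace N" "B \<subseteq> centralizer_G T" "N \<subseteq> B" "H \<subseteq> B" "dim B = dim H + dim N"
    "N = {x \<in> centralizer_G T. \<forall>y\<in>B. kappa x y = 0}"
    "\<forall>x\<in>B. (\<forall>v. v \<in> gen_eigenspace (bracket x) 0) \<longrightarrow> x \<in> N"
    "\<forall>s\<in>B. ss_part s s \<longrightarrow> (\<exists>g. equivariant_aut g \<and> (\<forall>t\<in>T. g t = t) \<and> g s \<in> H)"
    "\<forall>u\<in>centralizer_G T. (\<forall>b\<in>B. bracket u b \<in> B) \<longrightarrow> u \<in> B"
    "\<forall>x\<in>B. \<forall>b\<in>B. bracket x b \<in> B" "nondeg_on (centralizer_G T)"
  using assms unfolding borel_pair_def by - (elim conjE, assumption)+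

lemma borel_exists:
  assumes cartan: "cartan_subalgebra G H" and T: "T \<subseteq> H"
  shows "\<exists>B N. borel_pair T H B N"
proof -
  obtain lv :: "('a \<Rightarrow> 'k) \<Rightarrow> int" where lv:
    "\<forall>\<alpha>\<in>gen_weights H. \<forall>\<beta>\<in>gen_weights H. lv (\<alpha> + \<beta>) = lv \<alpha> + lv \<beta>"
    "\<forall>\<alpha>\<in>gen_weights H. lv (- \<alpha>) = - lv \<alpha>" "lv 0 = 0" "\<forall>\<alpha>\<in>gen_weights H. lv \<alpha> = 0 \<longrightarrow> \<alpha> = 0"
    using integral_level[OF finite_gen_weights[of H]] by blast
  note bf = borel_facts[OF cartan T, of lv, OF lv(1)[rule_format] lv(2)[rule_format] lv(3) lv(4)[rule_format]]
  have b7: "\<forall>x\<in>centralizer_G T \<inter> filtration H lv 0. (\<forall>v. v \<in> gen_eigenspace (bracket x) 0) \<longrightarrow> x \<in> centralizer_G T \<inter> filtration H lv 1"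
  proof (intro ballI impI)
    fix x assume "x \<in> centralizer_G T \<inter> filtration H lv 0" "\<forall>v. v \<in> gen_eigenspace (bracket x) 0"
    then show "x \<in> centralizer_G T \<inter> filtration H lv 1" using bf(7)[of x] by blast
  qed
  have b8: "\<forall>s\<in>centralizer_G T \<inter> filtration H lv 0. ss_part s s \<longrightarrow> (\<exists>g. equivariant_aut g \<and> (\<forall>t\<in>T. g t = t) \<and> g s \<in> H)"
    using bf(8) by blast
  have b9: "\<forall>u\<in>centralizer_G T. (\<forall>b\<in>centralizer_G T \<inter> filtration H lv 0. bracket u b \<in> centralizer_G T \<inter> filtration H lv 0) \<longrightarrow> u \<in> centralizer_G T \<inter> filtration H lv 0"
  proof (intro ballI impI)
    fix u assume "u \<in> centralizer_G T" "\<forall>b\<in>centralizer_G T \<inter> filtration H lv 0. bracket u b \<in> centralizer_G T \<inter> filtration H lv 0"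
    then show "u \<in> centralizer_G T \<inter> filtration H lv 0" using bf(9)[of u] by blast
  qed
  have b10: "\<forall>x\<in>centralizer_G T \<inter> filtration H lv 0. \<forall>b\<in>centralizer_G T \<inter> filtration H lv 0. bracket x b \<in> centralizer_G T \<inter> filtration H lv 0"
    using bf(10) by blast
  show ?thesis unfolding borel_pair_def
    by (rule exI[of _ "centralizer_G T \<inter> filtration H lv 0"], rule exI[of _ "centralizer_G T \<inter> filtration H lv 1"])
      (intro conjI bf(1-6) Int_lower1 b7 b8 b9 b10 bf(11))
qed

theorem cartan_conjugate:
  assumes "cartan_subalgebra G H1" "cartan_subalgebra G H2"
  shows "\<exists>g. equivariant_aut g \<and> g ` H1 = H2"
  using assms
proof (induction "dimension - dim (H1 \<inter> H2)" arbitrary: H1 H2 rule: less_induct)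
  case less
  note C1 = less.prems(1) and C2 = less.prems(2)
  define T where "T = H1 \<inter> H2"
  have T1: "T \<subseteq> H1" and T2: "T \<subseteq> H2" by (auto simp: T_def)
  have sT: "subspace T" unfolding T_def by (intro subspace_inter subspace_cartan[OF C1] subspace_cartan[OF C2])
  \<comment> \<open>The larger of two nested Cartan subalgebras is abelian, so it normalizes the
    smaller one.\<close>
  have sub_eq: "H = K" if C: "cartan_subalgebra G H" "cartan_subalgebra G K" and HK: "H \<subseteq> K" for H K
  proof
    show "K \<subseteq> H"
    proof
      fix x assume x: "x \<in> K"
      then have "bracket x y \<in> H" if "y \<in> H" for y
        using cartan_abelian[OF C(2) x, of y] that HK subspace_0[OF subspace_cartan[OF C(1)]] by auto
      then show "x \<in> H" using cartan_normalizer[OF C(1)] cartan_subset[OF C(2)] x by blast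
    qed
  qed fact
  show ?case
  proof (cases "T = H1 \<or> T = H2")
    case True
    then have "H1 \<subseteq> H2 \<or> H2 \<subseteq> H1" by (auto simp: T_def)
    then have "H1 = H2" using sub_eq[OF C1 C2] sub_eq[OF C2 C1] by blast
    then show ?thesis using equivariant_aut_id by (intro exI[of _ "\<lambda>x. x"]) auto
  next
    case False
    have dT: "dim T < dim H1" "dim T < dim H2"
      using False subspace_dim_equal[OF sT subspace_cartan[OF C1] T1] subspace_dim_equal[OF sT subspace_cartan[OF C2] T2]
      by (meson not_le)+
    obtain B1 N1 where p1: "borel_pair T H1 B1 N1" using borel_exists[OF C1 T1] by blast
    note b1 = borel_pairD(1-7)[OF p1] and b1' = borel_pairD(8-11)[OF p1, rule_format]
    obtain B2 N2 where p2: "borel_pair T H2 B2 N2" using borel_exists[OF C2 T2] by blast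
    note b2 = borel_pairD(1-7)[OF p2] and b2' = borel_pairD(8-11)[OF p2, rule_format]
    note nd = borel_pairD(12)[OF p1]
    have sM: "subspace (centralizer_G T)"
      using subspace_G by (auto simp: centralizer_G_def subspace_def bracket_0_right bracket_add_right bracket_scale_right)
    let ?S = "{x + y |x y. x \<in> B1 \<and> y \<in> B2}"
    have sS: "subspace ?S" by (rule subspace_sums[OF b1(1) b2(1)])
    have SM: "?S \<subseteq> centralizer_G T" using b1(3) b2(3) subspace_add[OF sM] by blast
    have "N1 \<inter> N2 = {x \<in> centralizer_G T. \<forall>y\<in>?S. kappa x y = 0}"
    proof (intro equalityI subsetI)
      fix x assume x: "x \<in> {x \<in> centralizer_G T. \<forall>y\<in>?S. kappa x y = 0}"
      have "y \<in> ?S" if "y \<in> B1" for y using that subspace_0[OF b2(1)] by (intro CollectI exI[of _ y] exI[of _ 0]) simp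
      moreover have "y \<in> ?S" if "y \<in> B2" for y using that subspace_0[OF b1(1)] by (intro CollectI exI[of _ 0] exI[of _ y]) simp
      ultimately show "x \<in> N1 \<inter> N2" using x unfolding b1(7) b2(7) by blast
    next
      fix x assume "x \<in> N1 \<inter> N2"
      then show "x \<in> {x \<in> centralizer_G T. \<forall>y\<in>?S. kappa x y = 0}"
        unfolding b1(7) b2(7) by (auto simp: kappa_add_right)
    qed
    then have d1: "dim (N1 \<inter> N2) + dim ?S \<le> dim (centralizer_G T)" using dim_annihilator_le[OF sM nd sS SM] by simp
    have d2: "dim ?S + dim (B1 \<inter> B2) = dim B1 + dim B2" by (rule dim_sums_Int[OF b1(1) b2(1)])
    have d3: "dim (centralizer_G T) \<le> dim N1 + dim B1" using dim_annihilator_ge[OF sM b1(1)] b1(7) by simp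
    have d4: "dim (centralizer_G T) \<le> dim N2 + dim B2" using dim_annihilator_ge[OF sM b2(1)] b2(7) by simp
    \<comment> \<open>With \<open>M\<close> the centralizer of \<open>T\<close>, adding
      \<open>d3\<close> and \<open>d4\<close> gives
      \<open>dim B1 + dim B2 - dim M \<ge> (dim H1 + dim H2) / 2 > dim T\<close>; \<open>d1\<close>
      and \<open>d2\<close> supply the remaining \<open>dim (N1 \<inter> N2)\<close>.\<close>
    have d5: "dim T + dim (N1 \<inter> N2) < dim (B1 \<inter> B2)"
      using d1 d2 d3 d4 dT b1(6) b2(6) by linarith
    let ?R = "{x + y |x y. x \<in> T \<and> y \<in> N1 \<inter> N2}"
    have sN: "subspace (N1 \<inter> N2)" by (rule subspace_inter[OF b1(2) b2(2)])
    have "dim ?R \<le> dim T + dim (N1 \<inter> N2)" using dim_sums_Int[OF sT sN] by linarith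
    then have "\<not> B1 \<inter> B2 \<subseteq> ?R" using d5 dim_subset[of "B1 \<inter> B2" ?R] by linarith
    then obtain x where x: "x \<in> B1" "x \<in> B2" "x \<notin> ?R" by blast
    obtain s where s: "ss_part x s" using ss_part_exists[OF nondeg_UNIV[OF C1]] by blast
    have xM: "x \<in> centralizer_G T" using x b1(3) by blast
    then have xG: "x \<in> G" by (simp add: centralizer_G_def)
    have "bracket t s = 0" if "t \<in> T" for t
    proof -
      have "bracket x t = 0" using xM that bracket_swap[of x t] by (simp add: centralizer_G_def)
      then have "t \<in> gen_eigenspace (bracket x) 0" by (intro eigen_in_gen_eigenspace) simp
      then have "bracket s t = 0" using s by (simp add: ss_part_def)
      then show ?thesis using bracket_swap[of t s] by simp
    qed
    then have sMT: "s \<in> centralizer_G T" using ss_part_fixed[OF s xG] by (simp add: centralizer_G_def)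
    \<comment> \<open>\<open>s\<close> centralizes \<open>T\<close> and, like \<open>x\<close>, maps
      \<open>B1\<close> to itself; a Borel subalgebra contains its normalizer.\<close>
    have sB1: "s \<in> B1" by (rule b1'(3)[OF sMT ss_part_invariant[OF s b1(1) b1'(4)[OF x(1)]]])
    have sB2: "s \<in> B2" by (rule b2'(3)[OF sMT ss_part_invariant[OF s b2(1) b2'(4)[OF x(2)]]])
    have "x - s \<in> N1" using b1'(1)[OF subspace_diff[OF b1(1) x(1) sB1] ss_part_nilpotent[OF s]] .
    moreover have "x - s \<in> N2" using b2'(1)[OF subspace_diff[OF b2(1) x(2) sB2] ss_part_nilpotent[OF s]] .
    ultimately have sT': "s \<notin> T" using x(3) by (auto intro!: exI[of _ s] exI[of _ "x - s"])
    note ss = ss_part_semisimple[OF s]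
    obtain g1 where g1: "equivariant_aut g1" "\<And>t. t \<in> T \<Longrightarrow> g1 t = t" "g1 s \<in> H1" using b1'(2)[OF sB1 ss] by blast
    obtain g2 where g2: "equivariant_aut g2" "\<And>t. t \<in> T \<Longrightarrow> g2 t = t" "g2 s \<in> H2" using b2'(2)[OF sB2 ss] by blast
    \<comment> \<open>Pulling back by \<open>g1\<close> and \<open>g2\<close> puts \<open>s\<close>
      into both Cartan subalgebras and keeps \<open>T\<close> in them, so the intersection
      grows.\<close>
    define H1' where "H1' = inv_into UNIV g1 ` H1"
    define H2' where "H2' = inv_into UNIV g2 ` H2"
    have C1': "cartan_subalgebra G H1'" unfolding H1'_def by (rule equivariant_aut_cartan[OF equivariant_aut_inv[OF g1(1)] C1])
    have C2': "cartan_subalgebra G H2'" unfolding H2'_def by (rule equivariant_aut_cartan[OF equivariant_aut_inv[OF g2(1)] C2])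
    have i1: "inv_into UNIV g1 (g1 v) = v" for v by (rule inv_into_f_f[OF bij_is_inj[OF equivariant_aut_bij[OF g1(1)]] UNIV_I])
    have i2: "inv_into UNIV g2 (g2 v) = v" for v by (rule inv_into_f_f[OF bij_is_inj[OF equivariant_aut_bij[OF g2(1)]] UNIV_I])
    have m1: "v \<in> H1'" if "g1 v \<in> H1" for v using that i1[of v] unfolding H1'_def by (metis imageI)
    have m2: "v \<in> H2'" if "g2 v \<in> H2" for v using that i2[of v] unfolding H2'_def by (metis imageI)
    have "T \<subseteq> H1' \<inter> H2'" using g1(2) g2(2) T1 T2 m1 m2 by (metis IntI subset_iff)
    moreover have "s \<in> H1' \<inter> H2'" using m1 m2 g1(3) g2(3) by blast
    ultimately have sub: "insert s T \<subseteq> H1' \<inter> H2'" by blast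
    have "s \<notin> span T" using sT' span_minimal[OF subset_refl sT] by blast
    then have "dim (insert s T) = dim T + 1" by (simp add: dim_insert)
    then have "dim T < dim (H1' \<inter> H2')" using dim_subset[OF sub] by linarith
    moreover have "dim (H1' \<inter> H2') \<le> dimension" by (rule dim_subset_UNIV)
    ultimately have "dimension - dim (H1' \<inter> H2') < dimension - dim (H1 \<inter> H2)" by (simp add: T_def)
    from less.hyps[OF this C1' C2'] obtain g where g: "equivariant_aut g" "g ` H1' = H2'" by blast
    have "equivariant_aut (\<lambda>v. g2 (g (inv_into UNIV g1 v)))"
      by (intro equivariant_aut_compose[OF g2(1)] equivariant_aut_compose[OF g(1)] equivariant_aut_inv g1(1))
    moreover have "(\<lambda>v. g2 (g (inv_into UNIV g1 v))) ` H1 = g2 ` (g ` H1')"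
      unfolding H1'_def image_image ..
    moreover have "g2 ` H2' = H2"
      unfolding H2'_def image_image using equivariant_aut_bij[OF g2(1)] by (simp add: bij_is_surj surj_f_inv_f)
    ultimately show ?thesis using g(2) by metis
  qed
qed

end

section \<open>The grading by characters\<close>

lemma primitive_root_powi_eq_1_iff:
  assumes "compatible_primitive_roots \<zeta>" "m \<ge> 1"
  shows "\<zeta> m powi a = (1::'k::field) \<longleftrightarrow> int m dvd a"
proof -
  have z: "\<zeta> m ^ m = 1" "\<And>i. 0 < i \<Longrightarrow> i < m \<Longrightarrow> \<zeta> m ^ i \<noteq> 1"
    using assms by (auto simp: compatible_primitive_roots_def)
  have nz: "\<zeta> m \<noteq> 0" using z(1) assms(2) by (auto simp: power_0_left)
  define r where "r = nat (a mod int m)"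
  have "\<zeta> m powi a = \<zeta> m powi (int m * (a div int m) + a mod int m)" by simp
  also have "\<dots> = (\<zeta> m powi int m) powi (a div int m) * \<zeta> m powi (a mod int m)"
    unfolding power_int_mult[symmetric] by (rule power_int_add) (use nz in simp)
  also have "\<dots> = \<zeta> m ^ r"
    using z(1) assms(2) by (simp add: r_def power_int_def[of _ "a mod int m"])
  finally have e: "\<zeta> m powi a = \<zeta> m ^ r" .
  have "r < m" using assms(2) by (simp add: r_def nat_less_iff)
  then have "\<zeta> m ^ r = 1 \<longleftrightarrow> r = 0" using z(2)[of r] by auto
  moreover have "r = 0 \<longleftrightarrow> int m dvd a"
  proof -
    have "0 \<le> a mod int m" using assms(2) by (intro pos_mod_sign) simp
    then show ?thesis by (auto simp: r_def dvd_eq_mod_eq_0)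
  qed
  ultimately show ?thesis unfolding e by simp
qed

lemma primitive_root_nonzero:
  assumes "compatible_primitive_roots \<zeta>" "m \<ge> 1"
  shows "\<zeta> m \<noteq> (0::'k::field)"
  using assms by (auto simp: compatible_primitive_roots_def power_0_left)

text \<open>The compatibility condition makes \<open>\<zeta> m powi a\<close> a function of \<open>a / m\<close>.\<close>

lemma primitive_root_powi_cross:
  assumes \<zeta>: "compatible_primitive_roots \<zeta>" and m: "m \<ge> 1" "n \<ge> 1" and e: "a * int n = b * int m"
  shows "\<zeta> m powi a = (\<zeta> n powi b :: 'k::field)"
proof -
  let ?w = "\<zeta> (m * n)"
  have w: "?w ^ n = \<zeta> m" "?w ^ m = \<zeta> n"
    using \<zeta> m by (auto simp: compatible_primitive_roots_def mult.commute)
  have nz: "?w \<noteq> 0" by (rule primitive_root_nonzero[OF \<zeta>]) (use m in simp)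
  have "\<zeta> m powi a = ?w powi (int n * a)" by (simp add: power_int_mult w)
  also have "\<dots> = ?w powi (int m * b)" using e by (simp add: mult.commute)
  also have "\<dots> = \<zeta> n powi b" by (simp add: power_int_mult w)
  finally show ?thesis .
qed

text \<open>The summands are discrete Fourier components: averages of the iterates of
  \<open>T\<close> weighted by roots of unity. The last clause keeps them in every
  \<open>T\<close>-stable subspace containing \<open>x\<close>, so that commuting maps can be
  diagonalized in turn.\<close>

lemma (in lin_space) finite_order_eigen_decomp:
  assumes T: "lin T" "\<And>x. (T ^^ m) x = x" and m: "m \<ge> 1" "of_nat m \<noteq> (0::'a)"
    and z: "z ^ m = 1" "\<And>i. 0 < i \<Longrightarrow> i < m \<Longrightarrow> z ^ i \<noteq> 1"
  shows "\<exists>y. x = (\<Sum>k<m. y k) \<and> (\<forall>k. T (y k) = z ^ k \<cdot> y k) \<and>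
    (\<forall>W. subspace W \<longrightarrow> (\<forall>w\<in>W. T w \<in> W) \<longrightarrow> x \<in> W \<longrightarrow> (\<forall>k. y k \<in> W))"
proof -
  have z0: "z \<noteq> 0" using z(1) m by (auto simp: power_0_left)
  define w where "w = inverse z"
  have wz: "w * z = 1" using z0 by (simp add: w_def)
  have wm: "w ^ m = 1" using z(1) by (simp add: w_def power_inverse)
  have w1: "w ^ i \<noteq> 1" if "0 < i" "i < m" for i using z(2)[OF that] by (simp add: w_def power_inverse)
  define y where "y k = (1 / of_nat m) \<cdot> (\<Sum>t<m. w ^ (k * t) \<cdot> (T ^^ t) x)" for k
  have "T (y k) = z ^ k \<cdot> y k" for k
  proof -
    let ?f = "\<lambda>t. w ^ (k * t) \<cdot> (T ^^ t) x"
    have fm: "?f m = ?f 0" using wm by (simp add: T power_mult mult.commute[of k])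
    have "T (?f t) = z ^ k \<cdot> ?f (Suc t)" for t
    proof -
      have "z ^ k * w ^ (k * Suc t) = (z ^ k * w ^ k) * w ^ (k * t)" by (simp add: power_add)
      also have "z ^ k * w ^ k = 1" using wz by (simp add: power_mult_distrib[symmetric] mult.commute)
      finally show ?thesis by (simp add: lin_scale[OF T(1)])
    qed
    then have "T (y k) = (1 / of_nat m) \<cdot> (\<Sum>t<m. z ^ k \<cdot> ?f (Suc t))"
      by (simp only: y_def lin_scale[OF T(1)] lin_sum[OF T(1)])
    also have "(\<Sum>t<m. z ^ k \<cdot> ?f (Suc t)) = z ^ k \<cdot> (\<Sum>t<m. ?f (Suc t))" by (rule scale_sum_right[symmetric])
    also have "(\<Sum>t<m. ?f (Suc t)) = (\<Sum>t<m. ?f t)"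
      using sum.lessThan_Suc_shift[of ?f m] sum.lessThan_Suc[of ?f m] fm by simp
    finally show ?thesis by (simp add: y_def mult.commute)
  qed
  moreover have "x = (\<Sum>k<m. y k)"
  proof -
    have geo: "(\<Sum>k<m. w ^ (k * t)) = (if t = 0 then of_nat m else 0)" if "t < m" for t
    proof (cases "t = 0")
      case False
      have "(\<Sum>k<m. w ^ (k * t)) = (\<Sum>k<m. (w ^ t) ^ k)" by (simp add: power_mult[symmetric] mult.commute)
      also have "\<dots> = ((w ^ t) ^ m - 1) / (w ^ t - 1)" by (rule geometric_sum) (use w1 False that in auto)
      also have "(w ^ t) ^ m = 1" using wm by (simp add: power_mult[symmetric] mult.commute[of t] power_mult[of w m t])
      finally show ?thesis using False by simp
    qed simp
    have "(\<Sum>k<m. y k) = (1 / of_nat m) \<cdot> (\<Sum>k<m. \<Sum>t<m. w ^ (k * t) \<cdot> (T ^^ t) x)"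
      unfolding y_def by (rule scale_sum_right[symmetric])
    also have "(\<Sum>k<m. \<Sum>t<m. w ^ (k * t) \<cdot> (T ^^ t) x) = (\<Sum>t<m. \<Sum>k<m. w ^ (k * t) \<cdot> (T ^^ t) x)" by (rule sum.swap)
    also have "\<dots> = (\<Sum>t<m. (\<Sum>k<m. w ^ (k * t)) \<cdot> (T ^^ t) x)" by (simp add: scale_sum_left)
    also have "\<dots> = (\<Sum>t<m. if t = 0 then of_nat m \<cdot> x else 0)"
      by (intro sum.cong refl) (auto simp: geo)
    also have "\<dots> = of_nat m \<cdot> x" using m(1) by (simp add: sum.delta)
    finally show ?thesis using m(2) by simp
  qed
  moreover have "y k \<in> W" if W: "subspace W" "\<forall>w\<in>W. T w \<in> W" "x \<in> W" for W k
  proof -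
    have "(T ^^ t) x \<in> W" for t by (induction t) (use W in auto)
    then show ?thesis unfolding y_def by (intro subspace_scale[OF W(1)] subspace_sum[OF W(1)])
  qed
  ultimately show ?thesis by blast
qed

locale torus = multiloop_lie_torus scale bracket \<zeta> \<sigma> H + fixed_lie scale bracket Basis \<sigma>
  for scale :: "'k::{alg_closed_field,field_char_0} \<Rightarrow> 'a::ab_group_add \<Rightarrow> 'a" (infixr "\<cdot>" 75)
    and bracket and \<zeta> and \<sigma> :: "'n::finite \<Rightarrow> 'a \<Rightarrow> 'a" and H and Basis +
  assumes roots: "compatible_primitive_roots \<zeta>"
begin

abbreviation "m j \<equiv> aut_order (\<sigma> j)"
abbreviation "E l \<equiv> eigenspace \<zeta> \<sigma> l"

lemma m_pos: "m j \<ge> 1"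
  using finite_order[of j] by simp

lemma \<zeta>_nz: "\<zeta> (m j) \<noteq> 0"
  by (rule primitive_root_nonzero[OF roots m_pos])

lemma E_iff: "x \<in> E l \<longleftrightarrow> (\<forall>j. \<sigma> j x = (\<zeta> (m j) powi (l $ j)) \<cdot> x)"
  by (simp add: eigenspace_def)

lemma subspace_E: "subspace (E l)"
  by (auto simp: subspace_def E_iff lin_0[OF lin_\<sigma>] lin_add[OF lin_\<sigma>] lin_scale[OF lin_\<sigma>] scale_right_distrib mult.commute)

lemma E_bracket: "x \<in> E l \<Longrightarrow> y \<in> E l' \<Longrightarrow> bracket x y \<in> E (l + l')"
  by (simp add: E_iff \<sigma>_bracket bracket_scale_left bracket_scale_right power_int_add \<zeta>_nz)

lemma E_0: "E 0 = G"
  by (auto simp: E_iff fixed_points_def)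

definition periods :: "(int^'n) set" where
  "periods = {l. \<forall>j. int (m j) dvd l $ j}"

lemma E_periodic: "l' - l \<in> periods \<Longrightarrow> E l' = E l"
proof -
  assume p: "l' - l \<in> periods"
  have "\<zeta> (m j) powi (l' $ j) = \<zeta> (m j) powi (l $ j)" for j
  proof -
    have "\<zeta> (m j) powi (l' $ j) = \<zeta> (m j) powi (l $ j) * \<zeta> (m j) powi (l' $ j - l $ j)"
      using power_int_add[of "\<zeta> (m j)" "l $ j" "l' $ j - l $ j"] \<zeta>_nz by simp
    also have "\<zeta> (m j) powi (l' $ j - l $ j) = 1"
      using p primitive_root_powi_eq_1_iff[OF roots m_pos] by (auto simp: periods_def)
    finally show ?thesis by simp
  qed
  then show ?thesis by (auto simp: E_iff)
qed

lemma E_Int: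
  assumes "x \<in> E l" "x \<in> E l'" "x \<noteq> 0"
  shows "l' - l \<in> periods"
proof -
  have "int (m j) dvd (l' - l) $ j" for j
  proof -
    have "\<zeta> (m j) powi (l' $ j) = \<zeta> (m j) powi (l $ j)" using assms by (auto simp: E_iff)
    then have "\<zeta> (m j) powi (l' $ j - l $ j) = 1" using \<zeta>_nz by (simp add: power_int_diff)
    then show ?thesis using primitive_root_powi_eq_1_iff[OF roots m_pos] by simp
  qed
  then show ?thesis by (simp add: periods_def)
qed

lemma \<sigma>_pow_m: "(\<sigma> j ^^ m j) x = x"
proof -
  interpret group aut_group by (rule group_aut_group)
  have "\<sigma> j [^]\<^bsub>aut_group\<^esub> n = \<sigma> j ^^ n" for n :: nat
    by (induction n) (simp_all add: aut_group_def comp_def fun_eq_iff funpow_swap1)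
  moreover have "\<sigma> j [^]\<^bsub>aut_group\<^esub> m j = \<one>\<^bsub>aut_group\<^esub>"
    unfolding aut_order_def by (rule pow_ord_eq_1) (rule multiloop_lie_torus.automorphism[OF multiloop_lie_torus_axioms])
  ultimately show ?thesis by (simp add: aut_group_def)
qed

lemma \<sigma>_commute: "\<sigma> i (\<sigma> j x) = \<sigma> j (\<sigma> i x)"
  using commute[of i j] by (metis comp_apply)

text \<open>The \<open>\<sigma> i\<close> are diagonalized one at a time; since they commute, the
  components for the next one remain eigenvectors of the earlier ones.\<close>

lemma E_span: "v \<in> span (\<Union>l. E l)"
proof -
  have "finite A \<Longrightarrow> v \<in> span {x. \<exists>l::'n \<Rightarrow> int. \<forall>j\<in>A. \<sigma> j x = (\<zeta> (m j) powi l j) \<cdot> x}" for A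
  proof (induction A rule: finite_induct)
    case (insert i A)
    let ?S = "\<lambda>A. {x. \<exists>l::'n \<Rightarrow> int. \<forall>j\<in>A. \<sigma> j x = (\<zeta> (m j) powi l j) \<cdot> x}"
    have "?S A \<subseteq> span (?S (insert i A))"
    proof
      fix x assume "x \<in> ?S A"
      then obtain l where l: "\<forall>j\<in>A. \<sigma> j x = (\<zeta> (m j) powi l j) \<cdot> x" by auto
      let ?W = "{x. \<forall>j\<in>A. \<sigma> j x = (\<zeta> (m j) powi l j) \<cdot> x}"
      have W: "subspace ?W"
        by (auto simp: subspace_def lin_0[OF lin_\<sigma>] lin_add[OF lin_\<sigma>] lin_scale[OF lin_\<sigma>] scale_right_distrib mult.commute)
      have Wi: "\<forall>w\<in>?W. \<sigma> i w \<in> ?W" by (auto simp: \<sigma>_commute[of _ i] lin_scale[OF lin_\<sigma>])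
      have "\<exists>y. x = (\<Sum>k<m i. y k) \<and> (\<forall>k. \<sigma> i (y k) = \<zeta> (m i) ^ k \<cdot> y k) \<and>
        (\<forall>W. subspace W \<longrightarrow> (\<forall>w\<in>W. \<sigma> i w \<in> W) \<longrightarrow> x \<in> W \<longrightarrow> (\<forall>k. y k \<in> W))"
        by (rule finite_order_eigen_decomp[OF lin_\<sigma> \<sigma>_pow_m m_pos])
          (use roots m_pos[of i] in \<open>auto simp: compatible_primitive_roots_def\<close>)
      then obtain y where y: "x = (\<Sum>k<m i. y k)" "\<forall>k. \<sigma> i (y k) = \<zeta> (m i) ^ k \<cdot> y k"
        and yW: "\<forall>W. subspace W \<longrightarrow> (\<forall>w\<in>W. \<sigma> i w \<in> W) \<longrightarrow> x \<in> W \<longrightarrow> (\<forall>k. y k \<in> W)"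
        by (elim exE conjE)
      have "x \<in> ?W" using l by simp
      with yW W Wi have y3: "y k \<in> ?W" for k by presburger
      have "y k \<in> ?S (insert i A)" for k
        using y(2) y3[of k] insert.hyps by (auto intro!: exI[of _ "l(i := int k)"])
      then show "x \<in> span (?S (insert i A))" unfolding y(1) by (intro span_sum span_base)
    qed
    then show ?case using insert.IH span_minimal[OF _ subspace_span] by blast
  qed (simp)
  from this[of UNIV] have "v \<in> span {x. \<exists>l::'n \<Rightarrow> int. \<forall>j. \<sigma> j x = (\<zeta> (m j) powi l j) \<cdot> x}" by simp
  moreover have "{x. \<exists>l::'n \<Rightarrow> int. \<forall>j. \<sigma> j x = (\<zeta> (m j) powi l j) \<cdot> x} \<subseteq> (\<Union>l. E l)"
  proof safe
    fix x and l :: "'n \<Rightarrow> int" assume "\<forall>j. \<sigma> j x = (\<zeta> (m j) powi l j) \<cdot> x"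
    then have "x \<in> E (vec_lambda l)" by (simp add: E_iff)
    then show "x \<in> (\<Union>l. E l)" by blast
  qed
  ultimately show ?thesis using span_mono by blast
qed

lemma eq_on_E:
  assumes S: "\<And>x y. S (x + y) = S x + S y" "\<And>c x. S (c \<cdot> x) = s c (S x)"
    and T: "\<And>x y. T (x + y) = T x + T y" "\<And>c x. T (c \<cdot> x) = s c (T x)"
    and s: "s 0 (S 0) = (0 :: 'b::ab_group_add)" "s 0 (T 0) = 0" 
    and e: "\<And>l x. x \<in> E l \<Longrightarrow> S x = T x"
  shows "S x = T x"
proof -
  have "S 0 = T 0" using S(2)[of 0 0] T(2)[of 0 0] s by simp
  then have "subspace {x. S x = T x}" by (auto simp: subspace_def S T)
  then have "span (\<Union>l. E l) \<subseteq> {x. S x = T x}" by (rule span_minimal[rotated]) (use e in auto)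
  then show ?thesis using E_span by blast
qed

lemma lin_eq_on_E: "lin S \<Longrightarrow> lin T \<Longrightarrow> (\<And>l x. x \<in> E l \<Longrightarrow> S x = T x) \<Longrightarrow> S = T"
proof
  fix x assume *: "lin S" "lin T" "\<And>l x. x \<in> E l \<Longrightarrow> S x = T x"
  show "S x = T x"
    by (rule eq_on_E[where s=scale, OF lin_add[OF *(1)] lin_scale[OF *(1)] lin_add[OF *(2)] lin_scale[OF *(2)] _ _ *(3)]) simp_all
qed

section \<open>Products of integer powers of the automorphisms and their characters\<close>

definition aprod :: "('n \<Rightarrow> int) \<Rightarrow> 'a \<Rightarrow> 'a" where
  "aprod a = (\<Otimes>\<^bsub>aut_group\<^esub>i\<in>UNIV. \<sigma> i [^]\<^bsub>aut_group\<^esub> a i)"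

lemma seq_power_aprod: "seq_power \<sigma> P j = aprod (\<lambda>i. P $ i $ j)"
  by (simp add: seq_power_def aprod_def)

lemma aut_lin: "f \<in> carrier aut_group \<Longrightarrow> lin f"
  by (auto simp: aut_group_def algebra_iso_def intro: linI)

lemma aut_mult: "f \<otimes>\<^bsub>aut_group\<^esub> g = f \<circ> g" and aut_one: "\<one>\<^bsub>aut_group\<^esub> = id"
  by (simp_all add: aut_group_def)

lemma \<sigma>_aut: "\<sigma> j \<in> carrier aut_group"
  by (rule multiloop_lie_torus.automorphism[OF multiloop_lie_torus_axioms])

lemma aut_int_pow_eigen:
  assumes f: "f \<in> carrier aut_group" and x: "f x = c \<cdot> x" and c: "c \<noteq> 0"
  shows "(f [^]\<^bsub>aut_group\<^esub> (n::int)) x = (c powi n) \<cdot> x"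
proof -
  interpret group aut_group by (rule group_aut_group)
  have nat: "(f [^]\<^bsub>aut_group\<^esub> (k::nat)) x = c ^ k \<cdot> x" for k
    by (induction k) (simp_all add: aut_mult aut_one lin_scale[OF aut_lin[OF nat_pow_closed[OF f]]] x mult.commute)
  show ?thesis
  proof (cases "n < 0")
    case False
    have "f [^]\<^bsub>aut_group\<^esub> n = f [^]\<^bsub>aut_group\<^esub> nat n" by (simp only: int_pow_def2 False if_False)
    moreover have "c powi n = c ^ nat n" using False by (simp add: power_int_def)
    ultimately show ?thesis by (simp only: nat)
  next
    case True
    let ?g = "f [^]\<^bsub>aut_group\<^esub> nat (- n)"
    have g: "?g \<in> carrier aut_group" using f by simp
    define y where "y = (inv\<^bsub>aut_group\<^esub> ?g) x"
    have "x = (inv\<^bsub>aut_group\<^esub> ?g) (?g x)"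
      using fun_cong[OF l_inv[OF g, unfolded aut_mult aut_one], of x] by simp
    also have "\<dots> = c ^ nat (- n) \<cdot> y"
      by (simp only: nat lin_scale[OF aut_lin[OF inv_closed[OF g]]] y_def)
    finally have "inverse (c ^ nat (- n)) \<cdot> x = inverse (c ^ nat (- n)) \<cdot> (c ^ nat (- n) \<cdot> y)"
      by (rule arg_cong)
    also have "\<dots> = y" using c by simp
    finally have "y = inverse (c ^ nat (- n)) \<cdot> x" ..
    then have "(inv\<^bsub>aut_group\<^esub> ?g) x = inverse (c ^ nat (- n)) \<cdot> x" by (simp only: y_def)
    moreover have "f [^]\<^bsub>aut_group\<^esub> n = inv\<^bsub>aut_group\<^esub> ?g" by (simp only: int_pow_def2 True if_True)
    moreover have "c powi n = inverse (c ^ nat (- n))" using True by (simp add: power_int_def power_inverse)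
    ultimately show ?thesis by (simp only:)
  qed
qed

text \<open>Both sides act on each \<open>E l\<close> by the same scalar. This is the commutation
  that \<open>finprod_aut_insert\<close> asks of the factors.\<close>

lemma int_pow_commute:
  "(\<sigma> i [^]\<^bsub>aut_group\<^esub> (a::int)) \<circ> (\<sigma> j [^]\<^bsub>aut_group\<^esub> (b::int)) = (\<sigma> j [^]\<^bsub>aut_group\<^esub> b) \<circ> (\<sigma> i [^]\<^bsub>aut_group\<^esub> a)"
proof -
  interpret group aut_group by (rule group_aut_group)
  have li: "lin (\<sigma> i [^]\<^bsub>aut_group\<^esub> (a::int))" for i a by (rule aut_lin[OF int_pow_closed[OF \<sigma>_aut]])
  show ?thesis
  proof (rule lin_eq_on_E)
    fix l x assume x: "x \<in> E l"
    have e: "(\<sigma> k [^]\<^bsub>aut_group\<^esub> n) x = ((\<zeta> (m k) powi (l $ k)) powi n) \<cdot> x" for k n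
      by (rule aut_int_pow_eigen[OF \<sigma>_aut]) (use x \<zeta>_nz in \<open>auto simp: E_iff\<close>)
    show "((\<sigma> i [^]\<^bsub>aut_group\<^esub> a) \<circ> (\<sigma> j [^]\<^bsub>aut_group\<^esub> b)) x = ((\<sigma> j [^]\<^bsub>aut_group\<^esub> b) \<circ> (\<sigma> i [^]\<^bsub>aut_group\<^esub> a)) x"
      by (simp add: e lin_scale[OF li] mult.commute)
  qed (auto simp: comp_def intro: lin_compose li)
qed

lemma
  shows aprod_aut: "aprod a \<in> carrier aut_group"
    and aprod_eigen: "(\<And>i. \<sigma> i x = c i \<cdot> x) \<Longrightarrow> (\<And>i. c i \<noteq> 0) \<Longrightarrow> aprod a x = (\<Prod>i\<in>UNIV. c i powi a i) \<cdot> x"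
proof -
  interpret group aut_group by (rule group_aut_group)
  let ?t = "\<lambda>i. \<sigma> i [^]\<^bsub>aut_group\<^esub> a i"
  have t: "?t i \<in> carrier aut_group" for i by (rule int_pow_closed[OF \<sigma>_aut])
  have ins: "finprod aut_group ?t (insert i A) = ?t i \<circ> finprod aut_group ?t A" if "finite A" "i \<notin> A" for i A
    using that t int_pow_commute by (intro finprod_aut_insert)
  have "id \<in> carrier aut_group" using one_closed by (simp only: aut_one)
  then have em: "finprod aut_group ?t {} = id" by (simp add: finprod_def aut_one)
  have "finite A \<Longrightarrow> finprod aut_group ?t A \<in> carrier aut_group" for A
  proof (induction A rule: finite_induct)
    case empty
    show ?case using one_closed by (simp only: em aut_one)
  next
    case (insert i A)
    show ?case using m_closed[OF t insert.IH, of i] unfolding ins[OF insert.hyps] aut_mult .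
  qed
  from this[of UNIV] show "aprod a \<in> carrier aut_group" by (simp add: aprod_def)
  assume c: "\<And>i. \<sigma> i x = c i \<cdot> x" "\<And>i. c i \<noteq> 0"
  have "finite A \<Longrightarrow> finprod aut_group ?t A x = (\<Prod>i\<in>A. c i powi a i) \<cdot> x" for A
  proof (induction A rule: finite_induct)
    case (insert i A)
    then show ?case
      by (simp add: ins lin_scale[OF aut_lin[OF t]] aut_int_pow_eigen[OF \<sigma>_aut c] mult.commute)
  qed (simp add: em)
  from this[of UNIV] show "aprod a x = (\<Prod>i\<in>UNIV. c i powi a i) \<cdot> x" by (simp add: aprod_def)
qed

lemma lin_aprod: "lin (aprod a)"
  by (rule aut_lin[OF aprod_aut])

definition char :: "int^'n \<Rightarrow> ('n \<Rightarrow> int) \<Rightarrow> 'k" where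
  "char l a = (\<Prod>i\<in>UNIV. \<zeta> (m i) powi (l $ i * a i))"

lemma aprod_E: "x \<in> E l \<Longrightarrow> aprod a x = char l a \<cdot> x"
  using aprod_eigen[of x "\<lambda>i. \<zeta> (m i) powi (l $ i)" a] \<zeta>_nz by (simp add: E_iff char_def power_int_mult)

lemma char_nz: "char l a \<noteq> 0"
  using \<zeta>_nz by (simp add: char_def)

lemma char_add: "char l (\<lambda>i. a i + b i) = char l a * char l b"
  by (simp add: char_def distrib_left power_int_add \<zeta>_nz prod.distrib)

lemma char_scale: "char l (\<lambda>i. a i * c) = char l a powi c"
proof -
  have "finite A \<Longrightarrow> (\<Prod>i\<in>A. f i) powi c = (\<Prod>i\<in>A. f i powi c)" for A and f :: "'n \<Rightarrow> 'k"
    by (induction A rule: finite_induct) (simp_all add: power_int_mult_distrib)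
  then show ?thesis by (simp add: char_def power_int_mult[symmetric] mult.assoc)
qed

lemma char_unit: "char l (\<lambda>i. if i = j then c else 0) = \<zeta> (m j) powi (l $ j * c)"
proof -
  have "char l (\<lambda>i. if i = j then c else 0) = (\<Prod>i\<in>UNIV. if i = j then \<zeta> (m j) powi (l $ j * c) else 1)"
    unfolding char_def by (intro prod.cong refl) auto
  then show ?thesis by simp
qed

lemma char_cong:
  assumes "\<And>i. int (m i) dvd a i - b i"
  shows "char l a = char l b"
  unfolding char_def
proof (rule prod.cong[OF refl])
  fix i
  have "\<zeta> (m i) powi (l $ i * a i) = \<zeta> (m i) powi (l $ i * b i + l $ i * (a i - b i))" by (simp add: algebra_simps)
  also have "\<dots> = \<zeta> (m i) powi (l $ i * b i) * \<zeta> (m i) powi (l $ i * (a i - b i))"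
    by (rule power_int_add) (simp add: \<zeta>_nz)
  also have "\<zeta> (m i) powi (l $ i * (a i - b i)) = 1"
    using assms primitive_root_powi_eq_1_iff[OF roots m_pos] by simp
  finally show "\<zeta> (m i) powi (l $ i * a i) = \<zeta> (m i) powi (l $ i * b i)" by simp
qed

lemma aprod_eqI: "(\<And>l x. x \<in> E l \<Longrightarrow> x \<noteq> 0 \<Longrightarrow> char l a = char l b) \<Longrightarrow> aprod a = aprod b"
  by (rule lin_eq_on_E[OF lin_aprod lin_aprod]) (metis aprod_E lin_0 lin_aprod)

lemma aprod_eq_idI: "(\<And>l x. x \<in> E l \<Longrightarrow> x \<noteq> 0 \<Longrightarrow> char l a = 1) \<Longrightarrow> aprod a = id"
proof (rule lin_eq_on_E[OF lin_aprod])
  fix l x assume *: "\<And>l x. x \<in> E l \<Longrightarrow> x \<noteq> 0 \<Longrightarrow> char l a = 1" and x: "x \<in> E l"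
  show "aprod a x = id x" using *[OF x] by (cases "x = 0") (auto simp: aprod_E[OF x] lin_0[OF lin_aprod])
qed (auto intro: linI)

lemma aprod_unit: "aprod (\<lambda>i. if i = j then 1 else 0) = \<sigma> j"
proof (rule lin_eq_on_E[OF lin_aprod lin_\<sigma>])
  fix l x assume x: "x \<in> E l"
  then show "aprod (\<lambda>i. if i = j then 1 else 0) x = \<sigma> j x"
    using E_iff[of x l] by (simp add: aprod_E[OF x] char_unit)
qed

text \<open>Here \<open>A3\<close> enters, by counting: there are as many exponent vectors reduced
  modulo the orders as elements of the generated group, and every element is reached, so reduced
  exponents are unique.\<close>

lemma aprod_eq_id_imp_dvd:
  assumes a: "aprod a = id"
  shows "int (m i) dvd a i"
proof -
  interpret group aut_group by (rule group_aut_group)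
  define R where "R = (\<Pi>\<^sub>E i\<in>(UNIV::'n set). {0..<int (m i)})"
  define red where "red b = (\<lambda>i. b i mod int (m i))" for b :: "'n \<Rightarrow> int"
  have redR: "red b \<in> R" for b using finite_order by (auto simp: red_def R_def PiE_def)
  have red: "aprod (red b) = aprod b" for b
    by (intro aprod_eqI char_cong) (simp add: red_def mod_eq_dvd_iff[symmetric])
  have add: "aprod (\<lambda>i. b i + c i) = aprod b \<circ> aprod c" for b c
    by (rule lin_eq_on_E[OF lin_aprod])
      (auto simp: aprod_E char_add lin_scale[OF lin_aprod] mult.commute comp_def intro: lin_compose lin_aprod)
  have zero: "aprod (\<lambda>i. 0) = id" by (intro aprod_eq_idI) (simp add: char_def)
  have "subgroup (range aprod) aut_group"
  proof (rule subgroupI)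
    show "range aprod \<subseteq> carrier aut_group" using aprod_aut by auto
    show "range aprod \<noteq> {}" by auto
    fix f assume "f \<in> range aprod"
    then obtain b where b: "f = aprod b" by auto
    have "aprod (\<lambda>i. - b i) \<otimes>\<^bsub>aut_group\<^esub> f = \<one>\<^bsub>aut_group\<^esub>"
      using add[of "\<lambda>i. - b i" b] zero by (simp add: aut_mult aut_one b)
    then have "inv\<^bsub>aut_group\<^esub> f = aprod (\<lambda>i. - b i)"
      using aprod_aut by (intro inv_equality) (auto simp: b)
    then show "inv\<^bsub>aut_group\<^esub> f \<in> range aprod" by auto
    fix g assume "g \<in> range aprod"
    then obtain c where "g = aprod c" by auto
    then show "f \<otimes>\<^bsub>aut_group\<^esub> g \<in> range aprod" using add[of b c] by (metis aut_mult b rangeI)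
  qed
  moreover have "range \<sigma> \<subseteq> range aprod"
  proof
    fix f assume "f \<in> range \<sigma>"
    then obtain j where "f = \<sigma> j" by auto
    then show "f \<in> range aprod" using aprod_unit[of j] by (metis rangeI)
  qed
  ultimately have "generate aut_group (range \<sigma>) \<subseteq> range aprod"
    by (intro generate_subgroup_incl)
  also have "range aprod \<subseteq> aprod ` R"
  proof
    fix f assume "f \<in> range aprod"
    then obtain b where "f = aprod b" by auto
    then show "f \<in> aprod ` R" using red[of b] redR[of b] by (metis imageI)
  qed
  finally have sub: "generate aut_group (range \<sigma>) \<subseteq> aprod ` R" .
  have fR: "finite R" unfolding R_def by (intro finite_PiE) auto
  have "card R = (\<Prod>j\<in>UNIV. m j)" unfolding R_def by (subst card_PiE) auto
  then have "card R \<le> card (aprod ` R)" using card_mono[OF finite_imageI[OF fR] sub] A3 by simp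
  then have "inj_on aprod R" using card_image_le[OF fR, of aprod] by (intro eq_card_imp_inj_on fR) simp
  moreover have "aprod (red a) = aprod (red (\<lambda>i. 0))" using red[of a] red[of "\<lambda>i. 0"] a zero by simp
  ultimately have "red a = red (\<lambda>i. 0)" using redR by (auto dest: inj_onD)
  then have "red a i = red (\<lambda>i. 0) i" by simp
  then show ?thesis by (simp add: red_def dvd_eq_mod_eq_0)
qed

end

section \<open>Twists by integer matrices\<close>

context torus
begin

lemma char_zero: "char l (\<lambda>i. 0) = 1"
  by (simp add: char_def)

lemma char_sum: "finite J \<Longrightarrow> char l (\<lambda>i. \<Sum>j\<in>J. f i j) = (\<Prod>j\<in>J. char l (\<lambda>i. f i j))"
  by (induction J rule: finite_induct) (simp_all add: char_zero char_add)

lemma aprod_period: "aprod (\<lambda>i. if i = j then int (m j) else 0) = id"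
proof (rule aprod_eq_idI)
  fix l
  show "char l (\<lambda>i. if i = j then int (m j) else 0) = 1"
    using primitive_root_powi_eq_1_iff[OF roots m_pos] by (simp add: char_unit)
qed

end

text \<open>Reads \<open>X diag(b) = diag(a) Y^T\<close>: up to diagonal rescaling, \<open>X\<close>
  is the transpose of \<open>Y\<close>. With the denominators cleared, all matrices stay
  integral.\<close>

definition scaled :: "('i \<Rightarrow> int) \<Rightarrow> ('j \<Rightarrow> int) \<Rightarrow> int^'j^'i \<Rightarrow> int^'i^'j \<Rightarrow> bool" where
  "scaled a b X Y \<longleftrightarrow> (\<forall>i j. X $ i $ j * b j = a i * Y $ j $ i)"

text \<open>The two relations combine to \<open>X X' diag(a) = diag(a) (Y' Y)^T\<close>, and the
  nonzero diagonal cancels.\<close>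

lemma scaled_inverse:
  fixes X X' :: "int^'n::finite^'n" and Y Y' :: "int^'n^'n"
  assumes s: "scaled a b X Y" "scaled b a X' Y'" and YY: "Y' ** Y = mat 1" and a: "\<And>i. a i \<noteq> 0"
  shows "X ** X' = mat 1"
proof -
  have "(X ** X') $ i $ k = mat 1 $ i $ k" for i k
  proof -
    have "(X ** X') $ i $ k * a k = (\<Sum>j\<in>UNIV. X $ i $ j * (X' $ j $ k * a k))"
      by (simp add: matrix_matrix_mult_def sum_distrib_right mult.assoc)
    also have "\<dots> = (\<Sum>j\<in>UNIV. (X $ i $ j * b j) * Y' $ k $ j)"
      using s(2) by (simp add: scaled_def mult.assoc)
    also have "\<dots> = a i * (\<Sum>j\<in>UNIV. Y' $ k $ j * Y $ j $ i)"
      using s(1) by (simp add: scaled_def sum_distrib_left mult.commute mult.left_commute)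
    also have "\<dots> = a i * (Y' ** Y) $ k $ i" by (simp add: matrix_matrix_mult_def)
    also have "\<dots> = mat 1 $ i $ k * a k" by (simp add: YY mat_def)
    finally show ?thesis using a[of k] by simp
  qed
  then show ?thesis by (simp add: vec_eq_iff)
qed

locale torus_pair = A: torus scale bracket \<zeta> \<sigma> H Basis + B: torus scale' bracket' \<zeta> \<sigma>' H' Basis'
  for scale :: "'k::{alg_closed_field,field_char_0} \<Rightarrow> 'a::ab_group_add \<Rightarrow> 'a"
    and bracket and \<zeta> and \<sigma> :: "'n::finite \<Rightarrow> 'a \<Rightarrow> 'a" and H Basis
    and scale' :: "'k \<Rightarrow> 'b::ab_group_add \<Rightarrow> 'b"
    and bracket' and \<sigma>' :: "'n \<Rightarrow> 'b \<Rightarrow> 'b" and H' Basis'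
begin

abbreviation "ma \<equiv> (\<lambda>i. int (A.m i))"
abbreviation "mb \<equiv> (\<lambda>j. int (B.m j))"

definition iso :: "('a \<Rightarrow> 'b) \<Rightarrow> bool" where
  "iso \<phi> \<longleftrightarrow> algebra_iso scale bracket UNIV scale' bracket' UNIV \<phi>"

lemma isoD:
  assumes "iso \<phi>"
  shows iso_bij: "bij \<phi>" and iso_add: "\<phi> (x + y) = \<phi> x + \<phi> y" and iso_scale: "\<phi> (scale c x) = scale' c (\<phi> x)"
    and iso_bracket: "\<phi> (bracket x y) = bracket' (\<phi> x) (\<phi> y)"
  using assms by (auto simp: iso_def algebra_iso_def)

lemma iso_0: "iso \<phi> \<Longrightarrow> \<phi> 0 = 0"
  using iso_scale[of \<phi> 0 0] by simp

lemma iso_eq_iff: "iso \<phi> \<Longrightarrow> \<phi> x = \<phi> y \<longleftrightarrow> x = y"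
  using iso_bij by (metis bij_is_inj injD)

lemma iso_inv_apply: "iso \<phi> \<Longrightarrow> inv_into UNIV \<phi> (\<phi> x) = x" "iso \<phi> \<Longrightarrow> \<phi> (inv_into UNIV \<phi> y) = y"
  using iso_bij by (simp_all add: bij_is_inj bij_is_surj surj_f_inv_f)

definition twist :: "int^'n^'n \<Rightarrow> ('a \<Rightarrow> 'b) \<Rightarrow> bool" where
  "twist P \<phi> \<longleftrightarrow> iso \<phi> \<and> (\<forall>j v. \<sigma>' j (\<phi> v) = \<phi> (A.aprod (\<lambda>i. P $ i $ j) v))"

lemma twist_iff:
  "algebra_iso scale bracket UNIV scale' bracket' UNIV \<phi> \<and>
     (\<forall>j. \<sigma>' j = \<phi> \<circ> A.seq_power \<sigma> P j \<circ> inv_into UNIV \<phi>) \<longleftrightarrow> twist P \<phi>"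
proof -
  have "(\<sigma>' j = \<phi> \<circ> A.seq_power \<sigma> P j \<circ> inv_into UNIV \<phi>)
      \<longleftrightarrow> (\<forall>v. \<sigma>' j (\<phi> v) = \<phi> (A.aprod (\<lambda>i. P $ i $ j) v))" if i: "iso \<phi>" for j
  proof
    assume "\<sigma>' j = \<phi> \<circ> A.seq_power \<sigma> P j \<circ> inv_into UNIV \<phi>"
    then show "\<forall>v. \<sigma>' j (\<phi> v) = \<phi> (A.aprod (\<lambda>i. P $ i $ j) v)"
      by (simp add: A.seq_power_aprod iso_inv_apply[OF i])
  next
    assume *: "\<forall>v. \<sigma>' j (\<phi> v) = \<phi> (A.aprod (\<lambda>i. P $ i $ j) v)"
    show "\<sigma>' j = \<phi> \<circ> A.seq_power \<sigma> P j \<circ> inv_into UNIV \<phi>"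
    proof
      fix w
      show "\<sigma>' j w = (\<phi> \<circ> A.seq_power \<sigma> P j \<circ> inv_into UNIV \<phi>) w"
        using *[rule_format, of "inv_into UNIV \<phi> w"] by (simp add: A.seq_power_aprod iso_inv_apply[OF i])
    qed
  qed
  then show ?thesis by (auto simp: twist_def iso_def)
qed

lemma twist_eigen:
  assumes "twist P \<phi>" "x \<in> A.E l"
  shows "\<sigma>' j (\<phi> x) = scale' (A.char l (\<lambda>i. P $ i $ j)) (\<phi> x)"
  using assms by (simp add: twist_def A.aprod_E iso_scale)

lemma twist_aprod:
  assumes t: "twist P \<phi>"
  shows "B.aprod b (\<phi> v) = \<phi> (A.aprod (\<lambda>i. \<Sum>j\<in>UNIV. P $ i $ j * b j) v)"
proof -
  have i: "iso \<phi>" using t by (simp add: twist_def)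
  show ?thesis
  proof (rule A.eq_on_E[where s=scale' and S="\<lambda>v. B.aprod b (\<phi> v)"
        and T="\<lambda>v. \<phi> (A.aprod (\<lambda>i. \<Sum>j\<in>UNIV. P $ i $ j * b j) v)"])
    fix l x assume x: "x \<in> A.E l"
    have "B.aprod b (\<phi> x) = scale' (\<Prod>j\<in>UNIV. A.char l (\<lambda>i. P $ i $ j) powi b j) (\<phi> x)"
      by (rule B.aprod_eigen[OF twist_eigen[OF t x] A.char_nz])
    also have "(\<Prod>j\<in>UNIV. A.char l (\<lambda>i. P $ i $ j) powi b j) = A.char l (\<lambda>i. \<Sum>j\<in>UNIV. P $ i $ j * b j)"
      by (simp add: A.char_sum A.char_scale)
    also have "scale' \<dots> (\<phi> x) = \<phi> (A.aprod (\<lambda>i. \<Sum>j\<in>UNIV. P $ i $ j * b j) x)"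
      by (simp add: A.aprod_E[OF x] iso_scale[OF i])
    finally show "B.aprod b (\<phi> x) = \<phi> (A.aprod (\<lambda>i. \<Sum>j\<in>UNIV. P $ i $ j * b j) x)" .
  qed (simp_all add: iso_add[OF i] iso_scale[OF i] A.lin_add[OF A.lin_aprod] A.lin_scale[OF A.lin_aprod]
      B.lin_add[OF B.lin_aprod] B.lin_scale[OF B.lin_aprod])
qed

text \<open>As \<open>\<sigma>' j\<close> has order \<open>mb j\<close>, the exponent vector
  \<open>mb j\<close> times column \<open>j\<close> of \<open>P\<close> gives the identity, and
  \<open>A3\<close> makes its entries multiples of the orders.\<close>

lemma twist_dvd:
  assumes t: "twist P \<phi>"
  shows "ma i dvd mb j * P $ i $ j"
proof -
  have i: "iso \<phi>" using t by (simp add: twist_def)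
  have "(\<lambda>i. \<Sum>k\<in>UNIV. P $ i $ k * (if k = j then mb j else 0)) = (\<lambda>i. mb j * P $ i $ j)"
    by (simp add: if_distrib[of "\<lambda>x. _ * x"] mult.commute cong: if_cong)
  then have "\<phi> (A.aprod (\<lambda>i. mb j * P $ i $ j) v) = \<phi> v" for v
    using twist_aprod[OF t, of "\<lambda>k. if k = j then mb j else 0" v] by (simp add: B.aprod_period)
  then have "A.aprod (\<lambda>i. mb j * P $ i $ j) = id" by (auto simp: iso_eq_iff[OF i])
  then show ?thesis by (rule A.aprod_eq_id_imp_dvd)
qed

text \<open>The transpose of \<open>D^-1 P D'\<close>. For a twist the division is exact by
  \<open>twist_dvd\<close>.\<close>

definition dual :: "int^'n^'n \<Rightarrow> int^'n^'n" where
  "dual P = (\<chi> j i. (mb j * P $ i $ j) div ma i)"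

lemma scaled_dual: "twist P \<phi> \<Longrightarrow> scaled mb ma (dual P) P"
  using twist_dvd by (simp add: scaled_def dual_def)

text \<open>Divided by the respective orders, the exponents on the two sides agree factor by factor,
  and compatible roots of unity make the powers depend on these fractions only.\<close>

lemma scaled_char:
  assumes s: "scaled mb ma A P"
  shows "\<zeta> (B.m j) powi ((A *v l) $ j) = A.char l (\<lambda>i. P $ i $ j)"
proof -
  have sum: "finite I \<Longrightarrow> \<zeta> (B.m j) powi (\<Sum>i\<in>I. f i) = (\<Prod>i\<in>I. \<zeta> (B.m j) powi f i)" for I :: "'n set" and f
    by (induction I rule: finite_induct) (simp_all add: power_int_add B.\<zeta>_nz)
  have "\<zeta> (B.m j) powi ((A *v l) $ j) = (\<Prod>i\<in>UNIV. \<zeta> (B.m j) powi (A $ j $ i * l $ i))"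
    by (simp add: matrix_vector_mult_def sum)
  also have "\<dots> = (\<Prod>i\<in>UNIV. \<zeta> (A.m i) powi (l $ i * P $ i $ j))"
  proof (rule prod.cong[OF refl])
    fix i
    have "A $ j $ i * ma i = mb j * P $ i $ j" using s by (simp add: scaled_def)
    then have "A $ j $ i * l $ i * ma i = l $ i * P $ i $ j * mb j" by (simp add: mult.commute mult.left_commute)
    then show "\<zeta> (B.m j) powi (A $ j $ i * l $ i) = \<zeta> (A.m i) powi (l $ i * P $ i $ j)"
      by (rule primitive_root_powi_cross[OF A.roots B.m_pos A.m_pos])
  qed
  finally show ?thesis by (simp add: A.char_def)
qed

lemma twist_E: "twist P \<phi> \<Longrightarrow> x \<in> A.E l \<Longrightarrow> \<phi> x \<in> B.E (dual P *v l)"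
  by (simp add: B.E_iff twist_eigen scaled_char[OF scaled_dual])

lemma swap: "torus_pair scale' bracket' \<zeta> \<sigma>' H' Basis' scale bracket \<sigma> H Basis"
  by unfold_locales

lemma iso_inv: "iso \<phi> \<Longrightarrow> torus_pair.iso scale' bracket' scale bracket (inv_into UNIV \<phi>)"
proof -
  assume i: "iso \<phi>"
  have e: "inv_into UNIV \<phi> y = x \<longleftrightarrow> y = \<phi> x" for x y using iso_inv_apply[OF i] by metis
  show ?thesis
    unfolding torus_pair.iso_def[OF swap] algebra_iso_def
    by (auto simp: e isoD(2-4)[OF i] iso_inv_apply[OF i] intro!: bij_imp_bij_inv iso_bij[OF i])
qed

lemma twist_inv:
  assumes t: "twist P \<phi>" and PQ: "P ** Q = mat 1"
  shows "torus_pair.twist scale' bracket' \<sigma>' scale bracket \<sigma> Q (inv_into UNIV \<phi>)"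
proof -
  have i: "iso \<phi>" using t by (simp add: twist_def)
  have "\<sigma> k (inv_into UNIV \<phi> w) = inv_into UNIV \<phi> (B.aprod (\<lambda>j. Q $ j $ k) w)" for k w
  proof -
    obtain v where v: "w = \<phi> v" using iso_bij[OF i] by (metis bij_pointE)
    have "(\<Sum>j\<in>UNIV. P $ i $ j * Q $ j $ k) = (if i = k then 1 else 0)" for i
    proof -
      have "(\<Sum>j\<in>UNIV. P $ i $ j * Q $ j $ k) = (P ** Q) $ i $ k" by (simp add: matrix_matrix_mult_def)
      then show ?thesis by (simp add: PQ mat_def)
    qed
    then have "B.aprod (\<lambda>j. Q $ j $ k) (\<phi> v) = \<phi> (\<sigma> k v)"
      by (simp add: twist_aprod[OF t] A.aprod_unit)
    then show ?thesis by (simp add: v iso_inv_apply[OF i])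
  qed
  then show ?thesis using iso_inv[OF i] by (simp add: torus_pair.twist_def[OF swap])
qed

text \<open>By \<open>scaled_inverse\<close> the dual of \<open>Q\<close> inverts the dual of
  \<open>P\<close>. Applied to the inverse of \<open>\<phi>\<close>, it also yields the reverse
  inclusion of eigenspaces.\<close>

lemma twist_matrix:
  assumes t: "twist P \<phi>" and PQ: "P ** Q = mat 1" "Q ** P = mat 1"
  shows "\<exists>X X' :: int^'n^'n. X ** X' = mat 1 \<and> X' ** X = mat 1 \<and> (\<forall>l. \<phi> ` A.E l = B.E (X *v l))"
proof -
  have i: "iso \<phi>" using t by (simp add: twist_def)
  note t' = twist_inv[OF t PQ(1)]
  define X where "X = dual P"
  have s: "scaled mb ma X P" unfolding X_def by (rule scaled_dual[OF t])
  obtain X' where s': "scaled ma mb X' Q" and X': "\<And>y l. y \<in> B.E l \<Longrightarrow> inv_into UNIV \<phi> y \<in> A.E (X' *v l)"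
    using torus_pair.scaled_dual[OF swap t'] torus_pair.twist_E[OF swap t'] by metis
  have nz: "ma i \<noteq> 0" "mb i \<noteq> 0" for i using A.finite_order[of i] B.finite_order[of i] by auto
  have 1: "X ** X' = mat 1" by (rule scaled_inverse[OF s s' PQ(2) nz(2)])
  have 2: "X' ** X = mat 1" by (rule scaled_inverse[OF s' s PQ(1) nz(1)])
  have "\<phi> ` A.E l = B.E (X *v l)" for l
  proof (intro equalityI subsetI)
    fix y assume y: "y \<in> B.E (X *v l)"
    have "inv_into UNIV \<phi> y \<in> A.E (X' *v (X *v l))" by (rule X'[OF y])
    also have "X' *v (X *v l) = l" by (simp add: matrix_vector_mul_assoc 2)
    finally show "y \<in> \<phi> ` A.E l" by (rule rev_image_eqI) (rule iso_inv_apply(2)[OF i, symmetric])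
  next
    fix y assume "y \<in> \<phi> ` A.E l"
    then show "y \<in> B.E (X *v l)" using twist_E[OF t] by (auto simp: X_def)
  qed
  then show ?thesis using 1 2 by blast
qed

lemma twist_G:
  assumes t: "twist P \<phi>" and PQ: "P ** Q = mat 1" "Q ** P = mat 1"
  shows "\<phi> ` A.G = B.G"
proof -
  obtain X where "\<And>l. \<phi> ` A.E l = B.E (X *v l)" using twist_matrix[OF t PQ] by blast
  from this[of 0] show ?thesis by (simp add: A.E_0 B.E_0)
qed

lemma iso_span: "iso \<phi> \<Longrightarrow> \<phi> ` A.span S = B.span (\<phi> ` S)"
proof -
  assume i: "iso \<phi>"
  have "Vector_Spaces.linear scale scale' \<phi>"
    using A.vector_space_axioms B.vector_space_axioms isoD[OF i] by (simp add: Vector_Spaces.linear_iff)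
  then show ?thesis by (metis module_hom.span_image Vector_Spaces.linear.axioms(3))
qed

lemma iso_cartan:
  assumes i: "iso \<phi>" and G: "\<phi> ` A.G = B.G"
  shows "B.cartan_subalgebra B.G (\<phi> ` H)"
proof -
  have m: "\<phi> x \<in> \<phi> ` S \<longleftrightarrow> x \<in> S" for x S using iso_eq_iff[OF i] by auto
  have lc: "B.lower_central (\<phi> ` H) n = \<phi> ` A.lower_central H n" for n
  proof (induction n)
    case (Suc n)
    have "{bracket' x y | x y. x \<in> \<phi> ` H \<and> y \<in> \<phi> ` A.lower_central H n} = \<phi> ` {bracket x y | x y. x \<in> H \<and> y \<in> A.lower_central H n}"
      using iso_bracket[OF i] by (auto simp: image_iff) metis+
    then show ?case using Suc iso_span[OF i] by simp
  qed simp
  have C: "A.subalgebra H" "H \<subseteq> A.G" "A.nilpotent_lie H" "{x \<in> A.G. \<forall>y\<in>H. bracket x y \<in> H} = H"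
    using A.cartan by (auto simp: A.cartan_subalgebra_def)
  have norm: "{x \<in> B.G. \<forall>y\<in>\<phi> ` H. bracket' x y \<in> \<phi> ` H} = \<phi> ` {x \<in> A.G. \<forall>y\<in>H. bracket x y \<in> H}"
    unfolding G[symmetric] by (auto simp: iso_bracket[OF i, symmetric] m)
  obtain N where N: "A.lower_central H N = {0}" using C(3) by (auto simp: A.nilpotent_lie_def)
  have "B.nilpotent_lie (\<phi> ` H)"
    unfolding B.nilpotent_lie_def by (intro exI[of _ N]) (simp add: lc N iso_0[OF i])
  moreover have "B.subspace (\<phi> ` H)"
  proof -
    have "B.span (\<phi> ` H) = \<phi> ` H"
      using iso_span[OF i, of H] C(1) by (simp add: A.subalgebra_def A.span_eq_iff[THEN iffD2])
    then show ?thesis using B.subspace_span by metis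
  qed
  moreover have "\<forall>x\<in>\<phi> ` H. \<forall>y\<in>\<phi> ` H. bracket' x y \<in> \<phi> ` H"
    using C(1) by (auto simp: A.subalgebra_def iso_bracket[OF i, symmetric] m)
  moreover have "\<phi> ` H \<subseteq> B.G" using C(2) G by blast
  ultimately show ?thesis
    unfolding B.cartan_subalgebra_def B.subalgebra_def norm C(4) by blast
qed

text \<open>The image of \<open>H\<close> is some Cartan subalgebra of the fixed points of
  \<open>\<sigma>'\<close>. The automorphism conjugating it to \<open>H'\<close> commutes with
  \<open>\<sigma>'\<close>, so composing with it preserves \<open>twist P\<close>.\<close>

lemma twist_cartan:
  assumes t: "twist P \<phi>" and PQ: "P ** Q = mat 1" "Q ** P = mat 1"
  shows "\<exists>\<phi>'. twist P \<phi>' \<and> \<phi>' ` H = H'"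
proof -
  have i: "iso \<phi>" using t by (simp add: twist_def)
  obtain g where g: "B.equivariant_aut g" "g ` (\<phi> ` H) = H'"
    using B.cartan_conjugate[OF iso_cartan[OF i twist_G[OF t PQ]] B.cartan] by blast
  have "iso (\<lambda>x. g (\<phi> x))"
    using bij_comp[OF iso_bij[OF i] B.equivariant_aut_bij[OF g(1)]]
    by (auto simp: iso_def algebra_iso_def isoD(2-4)[OF i] B.equivariant_autD[OF g(1)] comp_def
        B.lin_add[OF B.equivariant_aut_lin[OF g(1)]] B.lin_scale[OF B.equivariant_aut_lin[OF g(1)]])
  moreover have "\<sigma>' j (g (\<phi> v)) = g (\<phi> (A.aprod (\<lambda>i. P $ i $ j) v))" for j v
    using t by (simp add: twist_def B.equivariant_aut_\<sigma>[OF g(1), symmetric])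
  ultimately show ?thesis using g(2) by (intro exI[of _ "\<lambda>x. g (\<phi> x)"]) (auto simp: twist_def image_image)
qed

end

section \<open>Graded isomorphisms\<close>

text \<open>An eigenspace of a map that commutes with the adjoint action is an ideal, and over an
  algebraically closed field some eigenspace is nonzero.\<close>

lemma (in fin_lie) schur_simple:
  assumes simple: "simple_lie UNIV" and T: "lin T" and c: "\<And>u v. T (bracket u v) = bracket u (T v)"
  shows "\<exists>c. \<forall>v. T v = c \<cdot> v"
proof -
  obtain x y where "bracket x y \<noteq> 0" using simple by (auto simp: simple_lie_def)
  then have x: "x \<noteq> 0" by (auto simp: bracket_0_left)
  have "\<exists>c v. v \<in> gen_eigenspace T c \<and> v \<noteq> 0"
  proof (rule ccontr)
    assume "\<not> ?thesis"
    then have "(\<Union>c. UNIV \<inter> gen_eigenspace T c) \<subseteq> {0}" by auto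
    then have "span (\<Union>c. UNIV \<inter> gen_eigenspace T c) \<subseteq> {0}" by (rule span_minimal) (rule subspace_single_0)
    then show False using gen_eigenspace_span[OF T subspace_UNIV, of x] x by auto
  qed
  then obtain c v where v: "v \<in> gen_eigenspace T c" "v \<noteq> 0" by blast
  have ex: "\<exists>n. (shift T c ^^ n) v = 0" using v by (simp add: gen_eigenspace_def)
  \<comment> \<open>The last nonzero iterate of a generalized eigenvector is an eigenvector.\<close>
  define n where "n = (LEAST n. (shift T c ^^ n) v = 0)"
  have n: "(shift T c ^^ n) v = 0" unfolding n_def by (rule LeastI_ex[OF ex])
  have "n \<noteq> 0" using n v(2) by (metis funpow_0)
  then obtain k where k: "n = Suc k" using not0_implies_Suc by blast
  let ?w = "(shift T c ^^ k) v"
  have "?w \<noteq> 0" using not_less_Least[of k "\<lambda>n. (shift T c ^^ n) v = 0"] k by (simp add: n_def)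
  moreover have "T ?w = c \<cdot> ?w" using n k by (simp add: shift_def)
  ultimately have w: "?w \<in> {v. T v = c \<cdot> v}" "?w \<noteq> 0" by auto
  have "lie_ideal UNIV {v. T v = c \<cdot> v}"
    by (auto simp: lie_ideal_def subspace_def lin_0[OF T] lin_add[OF T] lin_scale[OF T] c bracket_scale_right
        scale_right_distrib mult.commute)
  then have "{v. T v = c \<cdot> v} = {0} \<or> {v. T v = c \<cdot> v} = UNIV" using simple unfolding simple_lie_def by blast
  then have "{v. T v = c \<cdot> v} = UNIV" using w by blast
  then show ?thesis by blast
qed

context torus
begin

section \<open>Residue classes of degrees modulo the periods\<close>

definition box :: "(int^'n) set" where
  "box = {l. \<forall>j. 0 \<le> l $ j \<and> l $ j < int (m j)}"

definition red :: "int^'n \<Rightarrow> int^'n" where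
  "red l = vec_lambda (\<lambda>j. l $ j mod int (m j))"

lemma finite_box: "finite box"
proof (rule finite_subset)
  show "box \<subseteq> vec_lambda ` (\<Pi>\<^sub>E j\<in>UNIV. {0..<int (m j)})"
  proof
    fix l assume "l \<in> box"
    then show "l \<in> vec_lambda ` (\<Pi>\<^sub>E j\<in>UNIV. {0..<int (m j)})"
      by (intro image_eqI[of _ _ "vec_nth l"]) (auto simp: box_def)
  qed
  show "finite (vec_lambda ` (\<Pi>\<^sub>E j\<in>(UNIV::'n set). {0..<int (m j)}))"
    by (intro finite_imageI finite_PiE) auto
qed

lemma red_box: "red l \<in> box"
  using finite_order by (auto simp: red_def box_def)

lemma red_periods: "red l - l \<in> periods"
proof -
  have "int (m j) dvd l $ j mod int (m j) - l $ j" for j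
    by (simp add: mod_eq_dvd_iff[symmetric])
  then show ?thesis by (simp add: periods_def red_def)
qed

lemma E_red: "E (red l) = E l"
  by (rule E_periodic[OF red_periods])

lemma direct_E: "direct box E"
  unfolding direct_def
proof (intro conjI allI impI ballI finite_box subspace_E)
  fix c l assume c: "(\<forall>l\<in>box. c l \<in> E l) \<and> sum c box = 0" and l: "l \<in> box"
  show "c l = 0"
  proof (rule joint_gen_eigenspace_independent[where S=UNIV and F=\<sigma> and ev="\<lambda>l j. \<zeta> (m j) powi (l $ j)" and X=box])
    fix a b assume ab: "a \<in> box" "b \<in> box" "a \<noteq> b"
    then obtain j where j: "a $ j \<noteq> b $ j" by (auto simp: vec_eq_iff)
    have "\<zeta> (m j) powi (a $ j) \<noteq> \<zeta> (m j) powi (b $ j)"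
    proof
      assume "\<zeta> (m j) powi (a $ j) = \<zeta> (m j) powi (b $ j)"
      then have "\<zeta> (m j) powi (a $ j - b $ j) = 1" using \<zeta>_nz by (simp add: power_int_diff)
      then have "int (m j) dvd a $ j - b $ j" using primitive_root_powi_eq_1_iff[OF roots m_pos] by simp
      then have "a $ j mod int (m j) = b $ j mod int (m j)" by (simp add: mod_eq_dvd_iff)
      then show False using ab j by (simp add: box_def)
    qed
    then show "\<exists>j\<in>UNIV. \<zeta> (m j) powi (a $ j) \<noteq> \<zeta> (m j) powi (b $ j)" by blast
  qed (use c l in \<open>auto simp: finite_box lin_\<sigma> E_iff intro: eigen_in_gen_eigenspace\<close>)
qed

lemma box_span: "v \<in> span (\<Union>l\<in>box. E l)"
proof -
  have "(\<Union>l. E l) \<subseteq> (\<Union>l\<in>box. E l)" using E_red red_box by blast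
  then show ?thesis using E_span span_mono by blast
qed

text \<open>The algebra is the direct sum of the \<open>E l\<close> over the representatives in
  \<open>box\<close>, so maps given degree by degree glue as soon as congruent degrees carry the
  same map.\<close>

lemma graded_extend:
  fixes t :: "int^'n \<Rightarrow> 'a \<Rightarrow> 'b::ab_group_add" and s :: "'k \<Rightarrow> 'b \<Rightarrow> 'b"
  assumes add: "\<And>l x y. x \<in> E l \<Longrightarrow> y \<in> E l \<Longrightarrow> t l (x + y) = t l x + t l y"
    and sc: "\<And>l c x. x \<in> E l \<Longrightarrow> t l (c \<cdot> x) = s c (t l x)"
    and s: "\<And>c u v. s c (u + v) = s c u + s c v"
    and per: "\<And>l l' x. l' - l \<in> periods \<Longrightarrow> x \<in> E l \<Longrightarrow> t l' x = t l x"
  shows "\<exists>T. (\<forall>x y. T (x + y) = T x + T y) \<and> (\<forall>c x. T (c \<cdot> x) = s c (T x)) \<and> (\<forall>l. \<forall>x\<in>E l. T x = t l x)"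
proof -
  let ?c = "component box E"
  define T where "T x = (\<Sum>l\<in>box. t l (?c l x))" for x
  have s0: "s c 0 = 0" for c using s[of c 0 0] by simp
  have ss: "s c (sum g A) = (\<Sum>a\<in>A. s c (g a))" for c g and A :: "(int^'n) set"
    by (induction A rule: infinite_finite_induct) (simp_all add: s0 s)
  have t0: "t l 0 = 0" for l using add[of 0 l 0] subspace_0[OF subspace_E] by simp
  have cE: "l \<in> box \<Longrightarrow> ?c l x \<in> E l" for l x by (rule component_in[OF direct_E box_span])
  have "T (x + y) = T x + T y" for x y
    by (simp add: T_def component_add[OF direct_E box_span box_span] add cE sum.distrib)
  moreover have "T (c \<cdot> x) = s c (T x)" for c x
    by (simp add: T_def component_scale[OF direct_E box_span] sc cE ss)
  moreover have "T x = t l x" if x: "x \<in> E l" for l x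
  proof -
    have xr: "x \<in> E (red l)" using x by (simp add: E_red)
    have "T x = (\<Sum>k\<in>box. if k = red l then t k x else 0)"
      unfolding T_def by (intro sum.cong refl) (simp add: component_of_mem[OF direct_E, OF red_box xr] t0)
    also have "\<dots> = t (red l) x" using finite_box red_box by simp
    also have "\<dots> = t l x" by (rule per[OF red_periods x])
    finally show ?thesis .
  qed
  ultimately show ?thesis by blast
qed

lemma E_nonzero: "\<exists>l x. x \<in> E l \<and> x \<noteq> 0"
proof (rule ccontr)
  assume "\<not> ?thesis"
  then have "(\<Union>l. E l) \<subseteq> {0}" by auto
  then have "span (\<Union>l. E l) \<subseteq> {0}" by (rule span_minimal) (rule subspace_single_0)
  then have "v = 0" for v :: 'a using E_span by blast
  moreover obtain x y where "bracket x y \<noteq> 0" using simple_fixed by (auto simp: simple_lie_def)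
  ultimately show False by blast
qed

end

context torus_pair
begin

text \<open>The degreewise form of a bi-isomorphism, sending \<open>x \<otimes> z^l\<close> to
  \<open>f l x \<otimes> z^(e l)\<close>. Congruent degrees share \<open>E l\<close> but may carry
  different maps, hence the argument \<open>l\<close> of \<open>f\<close>; the lemmas below remove
  this dependence.\<close>

definition graded_map :: "(int^'n \<Rightarrow> int^'n) \<Rightarrow> (int^'n \<Rightarrow> 'a \<Rightarrow> 'b) \<Rightarrow> bool" where
  "graded_map e f \<longleftrightarrow> bij e \<and> (\<forall>l l'. e (l + l') = e l + e l') \<and> (\<forall>l. f l ` A.E l = B.E (e l)) \<and>
     (\<forall>l. \<forall>x\<in>A.E l. f l x = 0 \<longrightarrow> x = 0) \<and>
     (\<forall>l. \<forall>x\<in>A.E l. \<forall>y\<in>A.E l. f l (x + y) = f l x + f l y) \<and>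
     (\<forall>l c. \<forall>x\<in>A.E l. f l (scale c x) = scale' c (f l x)) \<and>
     (\<forall>l l'. \<forall>x\<in>A.E l. \<forall>y\<in>A.E l'. f (l + l') (bracket x y) = bracket' (f l x) (f l' y))"

lemma graded_mapD:
  assumes "graded_map e f"
  shows "bij e" "e (l + l') = e l + e l'" "f l ` A.E l = B.E (e l)"
    "x \<in> A.E l \<Longrightarrow> f l x = 0 \<Longrightarrow> x = 0"
    "x \<in> A.E l \<Longrightarrow> y \<in> A.E l \<Longrightarrow> f l (x + y) = f l x + f l y"
    "x \<in> A.E l \<Longrightarrow> f l (scale c x) = scale' c (f l x)"
    "x \<in> A.E l \<Longrightarrow> y \<in> A.E l' \<Longrightarrow> f (l + l') (bracket x y) = bracket' (f l x) (f l' y)"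
    "x \<in> A.E l \<Longrightarrow> f l x \<in> B.E (e l)"
  using assms unfolding graded_map_def by auto (metis imageI)

lemma graded_map_inj: "graded_map e f \<Longrightarrow> x \<in> A.E l \<Longrightarrow> y \<in> A.E l \<Longrightarrow> f l x = f l y \<Longrightarrow> x = y"
proof -
  assume g: "graded_map e f" and x: "x \<in> A.E l" and y: "y \<in> A.E l" and e: "f l x = f l y"
  have d: "x - y \<in> A.E l" by (rule A.subspace_diff[OF A.subspace_E x y])
  have "f l (x - y) + f l y = f l x" using graded_mapD(5)[OF g d y] by simp
  then have "f l (x - y) = 0" using e by simp
  then show "x = y" using graded_mapD(4)[OF g d] by simp
qed

lemma graded_map_preimage:
  assumes g: "graded_map e f" and y: "y \<in> B.E l'"
  shows "\<exists>x\<in>A.E (inv_into UNIV e l'). f (inv_into UNIV e l') x = y"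
proof -
  have "e (inv_into UNIV e l') = l'" using graded_mapD(1)[OF g] by (simp add: bij_is_surj surj_f_inv_f)
  then have "y \<in> f (inv_into UNIV e l') ` A.E (inv_into UNIV e l')" using graded_mapD(3)[OF g] y by simp
  then show ?thesis by blast
qed

lemma graded_map_inv:
  assumes g: "graded_map e f"
  shows "\<exists>h. torus_pair.graded_map scale' bracket' \<zeta> \<sigma>' scale bracket \<sigma> (inv_into UNIV e) h \<and>
    (\<forall>l. \<forall>x\<in>A.E l. h (e l) (f l x) = x)"
proof -
  let ?i = "inv_into UNIV e"
  have ie: "?i (e l) = l" "e (?i l') = l'" for l l'
    using graded_mapD(1)[OF g] by (simp_all add: bij_is_inj bij_is_surj surj_f_inv_f)
  define h where "h l' y = (SOME x. x \<in> A.E (?i l') \<and> f (?i l') x = y)" for l' y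
  have h: "h l' y \<in> A.E (?i l')" "f (?i l') (h l' y) = y" if "y \<in> B.E l'" for l' y
    using someI_ex[of "\<lambda>x. x \<in> A.E (?i l') \<and> f (?i l') x = y"] graded_map_preimage[OF g that] unfolding h_def by blast+
  have hf: "h (e l) (f l x) = x" if x: "x \<in> A.E l" for l x
    using h[OF graded_mapD(8)[OF g x]] graded_map_inj[OF g _ x] by (simp add: ie)
  have iadd: "?i (l + l') = ?i l + ?i l'" for l l'
  proof -
    have "e (?i l + ?i l') = l + l'" by (simp add: graded_mapD(2)[OF g] ie)
    then show ?thesis by (metis ie(1))
  qed
  have "torus_pair.graded_map scale' bracket' \<zeta> \<sigma>' scale bracket \<sigma> ?i h"
    unfolding torus_pair.graded_map_def[OF swap]
  proof (intro conjI allI ballI impI)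
    show "bij ?i" by (rule bij_imp_bij_inv[OF graded_mapD(1)[OF g]])
    show "?i (l + l') = ?i l + ?i l'" for l l' by (rule iadd)
    show "h l ` B.E l = A.E (?i l)" for l
    proof (intro equalityI subsetI)
      fix x assume x: "x \<in> A.E (?i l)"
      have "f (?i l) x \<in> B.E l" using graded_mapD(8)[OF g x] by (simp add: ie)
      moreover have "x = h l (f (?i l) x)" using hf[OF x] by (simp add: ie)
      ultimately show "x \<in> h l ` B.E l" by blast
    qed (use h in auto)
  next
    fix l y assume y: "y \<in> B.E l" "h l y = 0"
    have "f (?i l) 0 = 0" using graded_mapD(5)[OF g, of 0 "?i l" 0] A.subspace_0[OF A.subspace_E] by simp
    then show "y = 0" using h[OF y(1)] y(2) by simp
  next
    fix l y z assume yz: "y \<in> B.E l" "z \<in> B.E l"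
    show "h l (y + z) = h l y + h l z"
      by (rule graded_map_inj[OF g h(1)[OF B.subspace_add[OF B.subspace_E yz]] A.subspace_add[OF A.subspace_E h(1)[OF yz(1)] h(1)[OF yz(2)]]])
        (simp add: h yz B.subspace_add[OF B.subspace_E yz] graded_mapD(5)[OF g])
  next
    fix l c y assume y: "y \<in> B.E l"
    show "h l (scale' c y) = scale c (h l y)"
      by (rule graded_map_inj[OF g h(1)[OF B.subspace_scale[OF B.subspace_E y]] A.subspace_scale[OF A.subspace_E h(1)[OF y]]])
        (simp add: h y B.subspace_scale[OF B.subspace_E y] graded_mapD(6)[OF g])
  next
    fix l k y z assume y: "y \<in> B.E l" and z: "z \<in> B.E k"
    have m: "bracket (h l y) (h k z) \<in> A.E (?i (l + k))" unfolding iadd by (rule A.E_bracket[OF h(1)[OF y] h(1)[OF z]])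
    show "h (l + k) (bracket' y z) = bracket (h l y) (h k z)"
    proof (rule graded_map_inj[OF g h(1)[OF B.E_bracket[OF y z]] m])
      show "f (?i (l + k)) (h (l + k) (bracket' y z)) = f (?i (l + k)) (bracket (h l y) (h k z))"
        using graded_mapD(7)[OF g h(1)[OF y] h(1)[OF z]] h(2)[OF B.E_bracket[OF y z]] h(2)[OF y] h(2)[OF z] by (simp add: iadd)
    qed
  qed
  then show ?thesis using hf by blast
qed

text \<open>Multiplication by \<open>z\<^sup>\<gamma>\<close> lies in the centroid. Transported along \<open>f\<close> it becomes a homogeneous
  map of degree \<open>e \<gamma>\<close> commuting with the adjoint action; as \<open>B\<close> is centreless it is periodic, hence
  induces a map in the centroid of the simple algebra \<open>B\<close>, which is a scalar.\<close>

lemma graded_map_period: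
  assumes g: "graded_map e f" and \<gamma>: "\<gamma> \<in> A.periods"
  shows "\<exists>c. c \<noteq> 0 \<and> e \<gamma> \<in> B.periods \<and> (\<forall>l. \<forall>x\<in>A.E l. f (l + \<gamma>) x = scale' c (f l x))"
proof -
  let ?i = "inv_into UNIV e"
  obtain h where h: "torus_pair.graded_map scale' bracket' \<zeta> \<sigma>' scale bracket \<sigma> ?i h"
    and hf: "\<And>l x. x \<in> A.E l \<Longrightarrow> h (e l) (f l x) = x" using graded_map_inv[OF g] by blast
  note hD = torus_pair.graded_mapD[OF swap h]
  have ie: "?i (e l) = l" "e (?i l') = l'" for l l'
    using graded_mapD(1)[OF g] by (simp_all add: bij_is_inj bij_is_surj surj_f_inv_f)
  have E\<gamma>: "A.E (l + \<gamma>) = A.E l" for l by (rule A.E_periodic) (use \<gamma> in simp)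
  define t where "t l' y = f (?i l' + \<gamma>) (h l' y)" for l' y
  have hE: "y \<in> B.E l' \<Longrightarrow> h l' y \<in> A.E (?i l' + \<gamma>)" for y l' using hD(8) E\<gamma> by blast
  have fh: "f (?i l') (h l' y) = y" if y: "y \<in> B.E l'" for l' y
  proof -
    obtain x where x: "x \<in> A.E (?i l')" "f (?i l') x = y" using graded_map_preimage[OF g y] by blast
    have "h l' y = x" using hf[OF x(1)] x(2) by (simp add: ie)
    then show ?thesis using x by simp
  qed
  have key: "t (l' + k') (bracket' u y) = bracket' u (t k' y)" if u: "u \<in> B.E l'" and y: "y \<in> B.E k'" for l' k' u y
  proof -
    have "t (l' + k') (bracket' u y) = f (?i l' + (?i k' + \<gamma>)) (bracket (h l' u) (h k' y))"
      unfolding t_def using hD(7)[OF u y] hD(2)[of l' k'] by (simp add: add.assoc)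
    also have "\<dots> = bracket' (f (?i l') (h l' u)) (t k' y)"
      unfolding t_def by (rule graded_mapD(7)[OF g hD(8)[OF u] hE[OF y]])
    finally show ?thesis by (simp add: fh[OF u])
  qed
  have per: "t l' y = t k' y" if d: "l' - k' \<in> B.periods" and y: "y \<in> B.E k'" for l' k' y
  proof -
    have y': "y \<in> B.E l'" using B.E_periodic[OF d] y by simp
    let ?D = "t l' y - t k' y"
    have "bracket' u ?D = 0" if u: "u \<in> B.E j" for j u
    proof -
      have u': "u \<in> B.E (j + (l' - k'))" using B.E_periodic[of "j + (l' - k')" j] d u by simp
      have "bracket' u (t l' y) = t (j + l') (bracket' u y)" by (rule key[OF u y', symmetric])
      also have "j + l' = (j + (l' - k')) + k'" by simp
      also have "t \<dots> (bracket' u y) = bracket' u (t k' y)" by (rule key[OF u' y])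
      finally show ?thesis by (simp add: B.bracket_diff_right)
    qed
    then have "(\<Union>j. B.E j) \<subseteq> {u. bracket' u ?D \<in> {0}}" by auto
    then have "B.span (\<Union>j. B.E j) \<subseteq> {u. bracket' u ?D \<in> {0}}"
      by (rule B.span_minimal) (intro B.subspace_lin_vimage B.lin_ad_left B.subspace_single_0)
    then have "bracket' u ?D = 0" for u using B.E_span by blast
    then have "bracket' ?D u = 0" for u using B.bracket_swap[of ?D u] by simp
    then have "?D = 0" by (rule B.simple_center[OF B.simple UNIV_I])
    then show ?thesis by simp
  qed
  have "\<exists>T. (\<forall>x y. T (x + y) = T x + T y) \<and> (\<forall>c x. T (scale' c x) = scale' c (T x)) \<and> (\<forall>l. \<forall>x\<in>B.E l. T x = t l x)"
  proof (rule B.graded_extend)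
    show "t l (x + y) = t l x + t l y" if "x \<in> B.E l" "y \<in> B.E l" for l x y
      unfolding t_def using hD(5)[OF that] graded_mapD(5)[OF g hE[OF that(1)] hE[OF that(2)]] by simp
    show "t l (scale' c x) = scale' c (t l x)" if "x \<in> B.E l" for l c x
      unfolding t_def using hD(6)[OF that] graded_mapD(6)[OF g hE[OF that]] by simp
    show "scale' c (u + v) = scale' c u + scale' c v" for c u v by (rule B.scale_right_distrib)
  qed (rule per)
  then obtain T where T: "B.lin T" "\<And>l x. x \<in> B.E l \<Longrightarrow> T x = t l x" using B.linI by metis
  have "T (bracket' u v) = bracket' u (T v)" for u v
  proof -
    have 1: "T (bracket' u y) = bracket' u (T y)" if u: "u \<in> B.E l" and y: "y \<in> B.E k" for u y l k
      using T(2)[OF B.E_bracket[OF u y]] T(2)[OF y] key[OF u y] by simp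
    have 2: "T (bracket' u y) = bracket' u (T y)" if y: "y \<in> B.E k" for u y k
    proof -
      have "(\<lambda>u. T (bracket' u y)) = (\<lambda>u. bracket' u (T y))"
        by (rule B.lin_eq_on_E) (rule B.lin_compose[OF T(1) B.lin_ad_left] B.lin_ad_left 1[OF _ y] | assumption)+
      then show ?thesis by (rule fun_cong)
    qed
    have "(\<lambda>v. T (bracket' u v)) = (\<lambda>v. bracket' u (T v))"
      by (rule B.lin_eq_on_E) (rule B.lin_compose[OF T(1) B.lin_ad] B.lin_compose[OF B.lin_ad T(1)] 2 | assumption)+
    then show ?thesis by (rule fun_cong)
  qed
  from B.schur_simple[OF B.simple T(1) this] obtain c where c: "\<And>v. T v = scale' c v" by blast
  have fc: "f (l + \<gamma>) x = scale' c (f l x)" if x: "x \<in> A.E l" for l x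
  proof -
    have "f (l + \<gamma>) x = t (e l) (f l x)" unfolding t_def by (simp add: ie hf[OF x])
    also have "\<dots> = T (f l x)" by (rule T(2)[OF graded_mapD(8)[OF g x], symmetric])
    finally show ?thesis by (simp add: c)
  qed
  \<comment> \<open>A nonzero homogeneous vector shows that \<open>c\<close> is nonzero. Its image
    is nonzero and lies in the degrees \<open>e l\<close> and \<open>e l + e \<gamma>\<close>, so
    \<open>e \<gamma>\<close> is a period.\<close>
  obtain l x where x: "x \<in> A.E l" "x \<noteq> 0" using A.E_nonzero by blast
  have x': "x \<in> A.E (l + \<gamma>)" using x E\<gamma> by simp
  have nz: "f (l + \<gamma>) x \<noteq> 0" using graded_mapD(4)[OF g x'] x(2) by blast
  then have c0: "c \<noteq> 0" using fc[OF x(1)] by auto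
  have "f (l + \<gamma>) x \<in> B.E (e l)" unfolding fc[OF x(1)] by (rule B.subspace_scale[OF B.subspace_E graded_mapD(8)[OF g x(1)]])
  moreover have "f (l + \<gamma>) x \<in> B.E (e l + e \<gamma>)" using graded_mapD(8)[OF g x'] by (simp add: graded_mapD(2)[OF g])
  ultimately have "e \<gamma> \<in> B.periods" using B.E_Int[OF _ _ nz] by fastforce
  then show ?thesis using c0 fc by blast
qed

end

section \<open>Additive maps as matrices, and generators of the period lattice\<close>

lemma additive_int_vec:
  fixes e :: "int^'n::finite \<Rightarrow> int^'n"
  assumes add: "\<And>l l'. e (l + l') = e l + e l'"
  shows "e l = (\<chi> j i. e (axis i 1) $ j) *v l"
proof -
  have e0: "e 0 = 0" using add[of 0 0] by simp
  have neg: "e (- v) = - e v" for v using add[of v "- v"] e0 by (simp add: eq_neg_iff_add_eq_0 add.commute)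
  have nat: "e (of_nat n *s v) = of_nat n *s e v" for n v
  proof (induction n)
    case 0
    have "0 *s v = 0" for v :: "int^'n" by (simp add: vec_eq_iff)
    then show ?case by (simp add: e0)
  next
    case (Suc n)
    have "of_nat (Suc n) *s v = v + of_nat n *s v" for v :: "int^'n" by (simp add: vec_eq_iff algebra_simps)
    then show ?case using Suc add by (simp only:)
  qed
  have sc: "e (q *s v) = q *s e v" for q v
  proof (cases "q \<ge> 0")
    case True
    then show ?thesis using nat[of "nat q" v] by simp
  next
    case False
    have "(- q) *s v = - (q *s v)" for v :: "int^'n" by (simp add: vec_eq_iff)
    then have "e (- (q *s v)) = - (q *s e v)" using nat[of "nat (- q)" v] False by simp
    then show ?thesis by (simp add: neg)
  qed
  have sum: "e (\<Sum>i\<in>I. g i) = (\<Sum>i\<in>I. e (g i))" for g and I :: "'n set"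
    by (induction I rule: infinite_finite_induct) (simp_all add: e0 add)
  have "l = (\<Sum>i\<in>UNIV. (l $ i) *s axis i 1)" by (simp add: basis_expansion)
  then have "e l = (\<Sum>i\<in>UNIV. (l $ i) *s e (axis i 1))" by (metis (no_types, lifting) sc sum sum.cong)
  then show ?thesis by (simp add: vec_eq_iff matrix_vector_mult_def mult.commute)
qed

context torus
begin

lemma periods_induct:
  assumes \<gamma>: "\<gamma> \<in> periods" and add: "\<And>a b. Q a \<Longrightarrow> Q b \<Longrightarrow> Q (a + b)" and neg: "\<And>a. Q a \<Longrightarrow> Q (- a)"
    and unit: "\<And>j. Q (axis j (int (m j)))" and zero: "Q 0"
  shows "Q \<gamma>"
proof -
  have nat: "Q (axis j (int (m j) * int q))" for j q
  proof (induction q)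
    case 0
    then show ?case using zero by (simp add: axis_def zero_vec_def)
  next
    case (Suc q)
    have "axis j (int (m j) * int (Suc q)) = axis j (int (m j)) + axis j (int (m j) * int q)"
      by (simp add: vec_eq_iff axis_def algebra_simps)
    then show ?case using add[OF unit Suc] by simp
  qed
  have int: "Q (axis j (int (m j) * q))" for j q
  proof (cases "q \<ge> 0")
    case True
    then show ?thesis using nat[of j "nat q"] by simp
  next
    case False
    have "axis j (int (m j) * q) = - axis j (int (m j) * int (nat (- q)))"
      using False by (simp add: vec_eq_iff axis_def)
    then show ?thesis using neg[OF nat[of j "nat (- q)"]] by (simp only:)
  qed
  have "Q (\<Sum>j\<in>J. axis j (\<gamma> $ j))" if "finite J" for J
    using that
  proof (induction J rule: finite_induct)
    case (insert j J)
    obtain q where "\<gamma> $ j = int (m j) * q" using \<gamma> by (auto simp: periods_def dvd_def)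
    then show ?case using insert add[OF int[of j q]] by simp
  qed (simp add: zero)
  moreover have "(\<Sum>j\<in>UNIV. axis j (\<gamma> $ j)) = \<gamma>" by (simp add: vec_eq_iff axis_def)
  ultimately show ?thesis by (metis finite_UNIV finite)
qed

end

context torus_pair
begin

text \<open>The scalars of \<open>graded_map_period\<close> form a character of the period lattice; extending it to \<open>int^'n\<close>
  by taking roots and dividing it out makes \<open>f\<close> periodic.\<close>

lemma graded_map_normalize:
  assumes g: "graded_map e f"
  shows "\<exists>F. graded_map e F \<and> (\<forall>\<gamma>\<in>A.periods. \<forall>l. \<forall>x\<in>A.E l. F (l + \<gamma>) x = F l x)"
proof -
  have ax: "axis j (ma j) \<in> A.periods" for j by (simp add: A.periods_def axis_def)
  have "\<forall>j. \<exists>c. c \<noteq> 0 \<and> (\<forall>l. \<forall>x\<in>A.E l. f (l + axis j (ma j)) x = scale' c (f l x))"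
    using graded_map_period[OF g ax] by blast
  then obtain c where c: "\<And>j. c j \<noteq> 0" "\<And>j l x. x \<in> A.E l \<Longrightarrow> f (l + axis j (ma j)) x = scale' (c j) (f l x)"
    by metis
  have "\<forall>j. \<exists>r. r ^ A.m j = c j" using nth_root_exists[of "A.m j" for j] A.finite_order by blast
  then obtain r where r: "\<And>j. r j ^ A.m j = c j" by metis
  have rnz: "r j \<noteq> 0" for j using r[of j] c(1)[of j] A.finite_order[of j] by (auto simp: power_0_left)
  define \<eta> where "\<eta> l = (\<Prod>j\<in>UNIV. r j powi (l $ j))" for l :: "int^'n"
  have \<eta>nz: "\<eta> l \<noteq> 0" for l using rnz by (simp add: \<eta>_def)
  have \<eta>add: "\<eta> (l + l') = \<eta> l * \<eta> l'" for l l'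
    by (simp add: \<eta>_def power_int_add rnz prod.distrib)
  have \<eta>ax: "\<eta> (axis j (ma j)) = c j" for j
  proof -
    have "\<eta> (axis j (ma j)) = (\<Prod>i\<in>UNIV. if i = j then c j else 1)"
      unfolding \<eta>_def by (intro prod.cong refl) (auto simp: axis_def r)
    then show ?thesis by simp
  qed
  define F where "F l x = scale' (inverse (\<eta> l)) (f l x)" for l x
  have "graded_map e F"
    unfolding graded_map_def
  proof (intro conjI allI ballI impI)
    fix l
    show "F l ` A.E l = B.E (e l)"
    proof (intro equalityI subsetI)
      fix y assume y: "y \<in> B.E (e l)"
      have "scale' (\<eta> l) y \<in> B.E (e l)" by (rule B.subspace_scale[OF B.subspace_E y])
      then obtain x where x: "x \<in> A.E l" "f l x = scale' (\<eta> l) y" using graded_mapD(3)[OF g, of l] by (metis imageE)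
      then have "F l x = y" using \<eta>nz[of l] by (simp add: F_def)
      then show "y \<in> F l ` A.E l" using x(1) by blast
    qed (auto simp: F_def intro: B.subspace_scale[OF B.subspace_E] graded_mapD(8)[OF g])
  qed (use g \<eta>nz in \<open>auto simp: F_def graded_mapD[OF g] B.scale_right_distrib \<eta>add B.bracket_scale_left
      B.bracket_scale_right mult.commute intro: graded_mapD(4)[OF g]\<close>)
  moreover have "\<forall>l. \<forall>x\<in>A.E l. F (l + \<gamma>) x = F l x" if \<gamma>: "\<gamma> \<in> A.periods" for \<gamma>
  proof -
    \<comment> \<open>Membership in \<open>A.periods\<close> is carried through the induction,
      because \<open>F\<close> is evaluated at \<open>x\<close> in shifted degrees, where
      \<open>x \<in> A.E (l + a)\<close> is required.\<close>
    have "\<gamma> \<in> A.periods \<and> (\<forall>l. \<forall>x\<in>A.E l. F (l + \<gamma>) x = F l x)"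
    proof (rule A.periods_induct[OF \<gamma>])
      fix a b assume a: "a \<in> A.periods \<and> (\<forall>l. \<forall>x\<in>A.E l. F (l + a) x = F l x)"
        and b: "b \<in> A.periods \<and> (\<forall>l. \<forall>x\<in>A.E l. F (l + b) x = F l x)"
      have "F (l + (a + b)) x = F l x" if x: "x \<in> A.E l" for l x
      proof -
        have "x \<in> A.E (l + a)" using x a A.E_periodic[of "l + a" l] by simp
        then show ?thesis using a b x by (simp add: add.assoc[symmetric])
      qed
      then show "a + b \<in> A.periods \<and> (\<forall>l. \<forall>x\<in>A.E l. F (l + (a + b)) x = F l x)"
        using a b by (simp add: A.periods_def)
    next
      fix a assume a: "a \<in> A.periods \<and> (\<forall>l. \<forall>x\<in>A.E l. F (l + a) x = F l x)"
      have na: "- a \<in> A.periods" using a by (simp add: A.periods_def)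
      have "F (l + (- a)) x = F l x" if x: "x \<in> A.E l" for l x
      proof -
        have "x \<in> A.E (l + (- a))" using x na A.E_periodic[of "l + (- a)" l] by simp
        then have "F (l + (- a) + a) x = F (l + (- a)) x" using a by blast
        then show ?thesis by simp
      qed
      then show "- a \<in> A.periods \<and> (\<forall>l. \<forall>x\<in>A.E l. F (l + - a) x = F l x)" using na by blast
    next
      fix j
      show "axis j (ma j) \<in> A.periods \<and> (\<forall>l. \<forall>x\<in>A.E l. F (l + axis j (ma j)) x = F l x)"
        using ax c by (simp add: F_def \<eta>add \<eta>ax)
    qed (simp add: A.periods_def)
    then show ?thesis by blast
  qed
  ultimately show ?thesis by blast
qed

text \<open>After normalization the degreewise maps glue to a map on the whole algebra. It is
  injective because its kernel is a proper ideal, and onto because its image contains every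
  eigenspace.\<close>

lemma graded_map_iso:
  assumes g: "graded_map e f"
  shows "\<exists>\<phi>. iso \<phi> \<and> (\<forall>l. \<forall>x\<in>A.E l. \<phi> x \<in> B.E (e l))"
proof -
  obtain F where F: "graded_map e F" and per: "\<And>\<gamma> l x. \<gamma> \<in> A.periods \<Longrightarrow> x \<in> A.E l \<Longrightarrow> F (l + \<gamma>) x = F l x"
    using graded_map_normalize[OF g] by blast
  have "\<exists>T. (\<forall>x y. T (x + y) = T x + T y) \<and> (\<forall>c x. T (scale c x) = scale' c (T x)) \<and> (\<forall>l. \<forall>x\<in>A.E l. T x = F l x)"
  proof (rule A.graded_extend)
    show "F l' x = F l x" if "l' - l \<in> A.periods" "x \<in> A.E l" for l l' x
      using per[OF that] by simp
  qed (simp_all add: graded_mapD(5,6)[OF F] B.scale_right_distrib)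
  then obtain \<phi> where \<phi>: "\<And>x y. \<phi> (x + y) = \<phi> x + \<phi> y" "\<And>c x. \<phi> (scale c x) = scale' c (\<phi> x)"
    "\<And>l x. x \<in> A.E l \<Longrightarrow> \<phi> x = F l x" by metis
  have br: "\<phi> (bracket x y) = bracket' (\<phi> x) (\<phi> y)" for x y
  proof -
    have 1: "\<phi> (bracket x y) = bracket' (\<phi> x) (\<phi> y)" if x: "x \<in> A.E l" and y: "y \<in> A.E k" for x y l k
      using \<phi>(3)[OF A.E_bracket[OF x y]] \<phi>(3)[OF x] \<phi>(3)[OF y] graded_mapD(7)[OF F x y] by simp
    have 2: "\<phi> (bracket x y) = bracket' (\<phi> x) (\<phi> y)" if y: "y \<in> A.E k" for x y k
      by (rule A.eq_on_E[where S="\<lambda>x. \<phi> (bracket x y)" and T="\<lambda>x. bracket' (\<phi> x) (\<phi> y)" and s=scale'])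
        (simp_all add: \<phi>(1,2) A.bracket_add_left A.bracket_scale_left B.bracket_add_left B.bracket_scale_left 1[OF _ y])
    show ?thesis
      by (rule A.eq_on_E[where S="\<lambda>y. \<phi> (bracket x y)" and T="\<lambda>y. bracket' (\<phi> x) (\<phi> y)" and s=scale'])
        (simp_all add: \<phi>(1,2) A.bracket_add_right A.bracket_scale_right B.bracket_add_right B.bracket_scale_right 2)
  qed
  have \<phi>0: "\<phi> 0 = 0" using \<phi>(1)[of 0 0] by simp
  have "A.lie_ideal UNIV {x. \<phi> x = 0}"
    by (auto simp: A.lie_ideal_def A.subspace_def \<phi>0 \<phi>(1,2) br B.bracket_0_right)
  then have "{x. \<phi> x = 0} = {0} \<or> {x. \<phi> x = 0} = UNIV" using A.simple unfolding A.simple_lie_def by blast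
  moreover have "{x. \<phi> x = 0} \<noteq> UNIV"
  proof
    assume z: "{x. \<phi> x = 0} = UNIV"
    obtain l x where x: "x \<in> A.E l" "x \<noteq> 0" using A.E_nonzero by blast
    have "\<phi> x = 0" using z by blast
    then have "F l x = 0" using \<phi>(3)[OF x(1)] by simp
    then show False using graded_mapD(4)[OF F x(1)] x(2) by blast
  qed
  ultimately have ker: "{x. \<phi> x = 0} = {0}" by blast
  have "inj \<phi>"
  proof (rule injI)
    fix x y assume "\<phi> x = \<phi> y"
    moreover have "\<phi> (x - y) + \<phi> y = \<phi> x" using \<phi>(1)[of "x - y" y] by simp
    ultimately have "x - y \<in> {x. \<phi> x = 0}" by simp
    then show "x = y" unfolding ker by simp
  qed
  moreover have "surj \<phi>"
  proof -
    have sub: "B.subspace (range \<phi>)"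
      unfolding B.subspace_def by (auto simp: \<phi>(1,2)[symmetric]) (metis \<phi>0 rangeI)
    have "B.E l' \<subseteq> range \<phi>" for l'
    proof
      fix y assume "y \<in> B.E l'"
      from graded_map_preimage[OF F this] obtain x where "x \<in> A.E (inv_into UNIV e l')" "F (inv_into UNIV e l') x = y" by blast
      then have "\<phi> x = y" using \<phi>(3) by metis
      then show "y \<in> range \<phi>" by blast
    qed
    then have "B.span (\<Union>l. B.E l) \<subseteq> range \<phi>" by (intro B.span_minimal[OF _ sub]) blast
    then show ?thesis using B.E_span by blast
  qed
  ultimately have "iso \<phi>" by (simp add: iso_def algebra_iso_def \<phi> br bij_def)
  then show ?thesis using \<phi>(3) graded_mapD(8)[OF F] by (intro exI[of _ \<phi>]) auto
qed

text \<open>That \<open>X\<close> maps the generators of one period lattice into the other means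
  that \<open>mb j\<close> divides \<open>ma i * X $ j $ i\<close>; the quotients are the entries of
  \<open>P\<close>.\<close>

lemma periods_matrix:
  assumes per: "\<And>i. X *v axis i (ma i) \<in> B.periods"
  shows "\<exists>P. scaled ma mb P X"
proof -
  have "(X *v axis i (ma i)) $ j = ma i * X $ j $ i" for i j
    by (simp add: matrix_vector_mult_def axis_def if_distrib mult.commute cong: if_cong)
  then have "mb j dvd ma i * X $ j $ i" for i j using per[of i] by (auto simp: B.periods_def)
  then show ?thesis
    by (intro exI[of _ "\<chi> i j. (ma i * X $ j $ i) div mb j"]) (simp add: scaled_def)
qed

lemma scaled_sym: "scaled a b X Y \<Longrightarrow> scaled b a Y X"
  by (simp add: scaled_def mult.commute)

text \<open>Both \<open>e\<close> and its inverse carry periods to periods, so both matrices rescale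
  to integral ones, which are inverse to each other by \<open>scaled_inverse\<close>.
  \<open>scaled_char\<close> then identifies the action of \<open>\<sigma>' j\<close>.\<close>

lemma graded_map_twist:
  assumes g: "graded_map e f"
  shows "\<exists>P \<phi>. invertible P \<and> twist P \<phi>"
proof -
  let ?i = "inv_into UNIV e"
  obtain h where h: "torus_pair.graded_map scale' bracket' \<zeta> \<sigma>' scale bracket \<sigma> ?i h" using graded_map_inv[OF g] by blast
  obtain \<phi> where \<phi>: "iso \<phi>" "\<And>l x. x \<in> A.E l \<Longrightarrow> \<phi> x \<in> B.E (e l)" using graded_map_iso[OF g] by blast
  define X where "X = (\<chi> j i. e (axis i 1) $ j)"
  define X' where "X' = (\<chi> i j. ?i (axis j 1) $ i)"
  have e: "e l = X *v l" for l unfolding X_def by (rule additive_int_vec[OF graded_mapD(2)[OF g]])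
  have i: "?i l = X' *v l" for l unfolding X'_def by (rule additive_int_vec[OF torus_pair.graded_mapD(2)[OF swap h]])
  have ie: "?i (e l) = l" "e (?i l) = l" for l
    using graded_mapD(1)[OF g] by (simp_all add: bij_is_inj bij_is_surj surj_f_inv_f)
  have "axis i (ma i) \<in> A.periods" for i by (simp add: A.periods_def axis_def)
  then have "X *v axis i (ma i) \<in> B.periods" for i using graded_map_period[OF g] unfolding e[symmetric] by blast
  then obtain P where P: "scaled ma mb P X" using periods_matrix by blast
  have "axis j (mb j) \<in> B.periods" for j by (simp add: B.periods_def axis_def)
  then have "X' *v axis j (mb j) \<in> A.periods" for j using torus_pair.graded_map_period[OF swap h] unfolding i[symmetric] by blast
  then obtain Q where Q: "scaled mb ma Q X'" using torus_pair.periods_matrix[OF swap] by blast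
  have nz: "ma i \<noteq> 0" "mb i \<noteq> 0" for i using A.finite_order[of i] B.finite_order[of i] by auto
  have XX: "X ** X' = mat 1" "X' ** X = mat 1"
    unfolding matrix_eq matrix_vector_mul_assoc[symmetric] e[symmetric] i[symmetric] by (simp_all add: ie)
  have "P ** Q = mat 1" by (rule scaled_inverse[OF P Q XX(2) nz(1)])
  moreover have "Q ** P = mat 1" by (rule scaled_inverse[OF Q P XX(1) nz(2)])
  ultimately have "invertible P" by (auto simp: invertible_def)
  moreover have "\<sigma>' j (\<phi> v) = \<phi> (A.aprod (\<lambda>i. P $ i $ j) v)" for j v
  proof (rule A.eq_on_E[where s=scale' and S="\<lambda>v. \<sigma>' j (\<phi> v)" and T="\<lambda>v. \<phi> (A.aprod (\<lambda>i. P $ i $ j) v)"])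
    fix l x assume x: "x \<in> A.E l"
    have "\<sigma>' j (\<phi> x) = scale' (\<zeta> (B.m j) powi ((X *v l) $ j)) (\<phi> x)"
      using \<phi>(2)[OF x] by (simp add: B.E_iff e)
    also have "\<dots> = \<phi> (A.aprod (\<lambda>i. P $ i $ j) x)"
      by (simp add: scaled_char[OF scaled_sym[OF P]] A.aprod_E[OF x] iso_scale[OF \<phi>(1)])
    finally show "\<sigma>' j (\<phi> x) = \<phi> (A.aprod (\<lambda>i. P $ i $ j) x)" .
  qed (simp_all add: iso_add[OF \<phi>(1)] iso_scale[OF \<phi>(1)] A.lin_add[OF A.lin_aprod] A.lin_scale[OF A.lin_aprod]
      B.lin_add[OF B.lin_\<sigma>] B.lin_scale[OF B.lin_\<sigma>])
  ultimately show ?thesis using \<phi>(1) unfolding twist_def by blast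
qed

end

section \<open>Bi-isomorphisms\<close>

lemma single_sum: "Poly_Mapping.single l (\<Sum>i\<in>I. y i) = (\<Sum>i\<in>I. Poly_Mapping.single l (y i))"
  by (induction I rule: infinite_finite_induct) (simp_all add: single_add)

lemma sum_single_lookup: "(\<Sum>k\<in>Poly_Mapping.keys p. Poly_Mapping.single k (Poly_Mapping.lookup p k)) = p"
  by (rule poly_mapping_eqI) (simp add: lookup_sum lookup_single when_def in_keys_iff)

lemma group_closure_image:
  assumes T: "\<And>x y. T (x - y) = T x - T y"
  shows "T ` group_closure S = group_closure (T ` S)"
proof -
  have T0: "T 0 = 0" using T[of 0 0] by simp
  show ?thesis
  proof (intro equalityI subsetI)
    fix y assume "y \<in> T ` group_closure S"
    then obtain x where "x \<in> group_closure S" "y = T x" by blast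
    then show "y \<in> group_closure (T ` S)"
    proof (induction x arbitrary: y rule: group_closure.induct)
      case (base s)
      then show ?case by (intro group_closure.base) (auto simp: T0)
    next
      case (diff s t)
      then show ?case by (auto simp: T intro: group_closure.diff)
    qed
  next
    fix y assume "y \<in> group_closure (T ` S)"
    then show "y \<in> T ` group_closure S"
    proof (induction y rule: group_closure.induct)
      case (base s)
      then have "s \<in> T ` insert 0 S" by (auto simp: T0)
      then show ?case using group_closure.base by blast
    next
      case (diff s t)
      then obtain x y where "x \<in> group_closure S" "y \<in> group_closure S" "s = T x" "t = T y" by blast
      then show ?case using T[of x y, symmetric] group_closure.diff by blast
    qed
  qed
qed

context lie_algebra
begin

lemma loop_scale_lookup: "Poly_Mapping.lookup (loop_scale c f) l = scale c (Poly_Mapping.lookup f l)"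
  by (simp add: loop_scale_def Poly_Mapping.map.rep_eq when_def)

lemma loop_bracket_single:
  "loop_bracket (Poly_Mapping.single l x) (Poly_Mapping.single k y) = Poly_Mapping.single (l + k) (bracket x y)"
proof -
  have "bracket 0 y = 0" "bracket x 0 = 0"
    using bracket_scale_left[of 0 0 y] bracket_scale_right[of x 0 0] by simp_all
  then show ?thesis by (cases "x = 0"; cases "y = 0") (simp_all add: loop_bracket_def)
qed

end

context torus
begin

text \<open>A bi-isomorphism is controlled only on bigraded components; decomposing into weight
  vectors extends this control to all of \<open>E l\<close>. It rests on the diagonalizability of
  the action of \<open>H\<close>.\<close>

lemma E_weight_decomp:
  assumes "x \<in> E l"
  shows "\<exists>u. (\<forall>\<mu>\<in>weights H UNIV. u \<mu> \<in> E l \<inter> weight_space H UNIV \<mu>) \<and> x = (\<Sum>\<mu>\<in>weights H UNIV. u \<mu>)"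
proof -
  have "bracket h v \<in> E l" if "h \<in> H" "v \<in> E l" for h v
    using E_bracket[of h 0 v l] that cartan_subset[OF cartan] by (auto simp: E_0)
  from invariant_decomp[OF cartan subspace_E this assms] show ?thesis
    by (simp only: gen_weights_eq_weights[OF cartan] gen_weight_eq_weight_space[OF cartan])
qed

end

context torus_pair
begin

lemma bi_isomorphic_graded_map:
  assumes bi: "bi_isomorphic (A.LT \<zeta> \<sigma> H) (B.LT \<zeta> \<sigma>' H')"
  shows "\<exists>e f. graded_map e f"
proof -
  let ?S = "{f :: (int^'n) \<Rightarrow>\<^sub>0 'a. \<forall>l. Poly_Mapping.lookup f l \<in> A.E l}"
  let ?S' = "{f :: (int^'n) \<Rightarrow>\<^sub>0 'b. \<forall>l. Poly_Mapping.lookup f l \<in> B.E l}"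
  obtain \<psi> \<psi>r e where
    iso: "algebra_iso A.loop_scale A.loop_bracket ?S B.loop_scale B.loop_bracket ?S' \<psi>" and
    e: "additive_iso UNIV UNIV e" and
    comp: "\<And>\<alpha> l. \<alpha> \<in> group_closure (A.weights H UNIV) \<Longrightarrow>
      \<psi> ` (Poly_Mapping.single l ` (A.weight_space H UNIV \<alpha> \<inter> A.E l))
      = Poly_Mapping.single (e l) ` (B.weight_space H' UNIV (\<psi>r \<alpha>) \<inter> B.E (e l))"
    using bi unfolding bi_isomorphic_def A.LT_def B.LT_def by auto
  have bij: "bij_betw \<psi> ?S ?S'" and padd: "\<And>p q. p \<in> ?S \<Longrightarrow> q \<in> ?S \<Longrightarrow> \<psi> (p + q) = \<psi> p + \<psi> q"
    and psc: "\<And>c p. p \<in> ?S \<Longrightarrow> \<psi> (A.loop_scale c p) = B.loop_scale c (\<psi> p)"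
    and pbr: "\<And>p q. p \<in> ?S \<Longrightarrow> q \<in> ?S \<Longrightarrow> \<psi> (A.loop_bracket p q) = B.loop_bracket (\<psi> p) (\<psi> q)"
    using iso unfolding algebra_iso_def by blast+
  have ebij: "bij e" and eadd: "\<And>l l'. e (l + l') = e l + e l'"
    using e by (auto simp: additive_iso_def)
  have S0: "0 \<in> ?S" using A.subspace_0[OF A.subspace_E] by simp
  have p0: "\<psi> 0 = 0" using padd[OF S0 S0] by simp
  have Ssum: "(\<Sum>i\<in>I. q i) \<in> ?S \<and> \<psi> (\<Sum>i\<in>I. q i) = (\<Sum>i\<in>I. \<psi> (q i))" if "\<And>i. i \<in> I \<Longrightarrow> q i \<in> ?S" for q and I :: "'c set"
    using that
  proof (induction I rule: infinite_finite_induct)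
    case (insert i I)
    have "q i + sum q I \<in> ?S" using insert A.subspace_add[OF A.subspace_E] by (simp add: lookup_add)
    then show ?case using insert padd[of "q i" "sum q I"] by simp
  qed (use S0 p0 in simp_all)
  have sS: "Poly_Mapping.single l x \<in> ?S" if "x \<in> A.E l" for l x
    using that A.subspace_0[OF A.subspace_E] by (simp add: lookup_single when_def)
  \<comment> \<open>Takes the coefficient at degree \<open>e l\<close>; the fact \<open>f\<close>
    below shows that there is no other.\<close>
  define f where "f l x = Poly_Mapping.lookup (\<psi> (Poly_Mapping.single l x)) (e l)" for l x
  have f: "\<psi> (Poly_Mapping.single l x) = Poly_Mapping.single (e l) (f l x) \<and> f l x \<in> B.E (e l)" if x: "x \<in> A.E l" for l x
  proof -
    let ?W = "A.weights H UNIV"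
    obtain u where u: "\<forall>\<mu>\<in>?W. u \<mu> \<in> A.E l \<inter> A.weight_space H UNIV \<mu>" "x = sum u ?W"
      using A.E_weight_decomp[OF x] by blast
    have "\<exists>y\<in>B.E (e l). \<psi> (Poly_Mapping.single l (u \<mu>)) = Poly_Mapping.single (e l) y" if \<mu>: "\<mu> \<in> ?W" for \<mu>
    proof -
      have "\<psi> (Poly_Mapping.single l (u \<mu>)) \<in> \<psi> ` (Poly_Mapping.single l ` (A.weight_space H UNIV \<mu> \<inter> A.E l))"
        using u(1) \<mu> by blast
      also have "\<dots> = Poly_Mapping.single (e l) ` (B.weight_space H' UNIV (\<psi>r \<mu>) \<inter> B.E (e l))"
        using \<mu> by (intro comp group_closure.base) simp
      finally show ?thesis by blast
    qed
    then obtain y where y: "\<And>\<mu>. \<mu> \<in> ?W \<Longrightarrow> y \<mu> \<in> B.E (e l)"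
      "\<And>\<mu>. \<mu> \<in> ?W \<Longrightarrow> \<psi> (Poly_Mapping.single l (u \<mu>)) = Poly_Mapping.single (e l) (y \<mu>)" by metis
    have "\<psi> (Poly_Mapping.single l x) = (\<Sum>\<mu>\<in>?W. \<psi> (Poly_Mapping.single l (u \<mu>)))"
      unfolding u(2) single_sum using u(1) by (intro Ssum[THEN conjunct2] sS) blast
    also have "\<dots> = Poly_Mapping.single (e l) (\<Sum>\<mu>\<in>?W. y \<mu>)" unfolding single_sum by (intro sum.cong refl y(2))
    finally have eq: "\<psi> (Poly_Mapping.single l x) = Poly_Mapping.single (e l) (\<Sum>\<mu>\<in>?W. y \<mu>)" .
    then have "f l x = (\<Sum>\<mu>\<in>?W. y \<mu>)" by (simp add: f_def)
    moreover have "(\<Sum>\<mu>\<in>?W. y \<mu>) \<in> B.E (e l)" by (intro B.subspace_sum[OF B.subspace_E] y(1))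
    ultimately show ?thesis using eq by simp
  qed
  note fs = f[THEN conjunct1] and fE = f[THEN conjunct2]
  have inj: "p = q" if "p \<in> ?S" "q \<in> ?S" "\<psi> p = \<psi> q" for p q
    using bij that unfolding bij_betw_def inj_on_def by blast
  have f0: "f l 0 = 0" for l by (simp add: f_def p0)
  have "graded_map e f"
    unfolding graded_map_def
  proof (intro conjI allI ballI impI ebij eadd)
    fix l x assume x: "x \<in> A.E l" "f l x = 0"
    have "\<psi> (Poly_Mapping.single l x) = \<psi> 0" using fs[OF x(1)] x(2) p0 by simp
    then have "Poly_Mapping.single l x = 0" using inj[OF sS[OF x(1)] S0] by blast
    then show "x = 0" using lookup_single_eq[of l x] by (metis lookup_zero)
  next
    fix l x y assume x: "x \<in> A.E l" and y: "y \<in> A.E l"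
    show "f l (x + y) = f l x + f l y"
      using padd[OF sS[OF x] sS[OF y]] by (simp add: f_def single_add lookup_add)
  next
    fix l c x assume x: "x \<in> A.E l"
    have "A.loop_scale c (Poly_Mapping.single l x) = Poly_Mapping.single l (scale c x)"
      by (rule poly_mapping_eqI) (simp add: A.loop_scale_lookup lookup_single when_def)
    then show "f l (scale c x) = scale' c (f l x)"
      using psc[OF sS[OF x], of c] by (simp add: f_def B.loop_scale_lookup)
  next
    fix l k x y assume x: "x \<in> A.E l" and y: "y \<in> A.E k"
    have "\<psi> (Poly_Mapping.single (l + k) (bracket x y)) = Poly_Mapping.single (e l + e k) (bracket' (f l x) (f k y))"
      using pbr[OF sS[OF x] sS[OF y]] by (simp add: A.loop_bracket_single B.loop_bracket_single fs[OF x] fs[OF y])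
    then show "f (l + k) (bracket x y) = bracket' (f l x) (f k y)" by (simp add: f_def eadd)
  next
    fix l
    show "f l ` A.E l = B.E (e l)"
    proof (intro equalityI subsetI)
      fix y assume y: "y \<in> B.E (e l)"
      have "Poly_Mapping.single (e l) y \<in> ?S'"
        using y B.subspace_0[OF B.subspace_E] by (simp add: lookup_single when_def)
      then have "Poly_Mapping.single (e l) y \<in> \<psi> ` ?S" unfolding bij_betw_imp_surj_on[OF bij] .
      \<comment> \<open>The preimage \<open>z\<close> may a priori spread over several degrees. As
        \<open>e\<close> is injective, comparing coefficients at \<open>e l\<close> singles out its
        component of degree \<open>l\<close>.\<close>
      then obtain z where z': "Poly_Mapping.single (e l) y = \<psi> z" and z1: "z \<in> ?S" by (rule imageE)
      note z = z1 z'[symmetric]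
      let ?lk = "Poly_Mapping.lookup z"
      have zE: "?lk k \<in> A.E k" for k using z(1) by simp
      have "\<psi> z = (\<Sum>k\<in>Poly_Mapping.keys z. \<psi> (Poly_Mapping.single k (?lk k)))"
        by (subst sum_single_lookup[of z, symmetric]) (intro Ssum[THEN conjunct2] sS zE)
      also have "\<dots> = (\<Sum>k\<in>Poly_Mapping.keys z. Poly_Mapping.single (e k) (f k (?lk k)))"
        by (intro sum.cong refl fs zE)
      finally have "Poly_Mapping.single (e l) y = (\<Sum>k\<in>Poly_Mapping.keys z. Poly_Mapping.single (e k) (f k (?lk k)))"
        by (simp only: z(2))
      then have "Poly_Mapping.lookup (Poly_Mapping.single (e l) y) (e l)
          = Poly_Mapping.lookup (\<Sum>k\<in>Poly_Mapping.keys z. Poly_Mapping.single (e k) (f k (?lk k))) (e l)"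
        by (rule arg_cong)
      then have "y = (\<Sum>k\<in>Poly_Mapping.keys z. Poly_Mapping.lookup (Poly_Mapping.single (e k) (f k (?lk k))) (e l))"
        by (simp only: lookup_single_eq lookup_sum)
      also have "\<dots> = (\<Sum>k\<in>Poly_Mapping.keys z. if k = l then f l (?lk l) else 0)"
        using ebij by (intro sum.cong refl) (auto simp: lookup_single when_def dest: bij_is_inj injD)
      also have "\<dots> = f l (?lk l)" by (simp add: in_keys_iff f0)
      finally show "y \<in> f l ` A.E l" using zE by blast
    qed (use fE in auto)
  qed
  then show ?thesis by blast
qed

text \<open>Degrees move by \<open>X\<close> and weights by composition with the inverse of
  \<open>\<phi>\<close>. The latter maps weights of \<open>H\<close> to weights of \<open>H'\<close>
  only because \<open>\<phi>\<close> carries \<open>H\<close> onto \<open>H'\<close>.\<close>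

lemma twist_bi_isomorphic:
  assumes t: "twist P \<phi>" and H: "\<phi> ` H = H'" and PQ: "P ** Q = mat 1" "Q ** P = mat 1"
  shows "bi_isomorphic (A.LT \<zeta> \<sigma> H) (B.LT \<zeta> \<sigma>' H')"
proof -
  have i: "iso \<phi>" using t by (simp add: twist_def)
  obtain X X' :: "int^'n^'n" where X: "X ** X' = mat 1" "X' ** X = mat 1" and XE: "\<And>l. \<phi> ` A.E l = B.E (X *v l)"
    using twist_matrix[OF t PQ] by blast
  have XX: "X *v (X' *v l) = l" "X' *v (X *v l) = l" for l
    by (simp_all add: matrix_vector_mul_assoc X)
  have injX: "inj (\<lambda>l. X' *v l)" using XX by (metis injI)
  let ?\<theta> = "inv_into UNIV \<phi>"
  note \<theta> = iso_inv_apply[OF i] and \<phi>0 = iso_0[OF i]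
  \<comment> \<open>\<open>map_key\<close> precomposes with its argument, so the inverse matrix
    \<open>X'\<close> is the one that moves degree \<open>l\<close> to
    \<open>X *v l\<close>.\<close>
  define \<psi> where "\<psi> p = Poly_Mapping.map_key (\<lambda>l. X' *v l) (Poly_Mapping.map \<phi> p)" for p :: "(int^'n) \<Rightarrow>\<^sub>0 'a"
  have lk: "Poly_Mapping.lookup (\<psi> p) l = \<phi> (Poly_Mapping.lookup p (X' *v l))" for p l
    by (simp add: \<psi>_def map_key.rep_eq[OF injX] Poly_Mapping.map.rep_eq when_def \<phi>0)
  have padd: "\<psi> (p + q) = \<psi> p + \<psi> q" for p q
    by (rule poly_mapping_eqI) (simp add: lk lookup_add iso_add[OF i])
  have psum: "\<psi> (sum g I) = (\<Sum>a\<in>I. \<psi> (g a))" for g and I :: "'c set"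
  proof (induction I rule: infinite_finite_induct)
    have "\<psi> 0 = 0" by (rule poly_mapping_eqI) (simp add: lk \<phi>0)
    then show "\<psi> (sum g I) = (\<Sum>a\<in>I. \<psi> (g a))" if "infinite I" for I :: "'c set" using that by simp
    show "\<psi> (sum g {}) = (\<Sum>a\<in>{}. \<psi> (g a))" using \<open>\<psi> 0 = 0\<close> by simp
  qed (simp add: padd)
  have psingle: "\<psi> (Poly_Mapping.single l x) = Poly_Mapping.single (X *v l) (\<phi> x)" for l x
  proof (rule poly_mapping_eqI)
    fix k
    have "l = X' *v k \<longleftrightarrow> X *v l = k" using XX by metis
    then show "Poly_Mapping.lookup (\<psi> (Poly_Mapping.single l x)) k = Poly_Mapping.lookup (Poly_Mapping.single (X *v l) (\<phi> x)) k"
      by (simp add: lk lookup_single when_def \<phi>0)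
  qed
  have nz: "\<phi> x = 0 \<longleftrightarrow> x = 0" for x using iso_eq_iff[OF i, of x 0] by (simp only: \<phi>0)
  have keys: "Poly_Mapping.keys (\<psi> p) = (\<lambda>l. X *v l) ` Poly_Mapping.keys p" for p
  proof (intro equalityI subsetI)
    fix k assume "k \<in> Poly_Mapping.keys (\<psi> p)"
    then have "X' *v k \<in> Poly_Mapping.keys p" by (simp add: in_keys_iff lk nz)
    then show "k \<in> (\<lambda>l. X *v l) ` Poly_Mapping.keys p" by (rule rev_image_eqI) (simp add: XX)
  next
    fix k assume "k \<in> (\<lambda>l. X *v l) ` Poly_Mapping.keys p"
    then obtain l where "l \<in> Poly_Mapping.keys p" "k = X *v l" by blast
    then show "k \<in> Poly_Mapping.keys (\<psi> p)" by (simp add: in_keys_iff lk XX nz)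
  qed
  have injX2: "inj_on (\<lambda>l. X *v l) I" for I using XX by (metis inj_onI)
  have pbr: "\<psi> (A.loop_bracket p q) = B.loop_bracket (\<psi> p) (\<psi> q)" for p q
  proof -
    have "B.loop_bracket (\<psi> p) (\<psi> q) = (\<Sum>l\<in>Poly_Mapping.keys p. \<Sum>k\<in>Poly_Mapping.keys q.
        Poly_Mapping.single (X *v l + X *v k) (bracket' (\<phi> (Poly_Mapping.lookup p l)) (\<phi> (Poly_Mapping.lookup q k))))"
      unfolding B.loop_bracket_def keys by (simp add: sum.reindex[OF injX2] lk XX)
    also have "\<dots> = \<psi> (A.loop_bracket p q)"
      unfolding A.loop_bracket_def psum psingle by (simp add: iso_bracket[OF i] matrix_vector_right_distrib)
    finally show ?thesis by simp
  qed
  let ?S = "{f :: (int^'n) \<Rightarrow>\<^sub>0 'a. \<forall>l. Poly_Mapping.lookup f l \<in> A.E l}"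
  let ?S' = "{f :: (int^'n) \<Rightarrow>\<^sub>0 'b. \<forall>l. Poly_Mapping.lookup f l \<in> B.E l}"
  have mE: "\<phi> x \<in> B.E (X *v l) \<longleftrightarrow> x \<in> A.E l" for x l
    unfolding XE[symmetric] using iso_eq_iff[OF i] by auto
  have "bij_betw \<psi> ?S ?S'"
    unfolding bij_betw_def
  proof (intro conjI inj_onI equalityI subsetI)
    fix p q assume e: "\<psi> p = \<psi> q"
    show "p = q"
    proof (rule poly_mapping_eqI)
      fix l
      have "Poly_Mapping.lookup (\<psi> p) (X *v l) = Poly_Mapping.lookup (\<psi> q) (X *v l)" by (simp add: e)
      then show "Poly_Mapping.lookup p l = Poly_Mapping.lookup q l" by (simp add: lk XX iso_eq_iff[OF i])
    qed
  next
    fix p' assume "p' \<in> \<psi> ` ?S"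
    then obtain p where p: "p \<in> ?S" "p' = \<psi> p" by blast
    have "\<phi> (Poly_Mapping.lookup p (X' *v l)) \<in> B.E (X *v (X' *v l))" for l using p(1) mE by blast
    then show "p' \<in> ?S'" by (simp add: p(2) lk XX)
  next
    fix p' assume p': "p' \<in> ?S'"
    define p where "p = (\<Sum>k\<in>Poly_Mapping.keys p'. Poly_Mapping.single (X' *v k) (?\<theta> (Poly_Mapping.lookup p' k)))"
    have "\<psi> p = p'" unfolding p_def psum psingle by (simp add: XX \<theta> sum_single_lookup)
    moreover have "p \<in> ?S"
    proof (rule CollectI, rule allI)
      fix l
      have "Poly_Mapping.lookup p' (X *v l) \<in> B.E (X *v l)" using p' by blast
      then have "\<phi> (Poly_Mapping.lookup p l) \<in> B.E (X *v l)" using lk[of p "X *v l"] \<open>\<psi> p = p'\<close> by (simp only: XX)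
      then show "Poly_Mapping.lookup p l \<in> A.E l" by (simp only: mE)
    qed
    ultimately show "p' \<in> \<psi> ` ?S" by blast
  qed
  moreover have "\<psi> (A.loop_scale c p) = B.loop_scale c (\<psi> p)" for c p
    by (rule poly_mapping_eqI) (simp add: lk A.loop_scale_lookup B.loop_scale_lookup iso_scale[OF i])
  ultimately have alg: "algebra_iso A.loop_scale A.loop_bracket ?S B.loop_scale B.loop_bracket ?S' \<psi>"
    unfolding algebra_iso_def using padd pbr by blast
  have ws: "B.weight_space H' UNIV \<beta> = \<phi> ` A.weight_space H UNIV (\<beta> \<circ> \<phi>)" for \<beta>
  proof (intro equalityI subsetI)
    fix y assume y: "y \<in> B.weight_space H' UNIV \<beta>"
    obtain x where x: "y = \<phi> x" using iso_bij[OF i] by (metis bij_pointE)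
    have "bracket h x = scale (\<beta> (\<phi> h)) x" if "h \<in> H" for h
    proof -
      have "\<phi> (bracket h x) = \<phi> (scale (\<beta> (\<phi> h)) x)"
        using y that H by (auto simp: B.weight_space_def x iso_bracket[OF i] iso_scale[OF i])
      then show ?thesis by (simp add: iso_eq_iff[OF i])
    qed
    then show "y \<in> \<phi> ` A.weight_space H UNIV (\<beta> \<circ> \<phi>)" by (auto simp: A.weight_space_def x)
  next
    fix y assume "y \<in> \<phi> ` A.weight_space H UNIV (\<beta> \<circ> \<phi>)"
    then show "y \<in> B.weight_space H' UNIV \<beta>"
      unfolding H[symmetric] by (auto simp: A.weight_space_def B.weight_space_def iso_bracket[OF i, symmetric] iso_scale[OF i, symmetric])
  qed
  have ds: "\<beta> \<in> B.dual_space H' \<longleftrightarrow> \<beta> \<circ> \<phi> \<in> A.dual_space H" for \<beta>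
  proof -
    have "(\<forall>x. x \<notin> \<phi> ` H \<longrightarrow> \<beta> x = 0) \<longleftrightarrow> (\<forall>x. x \<notin> H \<longrightarrow> \<beta> (\<phi> x) = 0)"
    proof
      assume *: "\<forall>x. x \<notin> \<phi> ` H \<longrightarrow> \<beta> x = 0"
      have "\<phi> x \<in> \<phi> ` H \<longleftrightarrow> x \<in> H" for x by (rule inj_image_mem_iff[OF bij_is_inj[OF iso_bij[OF i]]])
      then show "\<forall>x. x \<notin> H \<longrightarrow> \<beta> (\<phi> x) = 0" using * by blast
    next
      assume *: "\<forall>x. x \<notin> H \<longrightarrow> \<beta> (\<phi> x) = 0"
      show "\<forall>x. x \<notin> \<phi> ` H \<longrightarrow> \<beta> x = 0"
      proof (intro allI impI)
        fix y assume "y \<notin> \<phi> ` H"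
        then have "?\<theta> y \<notin> H" using \<theta>(2)[of y] by (metis imageI)
        then show "\<beta> y = 0" using * \<theta>(2)[of y] by metis
      qed
    qed
    then show ?thesis
      unfolding H[symmetric] by (simp add: A.dual_space_def B.dual_space_def iso_add[OF i] iso_scale[OF i])
  qed
  have wt: "\<beta> \<in> B.weights H' UNIV \<longleftrightarrow> \<beta> \<circ> \<phi> \<in> A.weights H UNIV" for \<beta>
  proof -
    have "\<phi> ` S = {0} \<longleftrightarrow> S = {0}" for S
      using inj_image_eq_iff[OF bij_is_inj[OF iso_bij[OF i]], of S "{0}"] \<phi>0 by simp
    then show ?thesis by (simp add: B.weights_def A.weights_def ds ws)
  qed
  \<comment> \<open>Weights are functions on the whole type, so this composition also transports
    their vanishing outside \<open>H\<close>.\<close>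
  define \<psi>r where "\<psi>r \<alpha> = \<alpha> \<circ> ?\<theta>" for \<alpha> :: "'a \<Rightarrow> 'k"
  have r1: "\<psi>r \<alpha> \<circ> \<phi> = \<alpha>" for \<alpha> by (auto simp: \<psi>r_def \<theta>)
  have r2: "\<psi>r (\<beta> \<circ> \<phi>) = \<beta>" for \<beta> by (auto simp: \<psi>r_def \<theta>)
  have wr: "\<psi>r ` A.weights H UNIV = B.weights H' UNIV"
  proof (intro equalityI subsetI)
    fix \<beta> assume "\<beta> \<in> B.weights H' UNIV"
    then show "\<beta> \<in> \<psi>r ` A.weights H UNIV" using wt r2[of \<beta>] by (intro rev_image_eqI[of "\<beta> \<circ> \<phi>"]) auto
  qed (auto simp: wt r1)
  have "\<psi>r ` group_closure (A.weights H UNIV) = group_closure (B.weights H' UNIV)"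
    unfolding wr[symmetric] by (rule group_closure_image) (auto simp: \<psi>r_def)
  moreover have "inj \<psi>r" using r1 by (metis injI)
  ultimately have lat: "additive_iso (group_closure (A.weights H UNIV)) (group_closure (B.weights H' UNIV)) \<psi>r"
    by (auto simp: additive_iso_def bij_betw_def \<psi>r_def intro: inj_on_subset)
  have "bij (\<lambda>l. X *v l)" by (rule bij_betw_byWitness[of _ "\<lambda>l. X' *v l"]) (auto simp: XX)
  then have grad: "additive_iso UNIV UNIV (\<lambda>l. X *v l)"
    by (simp add: additive_iso_def matrix_vector_right_distrib)
  have "\<psi> ` (Poly_Mapping.single l ` (A.weight_space H UNIV \<alpha> \<inter> A.E l))
      = Poly_Mapping.single (X *v l) ` (B.weight_space H' UNIV (\<psi>r \<alpha>) \<inter> B.E (X *v l))" for \<alpha> l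
  proof -
    have "\<phi> ` (A.weight_space H UNIV \<alpha> \<inter> A.E l) = B.weight_space H' UNIV (\<psi>r \<alpha>) \<inter> B.E (X *v l)"
      using image_Int[OF bij_is_inj[OF iso_bij[OF i]]] by (simp add: ws r1 XE)
    then show ?thesis by (simp add: image_image psingle flip: image_image[of "Poly_Mapping.single (X *v l)" \<phi>])
  qed
  then show ?thesis
    unfolding bi_isomorphic_def A.LT_def B.LT_def using alg lat grad
    by (intro exI[of _ \<psi>] exI[of _ \<psi>r] exI[of _ "\<lambda>l. X *v l"]) simp
qed

end

text \<open>The locale \<open>torus\<close> fixes a basis, whereas the hypotheses only assert that
  one exists.\<close>

lemma torus_exists:
  fixes scale :: "'k :: {alg_closed_field, field_char_0} \<Rightarrow> 'a :: ab_group_add \<Rightarrow> 'a"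
    and \<sigma> :: "'n :: finite \<Rightarrow> 'a \<Rightarrow> 'a"
  assumes "compatible_primitive_roots \<zeta>" "multiloop_lie_torus scale bracket \<zeta> \<sigma> H"
  shows "\<exists>Basis. torus scale bracket \<zeta> \<sigma> H Basis"
proof -
  interpret multiloop_lie_torus scale bracket \<zeta> \<sigma> H by fact
  obtain Basis where B: "finite_dimensional_vector_space scale Basis" using finite_dim by blast
  have "fin_lie scale bracket Basis"
    by (intro fin_lie.intro fin_vs_ac.intro fin_vs.intro lin_space.intro B lie_algebra_axioms vector_space_axioms)
  then have "fixed_lie scale bracket Basis \<sigma>"
    by (intro fixed_lie.intro fixed_lie_axioms.intro simple automorphism A1)
  then have "torus scale bracket \<zeta> \<sigma> H Basis"
    by (intro torus.intro torus_axioms.intro assms)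
  then show ?thesis by blast
qed

theorem theorem4p1p1:
  fixes \<zeta> :: "nat \<Rightarrow> 'k :: {alg_closed_field, field_char_0}"
    and scale :: "'k \<Rightarrow> 's :: ab_group_add \<Rightarrow> 's" and bracket :: "'s \<Rightarrow> 's \<Rightarrow> 's"
    and \<sigma> :: "'n :: finite \<Rightarrow> 's \<Rightarrow> 's" and H :: "'s set"
    and scale' :: "'k \<Rightarrow> 't :: ab_group_add \<Rightarrow> 't" and bracket' :: "'t \<Rightarrow> 't \<Rightarrow> 't"
    and \<sigma>' :: "'n \<Rightarrow> 't \<Rightarrow> 't" and H' :: "'t set"
  assumes "compatible_primitive_roots \<zeta>"
    and "multiloop_lie_torus scale bracket \<zeta> \<sigma> H"
    and "multiloop_lie_torus scale' bracket' \<zeta> \<sigma>' H'"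
  shows "(bi_isomorphic (lie_algebra.LT scale bracket \<zeta> \<sigma> H) (lie_algebra.LT scale' bracket' \<zeta> \<sigma>' H')
           \<longleftrightarrow> (\<exists>(P :: int^'n^'n) \<phi>. invertible P \<and>
                 algebra_iso scale bracket UNIV scale' bracket' UNIV \<phi> \<and>
                 (\<forall>j. \<sigma>' j = \<phi> \<circ> lie_algebra.seq_power scale bracket \<sigma> P j \<circ> inv_into UNIV \<phi>)))
       \<and> (\<forall>P :: int^'n^'n. invertible P \<longrightarrow>
            (\<exists>\<phi>. algebra_iso scale bracket UNIV scale' bracket' UNIV \<phi> \<and>
                 (\<forall>j. \<sigma>' j = \<phi> \<circ> lie_algebra.seq_power scale bracket \<sigma> P j \<circ> inv_into UNIV \<phi>)) \<longrightarrow>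
            (\<exists>\<phi>. algebra_iso scale bracket UNIV scale' bracket' UNIV \<phi> \<and>
                 (\<forall>j. \<sigma>' j = \<phi> \<circ> lie_algebra.seq_power scale bracket \<sigma> P j \<circ> inv_into UNIV \<phi>) \<and>
                 \<phi> ` H = H'))"
proof -
  obtain Basis Basis' where "torus scale bracket \<zeta> \<sigma> H Basis" "torus scale' bracket' \<zeta> \<sigma>' H' Basis'"
    using torus_exists assms by metis
  then interpret torus_pair scale bracket \<zeta> \<sigma> H Basis scale' bracket' \<sigma>' H' Basis'
    by (rule torus_pair.intro)
  have cartan: "\<exists>\<phi>. twist P \<phi> \<and> \<phi> ` H = H'" if "invertible P" "twist P \<phi>" for P \<phi>
    using that twist_cartan unfolding invertible_def by blast
  have "bi_isomorphic (A.LT \<zeta> \<sigma> H) (B.LT \<zeta> \<sigma>' H') \<longleftrightarrow> (\<exists>P \<phi>. invertible P \<and> twist P \<phi>)"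
  proof
    assume "bi_isomorphic (A.LT \<zeta> \<sigma> H) (B.LT \<zeta> \<sigma>' H')"
    then show "\<exists>P \<phi>. invertible P \<and> twist P \<phi>" using bi_isomorphic_graded_map graded_map_twist by blast
  next
    assume "\<exists>P \<phi>. invertible P \<and> twist P \<phi>"
    then obtain P \<phi> where P: "invertible P" "twist P \<phi>" by blast
    \<comment> \<open>The given isomorphism must first be replaced by one that matches the Cartan
      subalgebras.\<close>
    from cartan[OF this] obtain \<phi>' where "twist P \<phi>'" "\<phi>' ` H = H'" by blast
    then show "bi_isomorphic (A.LT \<zeta> \<sigma> H) (B.LT \<zeta> \<sigma>' H')"
      using P(1) twist_bi_isomorphic unfolding invertible_def by blast
  qed
  moreover have "\<forall>P. invertible P \<longrightarrow> (\<exists>\<phi>. twist P \<phi>) \<longrightarrow> (\<exists>\<phi>. twist P \<phi> \<and> \<phi> ` H = H')"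
    using cartan by blast
  ultimately show ?thesis
    by (simp only: twist_iff[symmetric] conj_assoc)
qed

end
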